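(* The contravariant functors $\mathrm{Fun}(-;\mathcal C)$ and $\ell(-)$, from the category $\mathbf{qSet}$ of quantum sets and functions to the category of unital $*$-algebras over $\mathbb C$ and unital $*$-homomorphisms, are naturally isomorphic. The natural isomorphism takes each function $F\colon\mathcal X\to\mathcal C$ to the operator $F^\star(s)\in\ell(\mathcal X)$.
   Context: A quantum set $\mathcal X$ is determined by a set $\mathrm{At}(\mathcal X)$ of nonzero finite-dimensional complex Hilbert spaces, called its atoms; $X\propto\mathcal X$ means $X\in\mathrm{At}(\mathcal X)$. A binary relation $R$ from $\mathcal X$ to $\mathcal Y$ assigns to each $X\propto\mathcal X$, $Y\propto\mathcal Y$ a linear subspace $R(X,Y)\le L(X,Y)$ of the space of linear operators $X\to Y$. Composition: $(S\circ R)(X,Z)=\mathrm{span}\{sr : Y\propto\mathcal Y,\ s\in S(Y,Z),\ r\in R(X,Y)\}$. Identity: $I_{\mathcal X}(X,X)=\mathbb C\cdot 1_X$, $I_{\mathcal X}(X,X')=0$ for $X\ne X'$. Adjoint: $R^\dagger(Y,X)=\{r^\dagger: r\in R(X,Y)\}$. Order: $R\le S$ iff $R(X,Y)\le S(X,Y)$ for all $X,Y$. A function $F\colon\mathcal X\to\mathcal Y$ is a binary relation with $F^\dagger\circ F\ge I_{\mathcal X}$ and $F\circ F^\dagger\le I_{\mathcal Y}$; $\mathrm{Fun}(\mathcal X;\mathcal Y)$ is the set of functions from $\mathcal X$ to $\mathcal Y$. $\mathbf{qSet}$ is the category of quantum sets and functions; it has all small limits and colimits, and $\mathcal X*\mathcal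 Y$ denotes the category-theoretic product in $\mathbf{qSet}$, with projections $Q_1,Q_2$ and pairing $\langle F_1,F_2\rangle$. For an ordinary set $S$, $`S$ is the quantum set with one one-dimensional atom $\mathbb C_\alpha=\ell^2(\{\alpha\})$ for each $\alpha\in S$ (distinct for distinct $\alpha$); an ordinary function $f\colon S\to S'$ gives $`f\colon `S\to`S'$ with $`f(\mathbb C_\alpha,\mathbb C_{\beta})=L(\mathbb C_\alpha,\mathbb C_\beta)$ if $f(\alpha)=\beta$ and $0$ otherwise. $\ell(\mathcal X)=\prod_{X\propto\mathcal X}L(X)$, $L(X)=L(X,X)$, a unital $*$-algebra with the Hermitian adjoint as involution. For a function $F\colon\mathcal X\to\mathcal Y$, each $F(X,Y)$ carries the inner product defined by $(v|v')1_Y=v'v^\dagger$; choosing orthonormal bases $B_X^Y$ of $F(X,Y)$, the unital $*$-homomorphism $F^\star\colon\ell(\mathcal Y)\to\ell(\mathcal X)$ is $F^\star(b)(X)=\sum_{Y\propto\mathcal Y}\sum_{v\in B_X^Y}v^\dagger b(Y)v$ (a finite sum for each $X$, independent of choices). The functor $\ell(-)$ takes $F$ to $F^\star$; the functor $\mathrm{Fun}(-;\mathcal C)$ takes $F$ to precomposition by $F$. Define $\mathcal C=`\mathbb R*`\mathbb R$, let $r\in\ell(`\mathbb R)$ be given by $r(\mathbb C_\alpha)=\alpha$, and let $s=Q_1^\star(r)+iQ_2^\star(r)\in\ell(\mathcal C)$. For every quantum set $\mathcal X$ and $a\in\ell(\mathcal X)$ there is a unique function $F\colon\mathcal X\to\mathcal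 C$ with $F^\star(s)=a$; hence one may define functions $\boldsymbol{+}\colon\mathcal C*\mathcal C\to\mathcal C$ by $\boldsymbol{+}^\star(s)=Q_1^\star(s)+Q_2^\star(s)$, $\boldsymbol{\cdot}\colon\mathcal C*\mathcal C\to\mathcal C$ by $\boldsymbol{\cdot}^\star(s)=Q_1^\star(s)Q_2^\star(s)$ (with $Q_1,Q_2\colon\mathcal C*\mathcal C\to\mathcal C$ the projections), and $\overline{\phantom{s}}\colon\mathcal C\to\mathcal C$ by $\overline{\phantom{s}}^\star(s)=s^\dagger$. The inclusion $`\mathbb C\hookrightarrow\mathcal C$ is the function $\langle P_1,P_2\rangle$, where $P_1,P_2\colon`\mathbb C\cong`\mathbb R\times`\mathbb R\to`\mathbb R$ are induced by real part and imaginary part. The $*$-algebra structure on $\mathrm{Fun}(\mathcal X;\mathcal C)$: $F_1+F_2=\boldsymbol{+}\circ\langle F_1,F_2\rangle$, $F_1\cdot F_2=\boldsymbol{\cdot}\circ\langle F_1,F_2\rangle$, involution $\overline{F_1}=\overline{\phantom{s}}\circ F_1$, and each $\alpha\in\mathbb C$ is represented by the constant function $\mathrm{Cst}_\alpha\colon\mathcal X\xrightarrow{!}`\{\ast\}\xrightarrow{`\alpha}`\mathbb C\hookrightarrow\mathcal C$, where $!$ is the unique function to the terminal object $`\{\ast\}$ and $\alpha$ denotes the function $\{\ast\}\to\mathbb C$ with value $\alpha$ (so scalar multiplication is $\alpha F=\mathrm{Cst}_\alpha\cdot F$ and the unit is $\mathrm{Cst}_1$). *)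

theory Defs
  imports Complex_Main "HOL-Library.Function_Algebras" "HOL-Library.FuncSet" "HOL-Algebra.Module"
begin

section \<open>Finite-dimensional Hilbert spaces and operators\<close>

text \<open>
  The set-theoretic universe of Hilbert spaces is rendered by a universe of vectors: the complex
  vector space of all functions \<open>'p \<Rightarrow> complex\<close>. A Hilbert space is a linear subspace of
  it together with an arbitrary inner product, not related to the coordinates of the universe.
\<close>

definition cscale :: "complex \<Rightarrow> ('p \<Rightarrow> complex) \<Rightarrow> ('p \<Rightarrow> complex)" where
  "cscale c x = (\<lambda>i. c * x i)"

type_synonym 'p operator = "('p \<Rightarrow> complex) \<Rightarrow> ('p \<Rightarrow> complex)"

definition opscale :: "complex \<Rightarrow> 'p operator \<Rightarrow> 'p operator" where
  "opscale c r = (\<lambda>x. cscale c (r x))"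

interpretation cvec: vector_space cscale
  by unfold_locales (auto simp: cscale_def fun_eq_iff algebra_simps)

interpretation op: vector_space opscale
  by unfold_locales (auto simp: opscale_def cscale_def fun_eq_iff algebra_simps)

record 'p hilb = "('p \<Rightarrow> complex) partial_object" +
  ip :: "('p \<Rightarrow> complex) \<Rightarrow> ('p \<Rightarrow> complex) \<Rightarrow> complex"

text \<open>
  The inner product is linear in the second argument. It is required to vanish off the carrier so
  that two Hilbert spaces with the same vectors and the same inner product are equal.
\<close>

definition fd_hilbert :: "'p hilb \<Rightarrow> bool" where
  "fd_hilbert H \<longleftrightarrow>
     cvec.subspace (carrier H) \<and>
     (\<exists>B. finite B \<and> carrier H = cvec.span B) \<and>
     (\<forall>x\<in>carrier H. \<forall>y\<in>carrier H. \<forall>z\<in>carrier H. ip H x (y + z) = ip H x y + ip H x z) \<and>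
     (\<forall>c. \<forall>x\<in>carrier H. \<forall>y\<in>carrier H. ip H x (cscale c y) = c * ip H x y) \<and>
     (\<forall>x\<in>carrier H. \<forall>y\<in>carrier H. ip H y x = cnj (ip H x y)) \<and>
     (\<forall>x\<in>carrier H. x \<noteq> 0 \<longrightarrow> Im (ip H x x) = 0 \<and> Re (ip H x x) > 0) \<and>
     (\<forall>x y. x \<notin> carrier H \<or> y \<notin> carrier H \<longrightarrow> ip H x y = 0)"

text \<open>
  Linear operators from \<open>X\<close> to \<open>Y\<close>, represented by their extension by \<open>0\<close> off \<open>X\<close>. With this
  convention \<open>L X Y\<close> is a subspace for the pointwise operations, and composition of operators is
  composition of functions.
\<close>

definition L :: "'p hilb \<Rightarrow> 'p hilb \<Rightarrow> 'p operator set" where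
  "L X Y = {r. (\<forall>x\<in>carrier X. r x \<in> carrier Y) \<and>
               (\<forall>x\<in>carrier X. \<forall>x'\<in>carrier X. r (x + x') = r x + r x') \<and>
               (\<forall>c. \<forall>x\<in>carrier X. r (cscale c x) = cscale c (r x)) \<and>
               (\<forall>x. x \<notin> carrier X \<longrightarrow> r x = 0)}"

definition idop :: "'p hilb \<Rightarrow> 'p operator" where
  "idop X = (\<lambda>x. if x \<in> carrier X then x else 0)"

definition adj :: "'p hilb \<Rightarrow> 'p hilb \<Rightarrow> 'p operator \<Rightarrow> 'p operator" where
  "adj X Y r = (THE t. t \<in> L Y X \<and>
                 (\<forall>x\<in>carrier X. \<forall>y\<in>carrier Y. ip X (t y) x = ip Y y (r x)))"


section \<open>Quantum sets, binary relations, functions\<close>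

text \<open>A quantum set is identified with its set of atoms.\<close>

type_synonym 'p qset = "'p hilb set"

definition quantum_set :: "'p qset \<Rightarrow> bool" where
  "quantum_set XX \<longleftrightarrow> (\<forall>X\<in>XX. fd_hilbert X \<and> carrier X \<noteq> {0})"

text \<open>
  The entries of a binary relation at pairs that are not pairs of atoms are set to \<open>{0}\<close>, so that
  equality of relations is equality of HOL functions.
\<close>

type_synonym 'p qrel = "'p hilb \<Rightarrow> 'p hilb \<Rightarrow> 'p operator set"

definition binrel :: "'p qset \<Rightarrow> 'p qset \<Rightarrow> 'p qrel \<Rightarrow> bool" where
  "binrel XX YY R \<longleftrightarrow>
     (\<forall>X\<in>XX. \<forall>Y\<in>YY. op.subspace (R X Y) \<and> R X Y \<subseteq> L X Y) \<and>
     (\<forall>X Y. X \<notin> XX \<or> Y \<notin> YY \<longrightarrow> R X Y = {0})"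

text \<open>The first argument of \<open>qcomp\<close> is the quantum set in the middle.\<close>

definition qcomp :: "'p qset \<Rightarrow> 'p qrel \<Rightarrow> 'p qrel \<Rightarrow> 'p qrel" where
  "qcomp YY S R = (\<lambda>X Z. op.span {s \<circ> r | Y s r. Y \<in> YY \<and> s \<in> S Y Z \<and> r \<in> R X Y})"

definition qid :: "'p qset \<Rightarrow> 'p qrel" where
  "qid XX = (\<lambda>X X'. if X \<in> XX \<and> X' = X then {opscale c (idop X) | c. True} else {0})"

definition qadj :: "'p qrel \<Rightarrow> 'p qrel" where
  "qadj R = (\<lambda>Y X. adj X Y ` R X Y)"

definition qle :: "'p qset \<Rightarrow> 'p qset \<Rightarrow> 'p qrel \<Rightarrow> 'p qrel \<Rightarrow> bool" where
  "qle XX YY R S \<longleftrightarrow> (\<forall>X\<in>XX. \<forall>Y\<in>YY. R X Y \<subseteq> S X Y)"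

definition Fun :: "'p qset \<Rightarrow> 'p qset \<Rightarrow> 'p qrel set" where
  "Fun XX YY = {F. binrel XX YY F \<and>
                   qle XX XX (qid XX) (qcomp YY (qadj F) F) \<and>
                   qle YY YY (qcomp XX F (qadj F)) (qid YY)}"

record 'p qproduct =
  obj :: "'p qset"
  pr1 :: "'p qrel"
  pr2 :: "'p qrel"

definition is_product :: "'p qset \<Rightarrow> 'p qset \<Rightarrow> 'p qproduct \<Rightarrow> bool" where
  "is_product XX YY P \<longleftrightarrow>
     quantum_set (obj P) \<and> pr1 P \<in> Fun (obj P) XX \<and> pr2 P \<in> Fun (obj P) YY \<and>
     (\<forall>ZZ F1 F2. quantum_set ZZ \<longrightarrow> F1 \<in> Fun ZZ XX \<longrightarrow> F2 \<in> Fun ZZ YY \<longrightarrow>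
        (\<exists>!H. H \<in> Fun ZZ (obj P) \<and>
              qcomp (obj P) (pr1 P) H = F1 \<and> qcomp (obj P) (pr2 P) H = F2))"

definition pairing :: "'p qproduct \<Rightarrow> 'p qset \<Rightarrow> 'p qrel \<Rightarrow> 'p qrel \<Rightarrow> 'p qrel" where
  "pairing P ZZ F1 F2 =
     (THE H. H \<in> Fun ZZ (obj P) \<and>
             qcomp (obj P) (pr1 P) H = F1 \<and> qcomp (obj P) (pr2 P) H = F2)"


section \<open>Ordinary sets as quantum sets\<close>

definition ell2 :: "'p \<Rightarrow> 'p hilb" where
  "ell2 \<alpha> = \<lparr>carrier = {x. \<forall>i. i \<noteq> \<alpha> \<longrightarrow> x i = 0},
            ip = (\<lambda>x y. if (\<forall>i. i \<noteq> \<alpha> \<longrightarrow> x i = 0 \<and> y i = 0) then cnj (x \<alpha>) * y \<alpha> else 0)\<rparr>"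

definition quote_set :: "'p set \<Rightarrow> 'p qset" where
  "quote_set S = ell2 ` S"

definition quote_fun :: "'p set \<Rightarrow> ('p \<Rightarrow> 'p) \<Rightarrow> 'p qrel" where
  "quote_fun S f = (\<lambda>X Y. if \<exists>\<alpha>\<in>S. X = ell2 \<alpha> \<and> Y = ell2 (f \<alpha>) then L X Y else {0})"

text \<open>
  Coordinates of the vector universe: it must contain the elements of the ordinary sets
  \<open>\<real>\<close>, \<open>\<complex>\<close> and \<open>{*}\<close>. The parameter \<open>'i\<close> is an arbitrary further set of coordinates, so that the
  universe can be taken as large as desired. If \<open>\<kappa>\<close> is the cardinality of \<open>'i point\<close>, which is at
  least that of the continuum, then for each \<open>n > 0\<close> there are exactly \<open>2\<^sup>\<kappa>\<close> Hilbert
  spaces of dimension \<open>n\<close> in the universe, and products of two quantum sets exist in it.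
\<close>

datatype 'i point = Star | RealPt real | ComplexPt complex | OtherPt 'i

abbreviation qReal :: "'i point qset" where
  "qReal \<equiv> quote_set (range RealPt)"

abbreviation qComplex :: "'i point qset" where
  "qComplex \<equiv> quote_set (range ComplexPt)"

abbreviation qOne :: "'i point qset" where
  "qOne \<equiv> quote_set {Star}"


section \<open>Unital *-algebras over the complex numbers\<close>

record 'a star_algebra = "(complex, 'a) module" +
  star :: "'a \<Rightarrow> 'a"

definition complex_ring :: "complex ring" where
  "complex_ring = \<lparr>carrier = UNIV, mult = (*), one = 1, zero = 0, add = (+)\<rparr>"

definition unital_star_algebra :: "'a star_algebra \<Rightarrow> bool" where
  "unital_star_algebra A \<longleftrightarrow>
     Module.module complex_ring A \<and> Ring.ring A \<and>
     (\<forall>c. \<forall>x\<in>carrier A. \<forall>y\<in>carrier A.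
        (c \<odot>\<^bsub>A\<^esub> x) \<otimes>\<^bsub>A\<^esub> y = c \<odot>\<^bsub>A\<^esub> (x \<otimes>\<^bsub>A\<^esub> y) \<and>
        x \<otimes>\<^bsub>A\<^esub> (c \<odot>\<^bsub>A\<^esub> y) = c \<odot>\<^bsub>A\<^esub> (x \<otimes>\<^bsub>A\<^esub> y)) \<and>
     (\<forall>x\<in>carrier A. star A x \<in> carrier A \<and> star A (star A x) = x) \<and>
     (\<forall>x\<in>carrier A. \<forall>y\<in>carrier A.
        star A (x \<oplus>\<^bsub>A\<^esub> y) = star A x \<oplus>\<^bsub>A\<^esub> star A y \<and>
        star A (x \<otimes>\<^bsub>A\<^esub> y) = star A y \<otimes>\<^bsub>A\<^esub> star A x) \<and>
     (\<forall>c. \<forall>x\<in>carrier A. star A (c \<odot>\<^bsub>A\<^esub> x) = cnj c \<odot>\<^bsub>A\<^esub> star A x)"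

definition star_hom :: "'a star_algebra \<Rightarrow> 'b star_algebra \<Rightarrow> ('a \<Rightarrow> 'b) set" where
  "star_hom A B = {h. h \<in> ring_hom A B \<and>
     (\<forall>c. \<forall>x\<in>carrier A. h (c \<odot>\<^bsub>A\<^esub> x) = c \<odot>\<^bsub>B\<^esub> h x) \<and>
     (\<forall>x\<in>carrier A. h (star A x) = star B (h x))}"

definition star_iso :: "'a star_algebra \<Rightarrow> 'b star_algebra \<Rightarrow> ('a \<Rightarrow> 'b) set" where
  "star_iso A B = {h. h \<in> star_hom A B \<and> bij_betw h (carrier A) (carrier B)}"

text \<open>
  A contravariant functor from quantum sets and functions to unital *-algebras is given by its
  object map \<open>A\<close> and its arrow map \<open>m\<close>; \<open>m XX YY F\<close> is the image of \<open>F \<in> Fun XX YY\<close>.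
\<close>

definition contravariant_functor ::
  "('p qset \<Rightarrow> 'a star_algebra) \<Rightarrow> ('p qset \<Rightarrow> 'p qset \<Rightarrow> 'p qrel \<Rightarrow> 'a \<Rightarrow> 'a) \<Rightarrow> bool" where
  "contravariant_functor A m \<longleftrightarrow>
     (\<forall>XX. quantum_set XX \<longrightarrow> unital_star_algebra (A XX)) \<and>
     (\<forall>XX YY F. quantum_set XX \<longrightarrow> quantum_set YY \<longrightarrow> F \<in> Fun XX YY \<longrightarrow>
        m XX YY F \<in> star_hom (A YY) (A XX)) \<and>
     (\<forall>XX. quantum_set XX \<longrightarrow> (\<forall>x\<in>carrier (A XX). m XX XX (qid XX) x = x)) \<and>
     (\<forall>XX YY ZZ F G. quantum_set XX \<longrightarrow> quantum_set YY \<longrightarrow> quantum_set ZZ \<longrightarrow>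
        F \<in> Fun XX YY \<longrightarrow> G \<in> Fun YY ZZ \<longrightarrow>
        (\<forall>x\<in>carrier (A ZZ). m XX ZZ (qcomp YY G F) x = m XX YY F (m YY ZZ G x)))"

definition natural_isomorphism ::
  "('p qset \<Rightarrow> 'a star_algebra) \<Rightarrow> ('p qset \<Rightarrow> 'p qset \<Rightarrow> 'p qrel \<Rightarrow> 'a \<Rightarrow> 'a) \<Rightarrow>
   ('p qset \<Rightarrow> 'b star_algebra) \<Rightarrow> ('p qset \<Rightarrow> 'p qset \<Rightarrow> 'p qrel \<Rightarrow> 'b \<Rightarrow> 'b) \<Rightarrow>
   ('p qset \<Rightarrow> 'a \<Rightarrow> 'b) \<Rightarrow> bool" where
  "natural_isomorphism A m B n \<eta> \<longleftrightarrow>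
     (\<forall>XX. quantum_set XX \<longrightarrow> \<eta> XX \<in> star_iso (A XX) (B XX)) \<and>
     (\<forall>XX YY F. quantum_set XX \<longrightarrow> quantum_set YY \<longrightarrow> F \<in> Fun XX YY \<longrightarrow>
        (\<forall>x\<in>carrier (A YY). \<eta> XX (m XX YY F x) = n XX YY F (\<eta> YY x)))"


section \<open>The functor \<open>\<ell>\<close>\<close>

type_synonym 'p family = "'p hilb \<Rightarrow> 'p operator"

definition ell :: "'p qset \<Rightarrow> 'p family star_algebra" where
  "ell XX = \<lparr>carrier = (\<Pi>\<^sub>E X\<in>XX. L X X),
     mult = (\<lambda>a b. \<lambda>X\<in>XX. a X \<circ> b X),
     one = (\<lambda>X\<in>XX. idop X),
     zero = (\<lambda>X\<in>XX. 0),
     add = (\<lambda>a b. \<lambda>X\<in>XX. a X + b X),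
     smult = (\<lambda>c a. \<lambda>X\<in>XX. opscale c (a X)),
     star = (\<lambda>a. \<lambda>X\<in>XX. adj X X (a X))\<rparr>"

definition fun_ip :: "'p hilb \<Rightarrow> 'p hilb \<Rightarrow> 'p operator \<Rightarrow> 'p operator \<Rightarrow> complex" where
  "fun_ip X Y v v' = (THE c. opscale c (idop Y) = v' \<circ> adj X Y v)"

definition orthonormal_basis :: "'p hilb \<Rightarrow> 'p hilb \<Rightarrow> 'p operator set \<Rightarrow> 'p operator set \<Rightarrow> bool" where
  "orthonormal_basis X Y V B \<longleftrightarrow>
     finite B \<and> B \<subseteq> V \<and> op.span B = V \<and>
     (\<forall>v\<in>B. \<forall>v'\<in>B. fun_ip X Y v v' = (if v = v' then 1 else 0))"

text \<open>
  The atoms \<open>Y\<close> with \<open>F X Y = {0}\<close> are left out because they contribute \<open>0\<close> and the remaining sum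
  is finite; HOL sums over infinite sets are \<open>0\<close> by convention.
\<close>

definition pull :: "'p qset \<Rightarrow> 'p qset \<Rightarrow> 'p qrel \<Rightarrow> 'p family \<Rightarrow> 'p family" where
  "pull XX YY F b = (\<lambda>X\<in>XX. \<Sum>Y\<in>{Y\<in>YY. F X Y \<noteq> {0}}.
     \<Sum>v\<in>(SOME B. orthonormal_basis X Y (F X Y) B). adj X Y v \<circ> b Y \<circ> v)"


section \<open>The quantum set \<open>C\<close> and the functor \<open>Fun(-;C)\<close>\<close>

text \<open>
  Below, \<open>C\<close> is a product of \<open>qReal\<close> with itself, and \<open>D\<close> is a product of \<open>obj C\<close> with itself.
\<close>

definition r_elem :: "'i point family" where
  "r_elem = (\<lambda>X\<in>qReal. opscale (of_real (THE \<alpha>. X = ell2 (RealPt \<alpha>))) (idop X))"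

definition s_elem :: "'i point qproduct \<Rightarrow> 'i point family" where
  "s_elem C = pull (obj C) qReal (pr1 C) r_elem \<oplus>\<^bsub>ell (obj C)\<^esub>
     (\<i> \<odot>\<^bsub>ell (obj C)\<^esub> pull (obj C) qReal (pr2 C) r_elem)"

definition plus_fun :: "'i point qproduct \<Rightarrow> 'i point qproduct \<Rightarrow> 'i point qrel" where
  "plus_fun C D = (THE F. F \<in> Fun (obj D) (obj C) \<and>
     pull (obj D) (obj C) F (s_elem C) =
       pull (obj D) (obj C) (pr1 D) (s_elem C) \<oplus>\<^bsub>ell (obj D)\<^esub>
       pull (obj D) (obj C) (pr2 D) (s_elem C))"

definition times_fun :: "'i point qproduct \<Rightarrow> 'i point qproduct \<Rightarrow> 'i point qrel" where
  "times_fun C D = (THE F. F \<in> Fun (obj D) (obj C) \<and>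
     pull (obj D) (obj C) F (s_elem C) =
       pull (obj D) (obj C) (pr1 D) (s_elem C) \<otimes>\<^bsub>ell (obj D)\<^esub>
       pull (obj D) (obj C) (pr2 D) (s_elem C))"

definition conj_fun :: "'i point qproduct \<Rightarrow> 'i point qrel" where
  "conj_fun C = (THE F. F \<in> Fun (obj C) (obj C) \<and>
     pull (obj C) (obj C) F (s_elem C) = star (ell (obj C)) (s_elem C))"

definition re_fun :: "'i point qrel" where
  "re_fun = quote_fun (range ComplexPt)
     (\<lambda>p. case p of ComplexPt z \<Rightarrow> RealPt (Re z) | _ \<Rightarrow> undefined)"

definition im_fun :: "'i point qrel" where
  "im_fun = quote_fun (range ComplexPt)
     (\<lambda>p. case p of ComplexPt z \<Rightarrow> RealPt (Im z) | _ \<Rightarrow> undefined)"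

definition incl :: "'i point qproduct \<Rightarrow> 'i point qrel" where
  "incl C = pairing C qComplex re_fun im_fun"

definition bang :: "'i point qset \<Rightarrow> 'i point qrel" where
  "bang XX = (THE F. F \<in> Fun XX qOne)"

definition Cst :: "'i point qproduct \<Rightarrow> 'i point qset \<Rightarrow> complex \<Rightarrow> 'i point qrel" where
  "Cst C XX \<alpha> = qcomp qComplex (incl C)
     (qcomp qOne (quote_fun {Star} (\<lambda>_. ComplexPt \<alpha>)) (bang XX))"

definition Fun_add ::
  "'i point qproduct \<Rightarrow> 'i point qproduct \<Rightarrow> 'i point qset \<Rightarrow> 'i point qrel \<Rightarrow> 'i point qrel \<Rightarrow> 'i point qrel" where
  "Fun_add C D XX F1 F2 = qcomp (obj D) (plus_fun C D) (pairing D XX F1 F2)"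

definition Fun_mult ::
  "'i point qproduct \<Rightarrow> 'i point qproduct \<Rightarrow> 'i point qset \<Rightarrow> 'i point qrel \<Rightarrow> 'i point qrel \<Rightarrow> 'i point qrel" where
  "Fun_mult C D XX F1 F2 = qcomp (obj D) (times_fun C D) (pairing D XX F1 F2)"

definition Fun_alg ::
  "'i point qproduct \<Rightarrow> 'i point qproduct \<Rightarrow> 'i point qset \<Rightarrow> 'i point qrel star_algebra" where
  "Fun_alg C D XX = \<lparr>carrier = Fun XX (obj C),
     mult = Fun_mult C D XX,
     one = Cst C XX 1,
     zero = Cst C XX 0,
     add = Fun_add C D XX,
     smult = (\<lambda>\<alpha> F. Fun_mult C D XX (Cst C XX \<alpha>) F),
     star = (\<lambda>F. qcomp (obj C) (conj_fun C) F)\<rparr>"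

definition precomp :: "'p qset \<Rightarrow> 'p qset \<Rightarrow> 'p qrel \<Rightarrow> 'p qrel \<Rightarrow> 'p qrel" where
  "precomp XX YY F G = qcomp YY G F"

end

theory Submission
  imports Defs "HOL-Computational_Algebra.Fundamental_Theorem_Algebra"
begin

text \<open>
  For a function \<open>F\<close>, the element \<open>F\<^sup>\<star>(b)\<close> is the only \<open>a\<close> with \<open>v a(X) = b(Y) v\<close> for all
  \<open>v \<in> F(X,Y)\<close>: such an \<open>a\<close> is unique because \<open>1\<close> is a linear combination of operators
  \<open>v'\<^sup>\<dagger>v\<close>. In this form it is evident that \<open>F\<^sup>\<star>\<close> is a *-homomorphism and functorial in \<open>F\<close>.
  By the spectral theorem, functions to the quantum set of reals correspond to self-adjoint
  elements \<open>a\<close>; the entry at \<open>\<alpha>\<close> is the space of all \<open>v\<close> with \<open>v a(X) = \<alpha> v\<close>. By the universal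
  property of the product, functions to \<open>C\<close> therefore correspond to pairs of self-adjoint elements,
  that is, to arbitrary elements of \<open>\<ell>(X)\<close>. The algebra structure on functions and its naturality
  are then transported along this injective correspondence.
\<close>

section \<open>Orthonormal bases\<close>

text \<open>Two features of the encoding shape the proof. Operators are functions extended by
  \<open>0\<close>, so composition is additive in the left factor by mere evaluation, but in the
  right factor only when the left one is linear and the values stay in its source. Inductions over
  spans therefore carry membership in \<open>L\<close> along. Moreover \<open>pull\<close> picks its
  bases by \<open>SOME\<close>: the intertwining condition makes the choice invisible, but bases
  must exist at all, so each F(X,Y) has to be shown finite-dimensional with a positive form.
  Gram-Schmidt is thus needed for vectors in an atom and for operators in F(X,Y) alike, hence the
  abstract setting here. One-dimensional targets make the real case tractable. Between equal atoms
  every operator is a scalar, so the condition on F F\<dagger> has content only between different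
  atoms, where it becomes the orthogonality of eigenspaces. The products \<open>C\<close> and
  \<open>D\<close> enter through their universal property alone and are never constructed.\<close>

locale inner_form = vector_space scale
  for scale :: "complex \<Rightarrow> 'v::ab_group_add \<Rightarrow> 'v" (infixr \<open>*s\<close> 75) +
  fixes V :: "'v set" and form :: "'v \<Rightarrow> 'v \<Rightarrow> complex"
  assumes sub: "subspace V"
    and form_add: "\<lbrakk>x \<in> V; y \<in> V; z \<in> V\<rbrakk> \<Longrightarrow> form x (y + z) = form x y + form x z"
    and form_scale: "\<lbrakk>x \<in> V; y \<in> V\<rbrakk> \<Longrightarrow> form x (c *s y) = c * form x y"
    and form_herm: "\<lbrakk>x \<in> V; y \<in> V\<rbrakk> \<Longrightarrow> form y x = cnj (form x y)"
    and form_pos: "\<lbrakk>x \<in> V; x \<noteq> 0\<rbrakk> \<Longrightarrow> Im (form x x) = 0 \<and> Re (form x x) > 0"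
begin

definition orthonormal :: "'v set \<Rightarrow> bool" where
  "orthonormal B \<longleftrightarrow> finite B \<and> B \<subseteq> V \<and> (\<forall>v\<in>B. \<forall>w\<in>B. form v w = (if v = w then 1 else 0))"

text \<open>For orthonormal \<open>B\<close> this is the orthogonal projection onto the span of
  \<open>B\<close>. The form is linear in its second argument, so \<open>x\<close> has to stand
  there for the map to be linear.\<close>

definition proj :: "'v set \<Rightarrow> 'v \<Rightarrow> 'v" where
  "proj B x = (\<Sum>b\<in>B. form b x *s b)"

lemma form_zero: "x \<in> V \<Longrightarrow> form x 0 = 0"
  using form_scale[of x 0 0] sub by (simp add: subspace_0)

lemma form_sum:
  assumes "x \<in> V" "finite B" "B \<subseteq> V"
  shows "form x (\<Sum>b\<in>B. c b *s b) = (\<Sum>b\<in>B. c b * form x b)"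
  using assms(2,3)
proof (induction B rule: finite_induct)
  case (insert b B)
  then have "(\<Sum>b\<in>B. c b *s b) \<in> V" "c b *s b \<in> V"
    using sub by (auto intro!: subspace_sum subspace_scale)
  then show ?case
    using insert assms(1) by (simp add: form_add form_scale)
qed (simp add: form_zero assms(1))

lemma proj_in: "B \<subseteq> V \<Longrightarrow> proj B x \<in> V"
  unfolding proj_def using subspace_sum[OF sub] subspace_scale[OF sub] by (metis (no_types, lifting) subset_iff)

lemma proj_in_span: "proj B x \<in> span B"
  unfolding proj_def by (intro span_sum span_scale span_base)

lemma form_sum_orthonormal:
  assumes "orthonormal B" "b \<in> B"
  shows "form b (\<Sum>v\<in>B. c v *s v) = c b"
proof -
  have "form b (\<Sum>v\<in>B. c v *s v) = (\<Sum>v\<in>B. c v * form b v)"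
    using assms by (intro form_sum) (auto simp: orthonormal_def)
  also have "\<dots> = (\<Sum>v\<in>B. if b = v then c v else 0)"
    using assms by (intro sum.cong) (auto simp: orthonormal_def)
  also have "\<dots> = c b"
    using assms by (simp add: orthonormal_def)
  finally show ?thesis .
qed

lemma proj_span:
  assumes "orthonormal B" "x \<in> span B"
  shows "proj B x = x"
proof -
  obtain c where x: "x = (\<Sum>v\<in>B. c v *s v)"
    using assms by (auto simp: span_finite orthonormal_def)
  show ?thesis
    unfolding proj_def x using assms(1)
    by (intro sum.cong) (simp_all add: form_sum_orthonormal)
qed

lemma form_diff: "\<lbrakk>x \<in> V; y \<in> V; z \<in> V\<rbrakk> \<Longrightarrow> form x (y - z) = form x y - form x z"
  using form_add[of x y "(-1) *s z"] form_scale[of x z "-1"] sub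
  by (simp add: subspace_neg)

text \<open>Running Gram-Schmidt inside a set \<open>E\<close> that is closed under its steps, rather than
  inside the whole subspace, also yields orthonormal bases of eigenvectors.\<close>

lemma gram_schmidt:
  assumes "finite S" "S \<subseteq> E" "E \<subseteq> V"
    and scale: "\<And>x c. x \<in> E \<Longrightarrow> c *s x \<in> E"
    and step: "\<And>x B. \<lbrakk>x \<in> E; B \<subseteq> E; orthonormal B\<rbrakk> \<Longrightarrow> x - proj B x \<in> E"
  shows "\<exists>B. orthonormal B \<and> B \<subseteq> E \<and> span B = span S"
  using assms(1,2)
proof (induction S rule: finite_induct)
  case empty
  then show ?case by (auto simp: orthonormal_def intro!: exI[of _ "{}"])
next
  case (insert x S)
  then obtain B where B: "orthonormal B" "B \<subseteq> E" "span B = span S" by auto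
  define y where "y = x - proj B x"
  have xE: "x \<in> E" using insert by auto
  then have xV: "x \<in> V" using assms by auto
  have BV: "B \<subseteq> V" "finite B" using B by (auto simp: orthonormal_def)
  have yE: "y \<in> E" unfolding y_def using step xE B by auto
  then have yV: "y \<in> V" using assms by auto
  have span_y: "span (insert y B) = span (insert x S)"
  proof -
    have "span (insert x B) = span (insert y B)"
      by (rule eq_span_insert_eq) (simp add: y_def proj_in_span)
    then show ?thesis using B(3) by (simp add: span_insert)
  qed
  show ?case
  \<comment> \<open>If the remainder vanishes, \<open>x\<close> already lies in the span of
    \<open>B\<close>, and \<open>B\<close> itself serves.\<close>
  proof (cases "y = 0")
    case True
    then show ?thesis using B span_y by auto
  next
    case False
    define n where "n = Re (form y y)"
    have n: "n > 0" "form y y = of_real n"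
      using form_pos[OF yV False] by (auto simp: n_def complex_eq_iff)
    define z where "z = of_real (1 / sqrt n) *s y"
    have zE: "z \<in> E" unfolding z_def using scale yE by auto
    then have zV: "z \<in> V" using assms by auto
    \<comment> \<open>Linearity is assumed in the second argument only, so the scalar is taken out
      of the first one by Hermitian symmetry.\<close>
    have zy: "form z y = of_real (sqrt n)"
    proof -
      have "form z y = cnj (form y z)" by (rule form_herm[OF yV zV])
      also have "\<dots> = of_real (n / sqrt n)" using n yV by (simp add: z_def form_scale)
      finally show ?thesis using n by (simp add: real_div_sqrt)
    qed
    have zz: "form z z = 1"
    proof -
      have "form z z = of_real (1 / sqrt n) * form z y"
        using zV yV by (subst (2) z_def) (simp add: form_scale)
      then show ?thesis using n zy by simp
    qed
    have by0: "form b y = 0" if "b \<in> B" for b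
    proof -
      have "form b y = form b x - form b (proj B x)"
        unfolding y_def using that BV xV proj_in by (intro form_diff) auto
      then show ?thesis using form_sum_orthonormal[OF B(1) that] by (simp add: proj_def)
    qed
    have bz: "form b z = 0" "form z b = 0" if "b \<in> B" for b
    proof -
      show "form b z = 0" using that BV yV by0 by (auto simp: z_def form_scale)
      then show "form z b = 0" using form_herm[of b z] that BV zV by auto
    qed
    have zB: "z \<notin> B" using bz zz by auto
    have "orthonormal (insert z B)"
      using B(1) zV zz bz zB by (auto simp: orthonormal_def)
    moreover have "span (insert z B) = span (insert y B)"
    proof -
      have "y = of_real (sqrt n) *s z"
        using n unfolding z_def by (simp flip: of_real_mult)
      then have "y \<in> span (insert z B)" by (metis insertI1 span_base span_scale)
      moreover have "z \<in> span (insert y B)"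
        unfolding z_def by (rule span_scale, rule span_base) simp
      moreover have "B \<subseteq> span (insert z B)" "B \<subseteq> span (insert y B)"
        using span_superset by blast+
      ultimately show ?thesis
        unfolding span_eq by simp
    qed
    ultimately show ?thesis
      using zE B(2) span_y by (intro exI[of _ "insert z B"]) auto
  qed
qed

lemma orthonormal_basis_exists:
  assumes "finite S" "V = span S"
  shows "\<exists>B. orthonormal B \<and> span B = V"
proof -
  have "\<exists>B. orthonormal B \<and> B \<subseteq> V \<and> span B = span S"
  proof (rule gram_schmidt[OF assms(1)])
    show "S \<subseteq> V" unfolding assms(2) by (rule span_superset)
    show "c *s x \<in> V" if "x \<in> V" for x c using sub that by (rule subspace_scale)
    show "x - proj B x \<in> V" if "x \<in> V" "B \<subseteq> V" for x B
      using sub that(1) proj_in[OF that(2)] by (rule subspace_diff)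
  qed simp
  then show ?thesis unfolding assms(2) by blast
qed

end


section \<open>Operators and adjoints\<close>

lemma cscale_apply: "cscale c x i = c * x i"
  by (simp add: cscale_def)

lemma opscale_apply: "opscale c r x = cscale c (r x)"
  by (simp add: opscale_def)

text \<open>The library rules for pointwise operations would also unfold sums of vectors into their
  coordinates, so they are replaced by instances for operators.\<close>

declare plus_fun_apply [simp del] zero_fun_apply [simp del] minus_apply [simp del]

lemma op_plus: "(r + s) x = r x + s x" for r s :: "'p operator"
  by (rule plus_fun_apply)

lemma op_zero: "(0 :: 'p operator) x = 0"
  by (rule zero_fun_apply)

lemmas op_apply = op_plus op_zero opscale_apply

lemma L_in: "r \<in> L X Y \<Longrightarrow> x \<in> carrier X \<Longrightarrow> r x \<in> carrier Y"
  and L_add: "r \<in> L X Y \<Longrightarrow> x \<in> carrier X \<Longrightarrow> y \<in> carrier X \<Longrightarrow> r (x + y) = r x + r y"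
  and L_scale: "r \<in> L X Y \<Longrightarrow> x \<in> carrier X \<Longrightarrow> r (cscale c x) = cscale c (r x)"
  and L_off: "r \<in> L X Y \<Longrightarrow> x \<notin> carrier X \<Longrightarrow> r x = 0"
  by (auto simp: L_def)

lemma L_0: "r \<in> L X Y \<Longrightarrow> r 0 = 0"
  using L_scale[of r X Y 0 0]  L_off[of r X Y 0] by (cases "0 \<in> carrier X") auto

lemma LI:
  assumes "\<And>x. x \<in> carrier X \<Longrightarrow> r x \<in> carrier Y"
    and "\<And>x y. x \<in> carrier X \<Longrightarrow> y \<in> carrier X \<Longrightarrow> r (x + y) = r x + r y"
    and "\<And>c x. x \<in> carrier X \<Longrightarrow> r (cscale c x) = cscale c (r x)"
    and "\<And>x. x \<notin> carrier X \<Longrightarrow> r x = 0"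
  shows "r \<in> L X Y"
  using assms by (auto simp: L_def)

lemma L_comp: "r \<in> L X Y \<Longrightarrow> s \<in> L Y Z \<Longrightarrow> s \<circ> r \<in> L X Z"
  by (rule LI) (simp_all only: comp_apply L_in L_add L_scale, metis L_off L_0)

lemma subspace_carrier: "fd_hilbert X \<Longrightarrow> cvec.subspace (carrier X)"
  by (simp add: fd_hilbert_def)

lemma carrier_closed:
  assumes "fd_hilbert X"
  shows "0 \<in> carrier X"
    and "x \<in> carrier X \<Longrightarrow> y \<in> carrier X \<Longrightarrow> x + y \<in> carrier X"
    and "x \<in> carrier X \<Longrightarrow> y \<in> carrier X \<Longrightarrow> x - y \<in> carrier X"
    and "x \<in> carrier X \<Longrightarrow> cscale c x \<in> carrier X"
  using subspace_carrier[OF assms]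
  by (auto intro: cvec.subspace_0 cvec.subspace_add cvec.subspace_diff cvec.subspace_scale)

lemma L_subspace: "fd_hilbert Y \<Longrightarrow> op.subspace (L X Y)"
  unfolding op.subspace_def
  by (auto intro!: LI simp: carrier_closed L_in L_add L_scale L_off op_apply
        cvec.scale_right_distrib cvec.scale_left_commute)

lemma L_closed:
  assumes "fd_hilbert Y"
  shows "0 \<in> L X Y" "r \<in> L X Y \<Longrightarrow> s \<in> L X Y \<Longrightarrow> r + s \<in> L X Y" "r \<in> L X Y \<Longrightarrow> opscale c r \<in> L X Y"
  using L_subspace[OF assms, of X]
  by (auto intro: op.subspace_0 op.subspace_add op.subspace_scale)

lemma idop_L [simp]: "fd_hilbert X \<Longrightarrow> idop X \<in> L X X"
  by (rule LI) (auto simp: idop_def carrier_closed)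

lemma L_idop: "r \<in> L X Y \<Longrightarrow> r \<circ> idop X = r" "r \<in> L X Y \<Longrightarrow> idop Y \<circ> r = r"
  by (rule ext, cases "r \<in> L X Y"; auto simp: idop_def L_off L_0 L_in)
     (rule ext, metis L_0 L_in L_off comp_apply idop_def)

lemma comp_add_left: "(r + s) \<circ> t = (r \<circ> t) + (s \<circ> t)" for r s t :: "'p operator"
  by (rule ext) (simp add: op_apply)

lemma comp_opscale_left: "opscale c r \<circ> t = opscale c (r \<circ> t)"
  by (rule ext) (simp add: op_apply)

text \<open>In contrast to \<open>comp_add_left\<close> this uses linearity of \<open>v\<close>,
  which holds on the carrier of \<open>Y\<close> only. Off the carrier of \<open>X\<close> both
  sides vanish.\<close>

lemma comp_add_right:
  assumes "v \<in> L Y Z" "r \<in> L X Y" "s \<in> L X Y"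
  shows "v \<circ> (r + s) = (v \<circ> r) + (v \<circ> s)"
proof
  fix x show "(v \<circ> (r + s)) x = ((v \<circ> r) + (v \<circ> s)) x"
    by (cases "x \<in> carrier X")
      (simp_all add: op_plus L_add[OF assms(1)] L_in[OF assms(2)] L_in[OF assms(3)]
        L_off[OF assms(2)] L_off[OF assms(3)] L_0[OF assms(1)])
qed

lemma comp_opscale_right:
  assumes "v \<in> L Y Z" "r \<in> L X Y"
  shows "v \<circ> opscale c r = opscale c (v \<circ> r)"
proof
  fix x show "(v \<circ> opscale c r) x = opscale c (v \<circ> r) x"
    by (cases "x \<in> carrier X")
      (simp_all add: opscale_apply L_scale[OF assms(1)] L_in[OF assms(2)] L_off[OF assms(2)] L_0[OF assms(1)])
qed

lemma comp_0_right: "v \<in> L Y Z \<Longrightarrow> v \<circ> (0 :: 'p operator) = 0"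
  by (rule ext) (simp add: op_apply L_0)

lemma comp_0_left: "(0 :: 'p operator) \<circ> v = 0" for v :: "'p operator"
  by (rule ext) (simp add: op_apply)

lemma inner_form_ip: "fd_hilbert X \<Longrightarrow> inner_form cscale (carrier X) (ip X)"
  by unfold_locales (unfold fd_hilbert_def, (elim conjE; blast)+)

lemma ip_rules:
  assumes "fd_hilbert X" "x \<in> carrier X" "y \<in> carrier X"
  shows "z \<in> carrier X \<Longrightarrow> ip X x (y + z) = ip X x y + ip X x z"
    and "z \<in> carrier X \<Longrightarrow> ip X x (y - z) = ip X x y - ip X x z"
    and "z \<in> carrier X \<Longrightarrow> ip X (y + z) x = ip X y x + ip X z x"
    and "ip X x (cscale c y) = c * ip X x y"
    and "ip X (cscale c y) x = cnj c * ip X y x"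
    and "ip X y x = cnj (ip X x y)"
    and "ip X x x = 0 \<longleftrightarrow> x = 0"
proof -
  interpret inner_form cscale "carrier X" "ip X" by (rule inner_form_ip[OF assms(1)])
  note c = carrier_closed[OF assms(1)]
  show "ip X x (cscale c y) = c * ip X x y" by (rule form_scale[OF assms(2,3)])
  show "ip X y x = cnj (ip X x y)" by (rule form_herm[OF assms(2,3)])
  then show "ip X (cscale c y) x = cnj c * ip X y x"
    using form_herm[OF assms(2) c(4)[OF assms(3)], of c] form_scale[OF assms(2,3), of c] by simp
  show "ip X x x = 0 \<longleftrightarrow> x = 0"
    using form_pos[OF assms(2)] form_zero[OF assms(2)] by (metis less_irrefl zero_complex.sel(1))
  assume z: "z \<in> carrier X"
  show "ip X x (y + z) = ip X x y + ip X x z" by (rule form_add[OF assms(2,3) z])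
  show "ip X x (y - z) = ip X x y - ip X x z" by (rule form_diff[OF assms(2,3) z])
  show "ip X (y + z) x = ip X y x + ip X z x"
    using form_herm[OF assms(2) c(2)[OF assms(3) z]] form_add[OF assms(2,3) z]
      form_herm[OF assms(2,3)] form_herm[OF assms(2) z] by simp
qed

lemma ip_eqI:
  assumes "fd_hilbert X" "u \<in> carrier X" "w \<in> carrier X"
    and "\<And>x. x \<in> carrier X \<Longrightarrow> ip X u x = ip X w x"
  shows "u = w"
proof -
  have d: "u - w \<in> carrier X" using assms(1-3) by (simp add: carrier_closed)
  have "ip X (u - w) (u - w) = ip X (u - w) u - ip X (u - w) w"
    by (rule ip_rules(2)[OF assms(1) d assms(2,3)])
  also have "\<dots> = cnj (ip X u (u - w)) - cnj (ip X w (u - w))"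
    by (simp only: ip_rules(6)[OF assms(1,2) d] ip_rules(6)[OF assms(1,3) d])
  also have "\<dots> = 0" using assms(4) d by simp
  finally show ?thesis using ip_rules(7)[OF assms(1) d d] by simp
qed

lemma hilbert_basis:
  assumes "fd_hilbert X"
  shows "\<exists>B. inner_form.orthonormal (carrier X) (ip X) B \<and> cvec.span B = carrier X"
proof -
  interpret inner_form cscale "carrier X" "ip X" by (rule inner_form_ip[OF assms(1)])
  obtain S where "finite S" "carrier X = cvec.span S"
    using assms by (auto simp: fd_hilbert_def)
  then show ?thesis using orthonormal_basis_exists by simp
qed

lemma adj_exists:
  assumes "fd_hilbert X" "fd_hilbert Y" "r \<in> L X Y"
  shows "\<exists>t. t \<in> L Y X \<and> (\<forall>x\<in>carrier X. \<forall>y\<in>carrier Y. ip X (t y) x = ip Y y (r x))"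
proof -
  interpret X: inner_form cscale "carrier X" "ip X" by (rule inner_form_ip[OF assms(1)])
  obtain B where B: "X.orthonormal B" "cvec.span B = carrier X"
    using hilbert_basis[OF assms(1)] by blast
  have BX: "finite B" "b \<in> B \<Longrightarrow> b \<in> carrier X" for b using B by (auto simp: X.orthonormal_def)
  \<comment> \<open>The formula is forced: the coefficient of an adjoint value at the basis vector
    \<open>b\<close> must be the inner product of \<open>b\<close> with \<open>t y\<close>, which is
    the conjugate of \<open>ip Y y (r b)\<close>.\<close>
  define t where "t y = (if y \<in> carrier Y then \<Sum>b\<in>B. cscale (ip Y (r b) y) b else 0)" for y
  have in_X: "(\<Sum>b\<in>B. cscale (c b) b) \<in> carrier X" for c
    using BX assms by (intro cvec.subspace_sum subspace_carrier) (auto simp: carrier_closed)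
  have "t \<in> L Y X"
    by (rule LI)
       (use assms in \<open>auto simp: t_def in_X carrier_closed ip_rules(1-5) L_in BX cvec.scale_left_distrib
          sum.distrib cvec.scale_sum_right\<close>)
  moreover have "ip X (t y) x = ip Y y (r x)" if x: "x \<in> carrier X" and y: "y \<in> carrier Y" for x y
  proof -
    interpret Y: inner_form cscale "carrier Y" "ip Y" by (rule inner_form_ip[OF assms(2)])
    \<comment> \<open>As \<open>r\<close> is linear only on the carrier, additivity over sums is
      proved by induction over the subsets of the basis, where all partial sums stay in the
      carrier.\<close>
    have r_sum: "r (\<Sum>b\<in>A. cscale (c b) b) = (\<Sum>b\<in>A. cscale (c b) (r b))" if "A \<subseteq> B" for c A
    proof -
      have "finite A" using that BX finite_subset by blast
      then show ?thesis using that
      proof (induction A rule: finite_induct)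
        case (insert a A)
        then have "(\<Sum>b\<in>A. cscale (c b) b) \<in> carrier X" "cscale (c a) a \<in> carrier X" "a \<in> carrier X"
          using BX assms by (auto simp: carrier_closed intro!: cvec.subspace_sum subspace_carrier)
        then show ?case using insert assms by (simp add: L_add L_scale)
      qed (use assms L_0 in auto)
    qed
    have x_eq: "x = (\<Sum>b\<in>B. cscale (ip X b x) b)"
      using X.proj_span[OF B(1), of x] B(2) x by (simp add: X.proj_def)
    have y_sum: "ip Y y (\<Sum>b\<in>A. cscale (c b) (r b)) = (\<Sum>b\<in>A. c b * ip Y y (r b))" if "A \<subseteq> B" for c A
    proof -
      have "finite A" using that BX finite_subset by blast
      then show ?thesis using that
      proof (induction A rule: finite_induct)
        case (insert a A)
        then have "(\<Sum>b\<in>A. cscale (c b) (r b)) \<in> carrier Y" "r a \<in> carrier Y"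
          using BX assms by (auto simp: carrier_closed L_in intro!: cvec.subspace_sum subspace_carrier)
        then show ?case using insert assms y by (simp add: ip_rules(1-5) carrier_closed)
      qed (use assms y Y.form_zero in auto)
    qed
    have "ip Y y (r x) = (\<Sum>b\<in>B. ip X b x * ip Y y (r b))"
      using y_sum[of B "\<lambda>b. ip X b x"] r_sum[of B "\<lambda>b. ip X b x"] x_eq by simp
    also have "\<dots> = (\<Sum>b\<in>B. cnj (ip Y (r b) y * ip X x b))"
    proof (rule sum.cong)
      fix b assume "b \<in> B"
      then show "ip X b x * ip Y y (r b) = cnj (ip Y (r b) y * ip X x b)"
        using ip_rules(6)[OF assms(1) x, of b] ip_rules(6)[OF assms(2) L_in[OF assms(3)] y, of b] BX
        by simp
    qed simp
    also have "\<dots> = cnj (ip X x (t y))"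
      using X.form_sum[OF x BX(1) subsetI[OF BX(2)], of "\<lambda>b. ip Y (r b) y"] y by (simp add: t_def)
    also have "\<dots> = ip X (t y) x"
      using ip_rules(6)[OF assms(1) x, of "t y"] in_X y by (simp add: t_def)
    finally show ?thesis by simp
  qed
  ultimately show ?thesis by blast
qed

lemma adj_unique:
  assumes "fd_hilbert X" "t \<in> L Y X" "t' \<in> L Y X"
    and "\<And>x y. x \<in> carrier X \<Longrightarrow> y \<in> carrier Y \<Longrightarrow> ip X (t y) x = ip X (t' y) x"
  shows "t = t'"
proof
  fix y show "t y = t' y"
  proof (cases "y \<in> carrier Y")
    case True
    then show ?thesis
      by (intro ip_eqI[OF assms(1)] L_in[OF assms(2)] L_in[OF assms(3)] assms(4))
  next
    case False
    then show ?thesis by (simp add: L_off[OF assms(2)] L_off[OF assms(3)])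
  qed
qed

lemma adj_props:
  assumes "fd_hilbert X" "fd_hilbert Y" "r \<in> L X Y"
  shows "adj X Y r \<in> L Y X \<and> (\<forall>x\<in>carrier X. \<forall>y\<in>carrier Y. ip X (adj X Y r y) x = ip Y y (r x))"
proof -
  have "\<exists>!t. t \<in> L Y X \<and> (\<forall>x\<in>carrier X. \<forall>y\<in>carrier Y. ip X (t y) x = ip Y y (r x))"
    using adj_exists[OF assms] adj_unique[OF assms(1)]
    by (metis (no_types, lifting))
  from theI'[OF this] show ?thesis unfolding adj_def .
qed

lemma adj_L: "fd_hilbert X \<Longrightarrow> fd_hilbert Y \<Longrightarrow> r \<in> L X Y \<Longrightarrow> adj X Y r \<in> L Y X"
  using adj_props by blast

lemma ip_adj:
  "fd_hilbert X \<Longrightarrow> fd_hilbert Y \<Longrightarrow> r \<in> L X Y \<Longrightarrow> x \<in> carrier X \<Longrightarrow> y \<in> carrier Y \<Longrightarrow>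
    ip X (adj X Y r y) x = ip Y y (r x)"
  using adj_props by blast

text \<open>This turns the definite description into a check: each rule for adjoints below exhibits
  a candidate and verifies the defining equation for it.\<close>

lemma adjI:
  assumes "fd_hilbert X" "fd_hilbert Y" "r \<in> L X Y" "t \<in> L Y X"
    and "\<And>x y. x \<in> carrier X \<Longrightarrow> y \<in> carrier Y \<Longrightarrow> ip X (t y) x = ip Y y (r x)"
  shows "adj X Y r = t"
  using assms adj_L by (intro adj_unique[of X _ Y]) (auto simp: ip_adj)

lemma adj_adj:
  assumes "fd_hilbert X" "fd_hilbert Y" "r \<in> L X Y"
  shows "adj Y X (adj X Y r) = r"
proof (rule adjI)
  fix x y assume xy: "x \<in> carrier Y" "y \<in> carrier X"
  then have "cnj (ip X (adj X Y r x) y) = cnj (ip Y x (r y))" using assms by (simp add: ip_adj)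
  then show "ip Y (r y) x = ip X y (adj X Y r x)"
    using ip_rules(6)[OF assms(2) xy(1) L_in[OF assms(3) xy(2)]]
      ip_rules(6)[OF assms(1) L_in[OF adj_L[OF assms] xy(1)] xy(2)] by simp
qed (use assms adj_L in auto)

lemma adj_comp:
  assumes "fd_hilbert X" "fd_hilbert Y" "fd_hilbert Z" "r \<in> L X Y" "s \<in> L Y Z"
  shows "adj X Z (s \<circ> r) = adj X Y r \<circ> adj Y Z s"
proof (rule adjI)
  show "adj X Y r \<circ> adj Y Z s \<in> L Z X"
    using assms by (blast intro: L_comp adj_L)
  fix x y assume xy: "x \<in> carrier X" "y \<in> carrier Z"
  then have "adj Y Z s y \<in> carrier Y" "r x \<in> carrier Y"
    using assms L_in adj_L by blast+
  then show "ip X ((adj X Y r \<circ> adj Y Z s) y) x = ip Z y ((s \<circ> r) x)"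
    using assms xy by (simp add: ip_adj)
qed (use assms L_comp in auto)

lemma adj_add:
  assumes "fd_hilbert X" "fd_hilbert Y" "r \<in> L X Y" "s \<in> L X Y"
  shows "adj X Y (r + s) = adj X Y r + adj X Y s" (is "adj X Y ?lhs = ?rhs")
proof (rule adjI)
  show "?rhs \<in> L Y X" using assms by (intro L_closed adj_L)
  fix x y assume xy: "x \<in> carrier X" "y \<in> carrier Y"
  show "ip X (?rhs y) x = ip Y y (?lhs x)"
    using assms xy L_in[OF assms(3)] L_in[OF adj_L[OF assms(1-3)]]
      L_in[OF assms(4)] L_in[OF adj_L[OF assms(1,2,4)]]
    by (simp add: op_apply ip_adj ip_rules(1-5))
qed (use assms in \<open>auto intro: L_closed\<close>)

lemma adj_opscale:
  assumes "fd_hilbert X" "fd_hilbert Y" "r \<in> L X Y"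
  shows "adj X Y (opscale c r) = opscale (cnj c) (adj X Y r)" (is "adj X Y ?lhs = ?rhs")
proof (rule adjI)
  show "?rhs \<in> L Y X" using assms by (intro L_closed adj_L)
  fix x y assume xy: "x \<in> carrier X" "y \<in> carrier Y"
  show "ip X (?rhs y) x = ip Y y (?lhs x)"
    using assms xy L_in[OF assms(3)] L_in[OF adj_L[OF assms(1-3)]]
    by (simp add: op_apply ip_adj ip_rules(1-5))
qed (use assms in \<open>auto intro: L_closed\<close>)

lemma adj_idop: "fd_hilbert X \<Longrightarrow> adj X X (idop X) = idop X"
  by (rule adjI; (intro idop_L)?) (simp_all add: idop_def)

lemma adj_0: "fd_hilbert X \<Longrightarrow> fd_hilbert Y \<Longrightarrow> adj X Y 0 = 0"
  using adj_opscale[of X Y 0 0] L_closed(1)[of Y X] by simp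

section \<open>Functions between quantum sets\<close>

text \<open>Keeps equations between compositions of operators free of arguments.\<close>

declare comp_apply [simp del]

lemma quantum_setD: "quantum_set XX \<Longrightarrow> X \<in> XX \<Longrightarrow> fd_hilbert X"
  by (simp add: quantum_set_def)

lemma comp_sum_right:
  assumes "fd_hilbert Y" "v \<in> L Y Z" "\<And>i. i \<in> I \<Longrightarrow> f i \<in> L X Y"
  shows "v \<circ> sum f I = (\<Sum>i\<in>I. v \<circ> f i)"
proof (cases "finite I")
  case True
  then show ?thesis using assms(3)
  proof (induction I rule: finite_induct)
    case (insert i I)
    have "sum f I \<in> L X Y"
      by (intro op.subspace_sum L_subspace assms(1)) (use insert in auto)
    then show ?case using insert by (simp add: comp_add_right[OF assms(2), of _ X])
  qed (simp add: comp_0_right[OF assms(2)])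
qed (simp add: comp_0_right[OF assms(2)])

text \<open>Atoms are nonzero, so a scalar can be read off from its multiple of the identity. This
  makes \<open>fun_ip\<close> well defined.\<close>

lemma opscale_idop_cancel:
  assumes "quantum_set YY" "Y \<in> YY" "opscale c (idop Y) = opscale d (idop Y)"
  shows "c = d"
proof -
  have "carrier Y \<noteq> {0}" "0 \<in> carrier Y"
    using assms carrier_closed(1) by (auto simp: quantum_set_def)
  then obtain y where y: "y \<in> carrier Y" "y \<noteq> 0" by blast
  have "cscale c y = cscale d y"
    using fun_cong[OF assms(3), of y] y by (simp add: opscale_apply idop_def)
  then show ?thesis using y by simp
qed

lemma qid_same: "X \<in> XX \<Longrightarrow> qid XX X X = range (\<lambda>c. opscale c (idop X))"
  by (auto simp: qid_def)

lemma qid_diff: "X \<noteq> X' \<Longrightarrow> qid XX X X' = {0}"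
  by (auto simp: qid_def)

lemma qid_subspace: "op.subspace (qid XX X X')"
proof (cases "X \<in> XX \<and> X' = X")
  case True
  show ?thesis unfolding op.subspace_def
  proof (intro conjI ballI allI)
    have "0 = opscale 0 (idop X)" by simp
    then show "0 \<in> qid XX X X'" using True by (auto simp: qid_same)
    show "r + s \<in> qid XX X X'" if "r \<in> qid XX X X'" "s \<in> qid XX X X'" for r s
      using that True by (auto simp: qid_same simp flip: op.scale_left_distrib)
    show "opscale c r \<in> qid XX X X'" if "r \<in> qid XX X X'" for c r
      using that True by (auto simp: qid_same)
  qed
next
  case False
  then have "qid XX X X' = {0}" by (auto simp: qid_def)
  then show ?thesis by (simp add: op.subspace_single_0)
qed

text \<open>These are the generators of the entry of F\<dagger> F at (X,X). That the identity lies
  in their span is the first axiom of a function, and most arguments below are inductions over this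
  span.\<close>

definition source_span :: "'p qset \<Rightarrow> 'p qrel \<Rightarrow> 'p hilb \<Rightarrow> 'p operator set" where
  "source_span YY F X = {adj X Y v' \<circ> v | Y v v'. Y \<in> YY \<and> v \<in> F X Y \<and> v' \<in> F X Y}"

text \<open>Off the diagonal the first axiom is void, and on it everything is a multiple of
  \<open>idop X\<close>. For the second axiom generators suffice, since the entries of
  \<open>qid\<close> are subspaces.\<close>

lemma FunI:
  assumes "binrel XX YY F"
    and unit: "\<And>X. X \<in> XX \<Longrightarrow> idop X \<in> op.span (source_span YY F X)"
    and orth: "\<And>X Y Y' v v'. \<lbrakk>X \<in> XX; Y \<in> YY; Y' \<in> YY; v \<in> F X Y; v' \<in> F X Y'\<rbrakk>
      \<Longrightarrow> v' \<circ> adj X Y v \<in> qid YY Y Y'"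
  shows "F \<in> Fun XX YY"
proof -
  have "qid XX X X' \<subseteq> qcomp YY (qadj F) F X X'" if "X \<in> XX" "X' \<in> XX" for X X'
  proof (cases "X = X'")
    case True
    have "qcomp YY (qadj F) F X X = op.span (source_span YY F X)"
      unfolding qcomp_def qadj_def source_span_def by (rule arg_cong[where f = op.span]) blast
    then show ?thesis using unit that True by (auto simp: qid_same op.span_scale)
  next
    case False
    then show ?thesis by (simp add: qid_diff qcomp_def op.span_zero)
  qed
  moreover have "qcomp XX F (qadj F) Y Y' \<subseteq> qid YY Y Y'" if "Y \<in> YY" "Y' \<in> YY" for Y Y'
    unfolding qcomp_def
    by (intro op.span_minimal qid_subspace) (use that orth in \<open>auto simp: qadj_def\<close>)
  ultimately show ?thesis using assms(1) by (simp add: Fun_def qle_def)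
qed

locale quantum_function =
  fixes XX YY :: "'p qset" and F :: "'p qrel"
  assumes XX: "quantum_set XX" and YY: "quantum_set YY" and F: "F \<in> Fun XX YY"
begin

lemma hilbert_X: "X \<in> XX \<Longrightarrow> fd_hilbert X"
  and hilbert_Y: "Y \<in> YY \<Longrightarrow> fd_hilbert Y"
  using XX YY by (auto intro: quantum_setD)

lemma rel_subspace: "X \<in> XX \<Longrightarrow> Y \<in> YY \<Longrightarrow> op.subspace (F X Y)"
  and in_L: "X \<in> XX \<Longrightarrow> Y \<in> YY \<Longrightarrow> v \<in> F X Y \<Longrightarrow> v \<in> L X Y"
  using F by (auto simp: Fun_def binrel_def)

lemma off: "X \<notin> XX \<or> Y \<notin> YY \<Longrightarrow> F X Y = {0}"
  using F by (auto simp: Fun_def binrel_def)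

lemma unit: "X \<in> XX \<Longrightarrow> idop X \<in> op.span (source_span YY F X)"
proof -
  assume X: "X \<in> XX"
  have "qcomp YY (qadj F) F X X = op.span (source_span YY F X)"
    unfolding qcomp_def qadj_def source_span_def by (rule arg_cong[where f = op.span]) blast
  moreover have "qid XX X X \<subseteq> qcomp YY (qadj F) F X X"
    using F X by (auto simp: Fun_def qle_def)
  moreover have "idop X \<in> qid XX X X"
    unfolding qid_same[OF X] by (rule image_eqI[of _ _ 1]) simp_all
  ultimately show ?thesis by blast
qed

lemma orth:
  assumes "X \<in> XX" "Y \<in> YY" "Y' \<in> YY" "v \<in> F X Y" "v' \<in> F X Y'"
  shows "v' \<circ> adj X Y v \<in> qid YY Y Y'"
proof -
  have "v' \<circ> adj X Y v \<in> qcomp XX F (qadj F) Y Y'"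
    unfolding qcomp_def qadj_def by (rule op.span_base) (use assms in blast)
  moreover have "qcomp XX F (qadj F) Y Y' \<subseteq> qid YY Y Y'"
    using F assms(2,3) by (simp add: Fun_def qle_def)
  ultimately show ?thesis by blast
qed

lemma orth_same:
  assumes "X \<in> XX" "Y \<in> YY" "v \<in> F X Y" "v' \<in> F X Y"
  obtains c where "v' \<circ> adj X Y v = opscale c (idop Y)"
  using orth[OF assms(1,2,2,3,4)] unfolding qid_same[OF assms(2)] by blast

text \<open>Geometrically, the ranges of the adjoints of \<open>v\<close> and \<open>v'\<close> are
  orthogonal subspaces of X when the target atoms differ.\<close>

lemma orth_diff:
  assumes "X \<in> XX" "Y \<in> YY" "Y' \<in> YY" "v \<in> F X Y" "v' \<in> F X Y'" "Y \<noteq> Y'"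
  shows "v' \<circ> adj X Y v = 0"
  using orth[OF assms(1-5)] assms(6) by (simp add: qid_diff)

lemma adj_in_L: "X \<in> XX \<Longrightarrow> Y \<in> YY \<Longrightarrow> v \<in> F X Y \<Longrightarrow> adj X Y v \<in> L Y X"
  by (intro adj_L hilbert_X hilbert_Y in_L)

text \<open>The operators leaving X are jointly injective: every generator v'\<dagger> v of the
  identity ends in some \<open>v\<close> on the right, where \<open>a\<close> and \<open>a'\<close>
  become indistinguishable.\<close>

lemma cancel_left:
  assumes X: "X \<in> XX" and a: "a \<in> L W X" "a' \<in> L W X"
    and eq: "\<And>Y v. Y \<in> YY \<Longrightarrow> v \<in> F X Y \<Longrightarrow> v \<circ> a = v \<circ> a'"
  shows "a = a'"
proof -
  have "idop X \<circ> a = idop X \<circ> a'"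
    using unit[OF X]
  proof (induction rule: op.span_induct)
    case base
    show ?case unfolding op.subspace_def
      by (auto simp: comp_add_left comp_opscale_left comp_0_left)
  next
    case (step t)
    then show ?case unfolding source_span_def using eq by (auto simp: comp_assoc)
  qed
  then show ?thesis using a by (simp add: L_idop)
qed

text \<open>The product v' v\<dagger> is a scalar if the atoms agree and zero otherwise, so it
  passes through any family of endomorphisms of the atoms.\<close>

lemma orth_commute:
  assumes "X \<in> XX" "Y \<in> YY" "Y' \<in> YY" "v \<in> F X Y" "v' \<in> F X Y'"
    and b: "\<And>Y. Y \<in> YY \<Longrightarrow> b Y \<in> L Y Y"
  shows "b Y' \<circ> (v' \<circ> adj X Y v) = (v' \<circ> adj X Y v) \<circ> b Y"
proof (cases "Y = Y'")
  case True
  then obtain c where "v' \<circ> adj X Y v = opscale c (idop Y)"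
    using orth_same[OF assms(1,2,4)] assms(5) by metis
  then show ?thesis
    using True b[OF assms(2)] hilbert_Y[OF assms(2)]
    by (simp add: comp_opscale_left comp_opscale_right[OF _ idop_L] L_idop)
next
  case False
  then show ?thesis
    using orth_diff[OF assms(1-5)] b[OF assms(3)] by (simp add: comp_0_left comp_0_right)
qed

text \<open>Composing \<open>v\<close> with a finite decomposition of \<open>idop X\<close> yields multiples of the
  right-hand factors that occur in it.\<close>

lemma finite_support:
  assumes X: "X \<in> XX"
  shows "\<exists>S T. finite S \<and> finite T \<and>
    (\<forall>Y\<in>YY. \<forall>v\<in>F X Y. v \<in> op.span (S \<inter> F X Y) \<and> (Y \<notin> T \<longrightarrow> v = 0))"
proof -
  \<comment> \<open>For a combination \<open>t\<close> of generators, \<open>S\<close> collects the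
    right-hand factors that occur in it and \<open>T\<close> their target atoms. Sums of such
    \<open>t\<close> take unions of both sets.\<close>
  define Q where "Q t S T \<longleftrightarrow> finite S \<and> finite T \<and>
    (\<forall>Y\<in>YY. \<forall>v\<in>F X Y. v \<circ> t \<in> op.span (S \<inter> F X Y) \<and> (Y \<notin> T \<longrightarrow> v \<circ> t = 0))" for t S T
  have "idop X \<in> L X X \<and> (\<exists>S T. Q (idop X) S T)"
    using unit[OF X]
  proof (induction rule: op.span_induct)
    case base
    show ?case unfolding op.subspace_def
    proof (intro conjI ballI allI)
      have "Q 0 {} {}" by (auto simp: Q_def comp_0_right[OF in_L[OF X]] op.span_zero)
      then show "0 \<in> {t. t \<in> L X X \<and> (\<exists>S T. Q t S T)}"
        using L_closed(1)[OF hilbert_X[OF X]] by blast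
    next
      fix t u assume "t \<in> {t. t \<in> L X X \<and> (\<exists>S T. Q t S T)}" "u \<in> {t. t \<in> L X X \<and> (\<exists>S T. Q t S T)}"
      then obtain S T S' T' where tu: "t \<in> L X X" "Q t S T" "u \<in> L X X" "Q u S' T'" by blast
      have "Q (t + u) (S \<union> S') (T \<union> T')"
        unfolding Q_def
      proof (intro conjI ballI)
        show "finite (S \<union> S')" "finite (T \<union> T')" using tu by (auto simp: Q_def)
        fix Y v assume Yv: "Y \<in> YY" "v \<in> F X Y"
        have e: "v \<circ> (t + u) = (v \<circ> t) + (v \<circ> u)"
          using in_L[OF X Yv] tu(1,3) by (rule comp_add_right)
        have "v \<circ> t \<in> op.span (S \<inter> F X Y)" "v \<circ> u \<in> op.span (S' \<inter> F X Y)"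
          using tu Yv by (auto simp: Q_def)
        then have "v \<circ> t \<in> op.span ((S \<union> S') \<inter> F X Y)" "v \<circ> u \<in> op.span ((S \<union> S') \<inter> F X Y)"
          using op.span_mono[of "S \<inter> F X Y" "(S \<union> S') \<inter> F X Y"]
            op.span_mono[of "S' \<inter> F X Y" "(S \<union> S') \<inter> F X Y"] by blast+
        then show "v \<circ> (t + u) \<in> op.span ((S \<union> S') \<inter> F X Y)"
          unfolding e by (rule op.span_add)
        show "Y \<notin> T \<union> T' \<longrightarrow> v \<circ> (t + u) = 0"
          using tu Yv by (auto simp: Q_def e)
      qed
      then show "t + u \<in> {t. t \<in> L X X \<and> (\<exists>S T. Q t S T)}"
        using tu L_closed(2)[OF hilbert_X[OF X]] by blast
    next
      fix c t assume "t \<in> {t. t \<in> L X X \<and> (\<exists>S T. Q t S T)}"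
      then obtain S T where t: "t \<in> L X X" "Q t S T" by blast
      have "Q (opscale c t) S T"
        unfolding Q_def
      proof (intro conjI ballI)
        show "finite S" "finite T" using t by (auto simp: Q_def)
        fix Y v assume Yv: "Y \<in> YY" "v \<in> F X Y"
        have e: "v \<circ> opscale c t = opscale c (v \<circ> t)"
          using in_L[OF X Yv] t(1) by (rule comp_opscale_right)
        show "v \<circ> opscale c t \<in> op.span (S \<inter> F X Y)" "Y \<notin> T \<longrightarrow> v \<circ> opscale c t = 0"
          using t Yv by (auto simp: Q_def e op.span_scale)
      qed
      then show "opscale c t \<in> {t. t \<in> L X X \<and> (\<exists>S T. Q t S T)}"
        using t L_closed(3)[OF hilbert_X[OF X]] by blast
    qed
  next
    case (step t)
    then obtain Y w w' where t: "t = adj X Y w' \<circ> w" and w: "Y \<in> YY" "w \<in> F X Y" "w' \<in> F X Y"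
      unfolding source_span_def by blast
    have "Q t {w} {Y}"
      unfolding Q_def
    proof (intro conjI ballI)
      fix Y' v assume v: "Y' \<in> YY" "v \<in> F X Y'"
      have e: "v \<circ> t = (v \<circ> adj X Y w') \<circ> w" by (simp add: t comp_assoc)
      show "v \<circ> t \<in> op.span ({w} \<inter> F X Y')"
      proof (cases "Y = Y'")
        case True
        then obtain c where c: "v \<circ> adj X Y w' = opscale c (idop Y)"
          using orth_same[OF X w(1) w(3)] v(2) by metis
        have "v \<circ> t = opscale c w"
          unfolding e c using in_L[OF X w(1,2)] by (simp add: comp_opscale_left L_idop)
        then show ?thesis using w True by (simp add: op.span_scale op.span_base)
      next
        case False
        then show ?thesis
          using orth_diff[OF X w(1) v(1) w(3) v(2)] by (simp add: e comp_0_left op.span_zero)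
      qed
      show "Y' \<notin> {Y} \<longrightarrow> v \<circ> t = 0"
        using orth_diff[OF X w(1) v(1) w(3) v(2)] by (auto simp: e comp_0_left)
    qed auto
    moreover have "t \<in> L X X"
      unfolding t by (rule L_comp[OF in_L adj_in_L]) (use X w in auto)
    ultimately show ?case by blast
  qed
  then obtain S T where "Q (idop X) S T" by blast
  then have "finite S \<and> finite T \<and>
    (\<forall>Y\<in>YY. \<forall>v\<in>F X Y. v \<in> op.span (S \<inter> F X Y) \<and> (Y \<notin> T \<longrightarrow> v = 0))"
    unfolding Q_def by (simp add: L_idop(1)[OF in_L[OF X]])
  then show ?thesis by blast
qed

section \<open>The inner product on F(X,Y)\<close>

lemma fun_ip_eq:
  assumes "X \<in> XX" "Y \<in> YY" "v \<in> F X Y" "w \<in> F X Y"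
  shows "opscale (fun_ip X Y v w) (idop Y) = w \<circ> adj X Y v"
proof -
  obtain c where c: "opscale c (idop Y) = w \<circ> adj X Y v"
    using orth_same[OF assms] by metis
  have "fun_ip X Y v w = c"
    unfolding fun_ip_def
    by (rule the_equality[where P = "\<lambda>c. opscale c (idop Y) = w \<circ> adj X Y v"])
      (use c opscale_idop_cancel[OF YY assms(2)] in metis)+
  then show ?thesis using c by simp
qed

lemma fun_ipI:
  assumes "X \<in> XX" "Y \<in> YY" "v \<in> F X Y" "w \<in> F X Y" "w \<circ> adj X Y v = opscale c (idop Y)"
  shows "fun_ip X Y v w = c"
  by (rule opscale_idop_cancel[OF YY assms(2)]) (simp add: fun_ip_eq assms)

text \<open>Linearity is read off from w v\<dagger> = (v|w) 1, Hermitian symmetry comes from taking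
  the adjoint of this equation, and positivity from applying it to a suitable vector of Y.\<close>

lemma inner_form_fun_ip:
  assumes X: "X \<in> XX" and Y: "Y \<in> YY"
  shows "inner_form opscale (F X Y) (fun_ip X Y)"
proof
  note HX = hilbert_X[OF X] and HY = hilbert_Y[OF Y]
  note sub = rel_subspace[OF X Y]
  show "op.subspace (F X Y)" by (rule sub)
  show "fun_ip X Y v (w + w') = fun_ip X Y v w + fun_ip X Y v w'"
    if "v \<in> F X Y" "w \<in> F X Y" "w' \<in> F X Y" for v w w'
    by (rule fun_ipI[OF X Y])
      (use that X Y in \<open>auto simp: op.subspace_add[OF sub] comp_add_left op.scale_left_distrib fun_ip_eq\<close>)
  show "fun_ip X Y v (opscale c w) = c * fun_ip X Y v w" if "v \<in> F X Y" "w \<in> F X Y" for v w c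
    by (rule fun_ipI[OF X Y])
      (use that X Y in \<open>auto simp: op.subspace_scale[OF sub] comp_opscale_left fun_ip_eq simp flip: op.scale_scale\<close>)
  show "fun_ip X Y w v = cnj (fun_ip X Y v w)" if vw: "v \<in> F X Y" "w \<in> F X Y" for v w
  proof (rule fun_ipI[OF X Y vw(2,1)])
    have "v \<circ> adj X Y w = adj Y Y (w \<circ> adj X Y v)"
      using adj_comp[OF HY HX HY adj_in_L[OF X Y vw(1)] in_L[OF X Y vw(2)]]
        adj_adj[OF HX HY in_L[OF X Y vw(1)]] by simp
    also have "\<dots> = opscale (cnj (fun_ip X Y v w)) (idop Y)"
      using HY by (simp add: adj_opscale adj_idop flip: fun_ip_eq[OF X Y vw])
    finally show "v \<circ> adj X Y w = opscale (cnj (fun_ip X Y v w)) (idop Y)" .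
  qed
  show "Im (fun_ip X Y v v) = 0 \<and> Re (fun_ip X Y v v) > 0" if v: "v \<in> F X Y" "v \<noteq> 0" for v
  proof -
    note vL = in_L[OF X Y v(1)] and aL = adj_in_L[OF X Y v(1)]
    have "adj X Y v \<noteq> 0" using adj_adj[OF HX HY vL] adj_0[OF HY HX] v(2) by auto
    then obtain y where y: "adj X Y v y \<noteq> 0" by (auto simp: fun_eq_iff op_zero)
    then have yY: "y \<in> carrier Y" "y \<noteq> 0" using L_off[OF aL] L_0[OF aL] by auto
    \<comment> \<open>Pairing v v\<dagger> y = (v|v) y with \<open>y\<close> gives m = (v|v) n,
      where both squared norms are positive because \<open>y\<close> and v\<dagger> y are
      nonzero.\<close>
    define n m where "n = ip Y y y" and "m = ip X (adj X Y v y) (adj X Y v y)"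
    have "cscale (fun_ip X Y v v) y = v (adj X Y v y)"
      using fun_cong[OF fun_ip_eq[OF X Y v(1) v(1)], of y] yY by (simp add: opscale_apply idop_def comp_apply)
    then have "ip Y y (v (adj X Y v y)) = fun_ip X Y v v * n"
      using ip_rules(4)[OF HY yY(1) yY(1)] by (metis n_def)
    then have m: "m = fun_ip X Y v v * n"
      unfolding m_def using ip_adj[OF HX HY vL L_in[OF aL yY(1)] yY(1)] by simp
    have pos: "Im n = 0" "Re n > 0" "Im m = 0" "Re m > 0"
      unfolding n_def m_def
      using inner_form.form_pos[OF inner_form_ip[OF HY] yY]
        inner_form.form_pos[OF inner_form_ip[OF HX] L_in[OF aL yY(1)] y] by auto
    then show ?thesis
      using m by (auto simp: complex_eq_iff zero_less_mult_iff)
  qed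
qed

text \<open>This justifies the \<open>SOME\<close> in \<open>pull\<close>. The finite spanning set
  that Gram-Schmidt starts from is extracted from a finite decomposition of the identity of
  X.\<close>

lemma orthonormal_basis_exists:
  assumes X: "X \<in> XX" and Y: "Y \<in> YY"
  shows "\<exists>B. orthonormal_basis X Y (F X Y) B"
proof -
  interpret I: inner_form opscale "F X Y" "fun_ip X Y" by (rule inner_form_fun_ip[OF assms])
  obtain S where S: "finite S" "F X Y \<subseteq> op.span (S \<inter> F X Y)"
    using finite_support[OF X] Y by blast
  have "op.span (S \<inter> F X Y) = F X Y"
    using S op.span_minimal[OF _ rel_subspace[OF X Y], of "S \<inter> F X Y"] by auto
  then show ?thesis
    using I.orthonormal_basis_exists[of "S \<inter> F X Y"] S
    unfolding orthonormal_basis_def I.orthonormal_def by auto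
qed

text \<open>Without finiteness the outer sum in \<open>pull\<close> would collapse to
  \<open>0\<close> by the convention for infinite index sets.\<close>

lemma support_finite: "X \<in> XX \<Longrightarrow> finite {Y \<in> YY. F X Y \<noteq> {0}}"
proof -
  assume X: "X \<in> XX"
  then obtain T where "finite T" "\<forall>Y\<in>YY. \<forall>v\<in>F X Y. Y \<notin> T \<longrightarrow> v = 0"
    using finite_support by meson
  moreover have "0 \<in> F X Y" if "Y \<in> YY" for Y
    using rel_subspace[OF X that] by (rule op.subspace_0)
  ultimately show ?thesis
    by (auto intro!: finite_subset[of _ T])
qed

section \<open>Pullbacks characterised by intertwining\<close>

definition intertwines :: "'p family \<Rightarrow> 'p family \<Rightarrow> bool" where
  "intertwines a b \<longleftrightarrow> (\<forall>X\<in>XX. \<forall>Y\<in>YY. \<forall>v\<in>F X Y. v \<circ> a X = b Y \<circ> v)"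

lemma intertwines_unique:
  assumes "a \<in> carrier (ell XX)" "a' \<in> carrier (ell XX)" "intertwines a b" "intertwines a' b"
  shows "a = a'"
proof (rule PiE_ext[of _ XX "\<lambda>X. L X X"])
  show "a \<in> (\<Pi>\<^sub>E X\<in>XX. L X X)" "a' \<in> (\<Pi>\<^sub>E X\<in>XX. L X X)"
    using assms(1,2) by (simp_all add: ell_def)
  fix X assume X: "X \<in> XX"
  show "a X = a' X"
  proof (rule cancel_left[OF X])
    show "a X \<in> L X X" "a' X \<in> L X X" using assms(1,2) X by (auto simp: ell_def)
    show "v \<circ> a X = v \<circ> a' X" if "Y \<in> YY" "v \<in> F X Y" for Y v
      using assms(3,4) X that by (simp add: intertwines_def)
  qed
qed

text \<open>Multiplying the defining sum by \<open>v\<close> from the left, the terms of other atoms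
  die by orthogonality. In the remaining ones v w\<dagger> = (w|v) 1, so they add up to b(Y) applied
  to the Fourier expansion of \<open>v\<close> in the chosen basis, that is, to b(Y) v.\<close>

lemma pull_in: "b \<in> carrier (ell YY) \<Longrightarrow> pull XX YY F b \<in> carrier (ell XX)"
  and intertwines_pull: "b \<in> carrier (ell YY) \<Longrightarrow> intertwines (pull XX YY F b) b"
proof -
  assume b: "b \<in> carrier (ell YY)"
  then have bL: "b Y \<in> L Y Y" if "Y \<in> YY" for Y using that by (auto simp: ell_def)
  define B where "B X Y = (SOME B. orthonormal_basis X Y (F X Y) B)" for X Y
  have B: "orthonormal_basis X Y (F X Y) (B X Y)" if "X \<in> XX" "Y \<in> YY" for X Y
    unfolding B_def by (rule someI_ex[OF orthonormal_basis_exists[OF that]])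
  have BF: "w \<in> F X Y" if "X \<in> XX" "Y \<in> YY" "w \<in> B X Y" for w X Y
    using B[OF that(1,2)] that(3) by (auto simp: orthonormal_basis_def)
  define g where "g X Y = (\<Sum>w\<in>B X Y. adj X Y w \<circ> b Y \<circ> w)" for X Y
  have termL: "adj X Y w \<circ> b Y \<circ> w \<in> L X X" if "X \<in> XX" "Y \<in> YY" "w \<in> B X Y" for X Y w
    using that BF bL in_L adj_in_L by (blast intro: L_comp)
  have gL: "g X Y \<in> L X X" if "X \<in> XX" "Y \<in> YY" for X Y
    unfolding g_def by (rule op.subspace_sum[OF L_subspace[OF hilbert_X[OF that(1)]]]) (rule termL[OF that])
  have pull_eq: "pull XX YY F b X = (\<Sum>Y\<in>{Y \<in> YY. F X Y \<noteq> {0}}. g X Y)" if "X \<in> XX" for X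
    using that by (simp add: pull_def g_def B_def)
  have "pull XX YY F b X \<in> L X X" if "X \<in> XX" for X
    unfolding pull_eq[OF that]
    by (rule op.subspace_sum[OF L_subspace[OF hilbert_X[OF that]]]) (use gL[OF that] in simp)
  then show "pull XX YY F b \<in> carrier (ell XX)"
    by (auto simp: ell_def pull_def)
  have v_g: "v \<circ> g X Y = b Y \<circ> v" if X: "X \<in> XX" and Y: "Y \<in> YY" and v: "v \<in> F X Y" for X Y v
  proof -
    interpret I: inner_form opscale "F X Y" "fun_ip X Y" by (rule inner_form_fun_ip[OF X Y])
    have on: "I.orthonormal (B X Y)" and span: "op.span (B X Y) = F X Y"
      using B[OF X Y] by (auto simp: I.orthonormal_def orthonormal_basis_def)
    note HX = hilbert_X[OF X] and HY = hilbert_Y[OF Y]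
    have "v \<circ> g X Y = (\<Sum>w\<in>B X Y. v \<circ> (adj X Y w \<circ> b Y \<circ> w))"
      unfolding g_def by (rule comp_sum_right[OF HX in_L[OF X Y v] termL[OF X Y]])
    also have "\<dots> = (\<Sum>w\<in>B X Y. b Y \<circ> opscale (fun_ip X Y w v) w)"
    proof (rule sum.cong)
      fix w assume "w \<in> B X Y"
      then have w: "w \<in> F X Y" by (rule BF[OF X Y])
      have "v \<circ> (adj X Y w \<circ> b Y \<circ> w) = opscale (fun_ip X Y w v) (idop Y) \<circ> b Y \<circ> w"
        by (simp only: fun_ip_eq[OF X Y w v] comp_assoc)
      also have "\<dots> = b Y \<circ> opscale (fun_ip X Y w v) w"
        using L_idop(2)[OF bL[OF Y]]
        by (simp add: comp_opscale_left comp_opscale_right[OF bL[OF Y] in_L[OF X Y w]])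
      finally show "v \<circ> (adj X Y w \<circ> b Y \<circ> w) = b Y \<circ> opscale (fun_ip X Y w v) w" .
    qed simp
    also have "\<dots> = b Y \<circ> I.proj (B X Y) v"
      unfolding I.proj_def
      by (rule comp_sum_right[OF HY bL[OF Y], symmetric])
        (use L_closed(3)[OF HY] in_L[OF X Y] BF[OF X Y] in blast)
    also have "I.proj (B X Y) v = v"
      by (rule I.proj_span[OF on]) (simp add: span v)
    finally show ?thesis .
  qed
  have v_g0: "v \<circ> g X Y' = 0" if X: "X \<in> XX" and Y: "Y \<in> YY" "Y' \<in> YY" "Y' \<noteq> Y" and v: "v \<in> F X Y" for X Y Y' v
  proof -
    have "v \<circ> g X Y' = (\<Sum>w\<in>B X Y'. v \<circ> (adj X Y' w \<circ> b Y' \<circ> w))"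
      unfolding g_def by (rule comp_sum_right[OF hilbert_X[OF X] in_L[OF X Y(1) v] termL[OF X Y(2)]])
    also have "\<dots> = (\<Sum>w\<in>B X Y'. 0)"
    proof (rule sum.cong)
      fix w assume "w \<in> B X Y'"
      then have "v \<circ> adj X Y' w = 0" using orth_diff[OF X Y(2,1) BF[OF X Y(2)] v Y(3)] by simp
      then show "v \<circ> (adj X Y' w \<circ> b Y' \<circ> w) = 0"
        by (simp only: comp_assoc[symmetric] comp_0_left)
    qed simp
    finally show ?thesis by simp
  qed
  show "intertwines (pull XX YY F b) b"
    unfolding intertwines_def
  proof (intro ballI)
    fix X Y v assume X: "X \<in> XX" and Y: "Y \<in> YY" and v: "v \<in> F X Y"
    let ?T = "{Y \<in> YY. F X Y \<noteq> {0}}"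
    have "v \<circ> pull XX YY F b X = (\<Sum>Y'\<in>?T. v \<circ> g X Y')"
      unfolding pull_eq[OF X]
      by (rule comp_sum_right[OF hilbert_X[OF X] in_L[OF X Y v], where X = X]) (use gL[OF X] in simp)
    also have "\<dots> = (\<Sum>Y'\<in>?T. if Y' = Y then b Y \<circ> v else 0)"
      by (rule sum.cong) (use v_g0[OF X Y _ _ v] v_g[OF X Y v] in auto)
    also have "\<dots> = (if Y \<in> ?T then b Y \<circ> v else 0)"
      by (rule sum.delta[OF support_finite[OF X]])
    \<comment> \<open>If \<open>Y\<close> was left out of the sum then F(X,Y) is zero, so
      \<open>v\<close> is \<open>0\<close> and both sides vanish.\<close>
    also have "\<dots> = b Y \<circ> v"
      using v Y comp_0_right[OF bL[OF Y]] by (cases "Y \<in> ?T") auto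
    finally show "v \<circ> pull XX YY F b X = b Y \<circ> v" .
  qed
qed

text \<open>From here on pullbacks are computed by guessing the value and checking that it
  intertwines, never by expanding the sum over bases.\<close>

lemma pull_eqI:
  assumes "a \<in> carrier (ell XX)" "b \<in> carrier (ell YY)" "intertwines a b"
  shows "pull XX YY F b = a"
  using intertwines_unique[OF pull_in[OF assms(2)] assms(1) intertwines_pull[OF assms(2)] assms(3)] .

lemma pull_comm: "b \<in> carrier (ell YY) \<Longrightarrow> X \<in> XX \<Longrightarrow> Y \<in> YY \<Longrightarrow> v \<in> F X Y \<Longrightarrow>
    v \<circ> pull XX YY F b X = b Y \<circ> v"
  using intertwines_pull by (simp add: intertwines_def)

text \<open>Taking adjoints in v a = b v would only yield a relation for v\<dagger>, so the identity
  of X is decomposed instead. On a generator w'\<dagger> w one has a\<dagger> w'\<dagger> = (w'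
  a)\<dagger> = (b w')\<dagger> = w'\<dagger> b\<dagger>, after which v w'\<dagger> is moved past
  b\<dagger> by \<open>orth_commute\<close>.\<close>

lemma intertwines_adj:
  assumes a: "a \<in> carrier (ell XX)" and b: "b \<in> carrier (ell YY)" and ab: "intertwines a b"
    and X: "X \<in> XX" and Y: "Y \<in> YY" and v: "v \<in> F X Y"
  shows "v \<circ> adj X X (a X) = adj Y Y (b Y) \<circ> v"
proof -
  have aL: "a X \<in> L X X" using a X by (auto simp: ell_def)
  have bL: "b Y \<in> L Y Y" if "Y \<in> YY" for Y using b that by (auto simp: ell_def)
  note HX = hilbert_X[OF X] and HY = hilbert_Y[OF Y]
  note vL = in_L[OF X Y v] and a'L = adj_L[OF HX HX aL]
  have b'L: "adj Y Y (b Y) \<in> L Y Y" if "Y \<in> YY" for Y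
    using that by (intro adj_L hilbert_Y bL)
  define P where "P t \<longleftrightarrow> t \<in> L X X \<and>
    v \<circ> adj X X (a X) \<circ> t = adj Y Y (b Y) \<circ> v \<circ> t" for t
  have "P (idop X)"
    using unit[OF X]
  proof (induction rule: op.span_induct)
    case base
    note l = L_comp[OF a'L vL] L_comp[OF vL b'L[OF Y]]
    show ?case unfolding op.subspace_def
      by (auto simp: P_def L_closed[OF HX] comp_add_right[OF l(1), of _ X] comp_add_right[OF l(2), of _ X]
          comp_opscale_right[OF l(1), of _ X] comp_opscale_right[OF l(2), of _ X]
          comp_0_right[OF l(1)] comp_0_right[OF l(2)])
  next
    case (step t)
    then obtain Y' w w' where t: "t = adj X Y' w' \<circ> w" and w: "Y' \<in> YY" "w \<in> F X Y'" "w' \<in> F X Y'"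
      unfolding source_span_def by blast
    note HY' = hilbert_Y[OF w(1)] and wL = in_L[OF X w(1) w(3)]
    have "adj X X (a X) \<circ> adj X Y' w' = adj X Y' (w' \<circ> a X)"
      using adj_comp[OF HX HX HY' aL wL] by simp
    also have "w' \<circ> a X = b Y' \<circ> w'" using ab X w by (simp add: intertwines_def)
    also have "adj X Y' (b Y' \<circ> w') = adj X Y' w' \<circ> adj Y' Y' (b Y')"
      using adj_comp[OF HX HY' HY' wL bL[OF w(1)]] .
    finally have 1: "adj X X (a X) \<circ> adj X Y' w' = adj X Y' w' \<circ> adj Y' Y' (b Y')" .
    have "v \<circ> adj X X (a X) \<circ> t = v \<circ> (adj X X (a X) \<circ> adj X Y' w') \<circ> w"
      by (simp only: t comp_assoc)
    also have "\<dots> = ((v \<circ> adj X Y' w') \<circ> adj Y' Y' (b Y')) \<circ> w"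
      by (simp only: 1 comp_assoc)
    also have "(v \<circ> adj X Y' w') \<circ> adj Y' Y' (b Y') = adj Y Y (b Y) \<circ> (v \<circ> adj X Y' w')"
      using orth_commute[OF X w(1) Y w(3) v, of "\<lambda>Y. adj Y Y (b Y)"] b'L by simp
    finally have "v \<circ> adj X X (a X) \<circ> t = adj Y Y (b Y) \<circ> v \<circ> t"
      by (simp only: t comp_assoc)
    moreover have "t \<in> L X X"
      unfolding t by (rule L_comp[OF in_L adj_in_L]) (use X w in auto)
    ultimately show ?case by (simp add: P_def)
  qed
  then show ?thesis
    using L_idop(1)[OF L_comp[OF a'L vL]] L_idop(1)[OF L_comp[OF vL b'L[OF Y]]] by (simp add: P_def)
qed

end

section \<open>The functor \<open>\<ell>\<close>\<close>

lemma ell_in: "a \<in> carrier (ell XX) \<Longrightarrow> X \<in> XX \<Longrightarrow> a X \<in> L X X"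
  by (auto simp: ell_def)

lemma ell_carrierI: "(\<And>X. X \<in> XX \<Longrightarrow> a X \<in> L X X) \<Longrightarrow> restrict a XX \<in> carrier (ell XX)"
  by (simp add: ell_def)

lemma ell_ext:
  "\<lbrakk>a \<in> carrier (ell XX); a' \<in> carrier (ell XX); \<And>X. X \<in> XX \<Longrightarrow> a X = a' X\<rbrakk> \<Longrightarrow> a = a'"
  by (simp add: ell_def PiE_ext)

lemma ell_apply:
  assumes "X \<in> XX"
  shows "(a \<otimes>\<^bsub>ell XX\<^esub> b) X = a X \<circ> b X" "\<one>\<^bsub>ell XX\<^esub> X = idop X" "\<zero>\<^bsub>ell XX\<^esub> X = 0"
    "(a \<oplus>\<^bsub>ell XX\<^esub> b) X = a X + b X" "(c \<odot>\<^bsub>ell XX\<^esub> a) X = opscale c (a X)"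
    "star (ell XX) a X = adj X X (a X)"
  using assms by (simp_all add: ell_def)

lemma ell_closed:
  assumes "quantum_set XX"
  shows "\<one>\<^bsub>ell XX\<^esub> \<in> carrier (ell XX)" "\<zero>\<^bsub>ell XX\<^esub> \<in> carrier (ell XX)"
    "\<lbrakk>a \<in> carrier (ell XX); b \<in> carrier (ell XX)\<rbrakk> \<Longrightarrow> a \<otimes>\<^bsub>ell XX\<^esub> b \<in> carrier (ell XX)"
    "\<lbrakk>a \<in> carrier (ell XX); b \<in> carrier (ell XX)\<rbrakk> \<Longrightarrow> a \<oplus>\<^bsub>ell XX\<^esub> b \<in> carrier (ell XX)"
    "a \<in> carrier (ell XX) \<Longrightarrow> c \<odot>\<^bsub>ell XX\<^esub> a \<in> carrier (ell XX)"
    "a \<in> carrier (ell XX) \<Longrightarrow> star (ell XX) a \<in> carrier (ell XX)"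
proof -
  note H = quantum_setD[OF assms]
  show "\<one>\<^bsub>ell XX\<^esub> \<in> carrier (ell XX)" "\<zero>\<^bsub>ell XX\<^esub> \<in> carrier (ell XX)"
    using H by (simp_all add: ell_def L_closed)
  assume a: "a \<in> carrier (ell XX)"
  show "c \<odot>\<^bsub>ell XX\<^esub> a \<in> carrier (ell XX)"
    using H ell_in[OF a] by (auto simp: ell_def intro!: L_closed)
  show "star (ell XX) a \<in> carrier (ell XX)"
    using H ell_in[OF a] by (auto simp: ell_def intro!: adj_L)
  assume b: "b \<in> carrier (ell XX)"
  show "a \<otimes>\<^bsub>ell XX\<^esub> b \<in> carrier (ell XX)"
    using ell_in[OF a] ell_in[OF b] by (auto simp: ell_def intro: L_comp)
  show "a \<oplus>\<^bsub>ell XX\<^esub> b \<in> carrier (ell XX)"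
    using H ell_in[OF a] ell_in[OF b] by (auto simp: ell_def intro!: L_closed)
qed

lemma cring_complex_ring: "cring complex_ring"
proof (rule cringI)
  show "abelian_group complex_ring"
    by (rule abelian_groupI) (auto simp: complex_ring_def intro: exI[of _ "- x" for x])
  show "comm_monoid complex_ring"
    by (rule comm_monoidI) (auto simp: complex_ring_def)
qed (simp add: complex_ring_def ring_distribs)

lemma unital_star_algebra_ell:
  fixes XX :: "'p qset"
  assumes "quantum_set XX"
  shows "unital_star_algebra (ell XX)"
proof -
  let ?A = "ell XX"
  note H = quantum_setD[OF assms] and cl = ell_closed[OF assms]
  have dist: "x \<otimes>\<^bsub>?A\<^esub> (y \<oplus>\<^bsub>?A\<^esub> z) = x \<otimes>\<^bsub>?A\<^esub> y \<oplus>\<^bsub>?A\<^esub> x \<otimes>\<^bsub>?A\<^esub> z"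
    if "x \<in> carrier ?A" "y \<in> carrier ?A" "z \<in> carrier ?A" for x y z
    using that comp_add_right[OF ell_in ell_in ell_in, OF that(1) _ that(2) _ that(3)]
    by (intro ell_ext[of _ XX]) (auto simp: ell_apply cl)
  have group: "abelian_group ?A"
  proof (rule abelian_groupI)
    show "\<exists>y\<in>carrier ?A. y \<oplus>\<^bsub>?A\<^esub> x = \<zero>\<^bsub>?A\<^esub>" if "x \<in> carrier ?A" for x
    proof (rule bexI[of _ "(-1) \<odot>\<^bsub>?A\<^esub> x"])
      show "(-1) \<odot>\<^bsub>?A\<^esub> x \<oplus>\<^bsub>?A\<^esub> x = \<zero>\<^bsub>?A\<^esub>"
        using that by (intro ell_ext[of _ XX]) (auto simp: ell_apply cl)
    qed (use that cl in auto)
  qed (auto intro!: cl ell_ext[of _ XX] simp: ell_apply add_ac)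
  have ring: "ring ?A"
  proof (rule ringI[OF group])
    show "monoid ?A"
      by (rule monoidI)
        (auto intro!: cl ell_ext[of _ XX] simp: ell_apply comp_assoc L_idop[OF ell_in])
    show "(x \<oplus>\<^bsub>?A\<^esub> y) \<otimes>\<^bsub>?A\<^esub> z = x \<otimes>\<^bsub>?A\<^esub> z \<oplus>\<^bsub>?A\<^esub> y \<otimes>\<^bsub>?A\<^esub> z"
      if "x \<in> carrier ?A" "y \<in> carrier ?A" "z \<in> carrier ?A" for x y z
      using that by (intro ell_ext[of _ XX]) (auto simp: ell_apply cl comp_add_left)
  qed (rule dist)
  have module: "Module.module complex_ring ?A"
    by (rule Module.moduleI[OF cring_complex_ring group])
      (auto intro!: cl ell_ext[of _ XX] simp: ell_apply complex_ring_def op.scale_left_distrib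
        op.scale_right_distrib)
  have mult_smult: "x \<otimes>\<^bsub>?A\<^esub> (c \<odot>\<^bsub>?A\<^esub> y) = c \<odot>\<^bsub>?A\<^esub> (x \<otimes>\<^bsub>?A\<^esub> y)"
    if "x \<in> carrier ?A" "y \<in> carrier ?A" for c x y
    using that comp_opscale_right[OF ell_in ell_in, OF that(1) _ that(2)]
    by (intro ell_ext[of _ XX]) (auto simp: ell_apply cl)
  have smult_mult: "(c \<odot>\<^bsub>?A\<^esub> x) \<otimes>\<^bsub>?A\<^esub> y = c \<odot>\<^bsub>?A\<^esub> (x \<otimes>\<^bsub>?A\<^esub> y)"
    if "x \<in> carrier ?A" "y \<in> carrier ?A" for c x y
    using that by (intro ell_ext[of _ XX]) (auto simp: ell_apply cl comp_opscale_left)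
  have star_star: "star ?A (star ?A x) = x" if "x \<in> carrier ?A" for x
    using that by (intro ell_ext[of _ XX]) (auto simp: ell_apply cl adj_adj[OF H H ell_in])
  have star_add: "star ?A (x \<oplus>\<^bsub>?A\<^esub> y) = star ?A x \<oplus>\<^bsub>?A\<^esub> star ?A y"
    if "x \<in> carrier ?A" "y \<in> carrier ?A" for x y
    using that by (intro ell_ext[of _ XX]) (auto simp: ell_apply cl adj_add[OF H H ell_in ell_in])
  have star_mult: "star ?A (x \<otimes>\<^bsub>?A\<^esub> y) = star ?A y \<otimes>\<^bsub>?A\<^esub> star ?A x"
    if "x \<in> carrier ?A" "y \<in> carrier ?A" for x y
    using that by (intro ell_ext[of _ XX]) (auto simp: ell_apply cl adj_comp[OF H H H ell_in ell_in])
  have star_smult: "star ?A (c \<odot>\<^bsub>?A\<^esub> x) = cnj c \<odot>\<^bsub>?A\<^esub> star ?A x" if "x \<in> carrier ?A" for c x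
    using that by (intro ell_ext[of _ XX]) (auto simp: ell_apply cl adj_opscale[OF H H ell_in])
  show ?thesis
    unfolding unital_star_algebra_def
    by (simp add: ring module mult_smult smult_mult star_star star_add star_mult star_smult cl)
qed

context quantum_function
begin

lemma intertwinesI:
  assumes "\<And>X Y v. \<lbrakk>X \<in> XX; Y \<in> YY; v \<in> F X Y; v \<in> L X Y\<rbrakk> \<Longrightarrow> v \<circ> a X = b Y \<circ> v"
  shows "intertwines a b"
  using assms in_L by (simp add: intertwines_def)

lemma pull_add:
  assumes "a \<in> carrier (ell YY)" "b \<in> carrier (ell YY)"
  shows "pull XX YY F (a \<oplus>\<^bsub>ell YY\<^esub> b) = pull XX YY F a \<oplus>\<^bsub>ell XX\<^esub> pull XX YY F b"
proof (rule pull_eqI)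
  show "intertwines (pull XX YY F a \<oplus>\<^bsub>ell XX\<^esub> pull XX YY F b) (a \<oplus>\<^bsub>ell YY\<^esub> b)"
    by (rule intertwinesI)
      (simp add: ell_apply comp_add_left comp_add_right[OF _ ell_in[OF pull_in] ell_in[OF pull_in]]
        assms pull_comm)
qed (use assms in \<open>auto intro!: ell_closed XX YY pull_in\<close>)

lemma pull_mult:
  assumes "a \<in> carrier (ell YY)" "b \<in> carrier (ell YY)"
  shows "pull XX YY F (a \<otimes>\<^bsub>ell YY\<^esub> b) = pull XX YY F a \<otimes>\<^bsub>ell XX\<^esub> pull XX YY F b"
proof (rule pull_eqI)
  show "intertwines (pull XX YY F a \<otimes>\<^bsub>ell XX\<^esub> pull XX YY F b) (a \<otimes>\<^bsub>ell YY\<^esub> b)"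
  proof (rule intertwinesI)
    fix X Y v assume v: "X \<in> XX" "Y \<in> YY" "v \<in> F X Y"
    have "v \<circ> (pull XX YY F a X \<circ> pull XX YY F b X) = a Y \<circ> (v \<circ> pull XX YY F b X)"
      by (simp only: comp_assoc[symmetric] pull_comm[OF assms(1) v])
    then show "v \<circ> (pull XX YY F a \<otimes>\<^bsub>ell XX\<^esub> pull XX YY F b) X = (a \<otimes>\<^bsub>ell YY\<^esub> b) Y \<circ> v"
      using v by (simp add: ell_apply pull_comm[OF assms(2) v] comp_assoc)
  qed
qed (use assms in \<open>auto intro!: ell_closed XX YY pull_in\<close>)

lemma pull_smult:
  assumes "a \<in> carrier (ell YY)"
  shows "pull XX YY F (c \<odot>\<^bsub>ell YY\<^esub> a) = c \<odot>\<^bsub>ell XX\<^esub> pull XX YY F a"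
proof (rule pull_eqI)
  show "intertwines (c \<odot>\<^bsub>ell XX\<^esub> pull XX YY F a) (c \<odot>\<^bsub>ell YY\<^esub> a)"
    by (rule intertwinesI)
      (simp add: ell_apply comp_opscale_left comp_opscale_right[OF _ ell_in[OF pull_in]] assms pull_comm)
qed (use assms in \<open>auto intro!: ell_closed XX YY pull_in\<close>)

lemma pull_one: "pull XX YY F \<one>\<^bsub>ell YY\<^esub> = \<one>\<^bsub>ell XX\<^esub>"
proof (rule pull_eqI)
  show "intertwines \<one>\<^bsub>ell XX\<^esub> \<one>\<^bsub>ell YY\<^esub>"
    by (rule intertwinesI) (simp add: ell_apply L_idop)
qed (auto intro!: ell_closed XX YY)

lemma pull_star:
  assumes "a \<in> carrier (ell YY)"
  shows "pull XX YY F (star (ell YY) a) = star (ell XX) (pull XX YY F a)"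
proof (rule pull_eqI)
  show "intertwines (star (ell XX) (pull XX YY F a)) (star (ell YY) a)"
    by (rule intertwinesI)
      (simp add: ell_apply intertwines_adj[OF pull_in _ intertwines_pull] assms)
qed (use assms in \<open>auto intro!: ell_closed XX YY pull_in\<close>)

lemma pull_star_hom: "pull XX YY F \<in> star_hom (ell YY) (ell XX)"
  by (auto simp: star_hom_def ring_hom_def pull_in pull_add pull_mult pull_smult pull_one pull_star)

end

section \<open>Identities and composites of functions\<close>

lemma qid_Fun:
  assumes "quantum_set XX"
  shows "qid XX \<in> Fun XX XX"
proof (rule FunI)
  note H = quantum_setD[OF assms]
  show "binrel XX XX (qid XX)"
    unfolding binrel_def
  proof (intro conjI ballI allI impI)
    fix X Y assume "X \<in> XX" "Y \<in> XX"
    show "op.subspace (qid XX X Y)" by (rule qid_subspace)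
    show "qid XX X Y \<subseteq> L X Y"
      using H[OF \<open>X \<in> XX\<close>] H[OF \<open>Y \<in> XX\<close>] by (auto simp: qid_def intro: L_closed)
  qed (auto simp: qid_def)
  have id: "idop X \<in> qid XX X X" if "X \<in> XX" for X
    unfolding qid_same[OF that] by (rule image_eqI[of _ _ 1]) simp_all
  show "idop X \<in> op.span (source_span XX (qid XX) X)" if X: "X \<in> XX" for X
  proof (rule op.span_base)
    have "idop X = adj X X (idop X) \<circ> idop X"
      using H[OF X] by (simp add: adj_idop L_idop(1)[OF idop_L])
    then show "idop X \<in> source_span XX (qid XX) X"
      unfolding source_span_def using X id[OF X] by blast
  qed
  fix X Y Y' v v'
  assume XY: "X \<in> XX" "Y \<in> XX" "Y' \<in> XX" and v: "v \<in> qid XX X Y" "v' \<in> qid XX X Y'"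
  show "v' \<circ> adj X Y v \<in> qid XX Y Y'"
  proof (cases "X = Y \<and> X = Y'")
    case True
    then have "v \<in> range (\<lambda>c. opscale c (idop X))" "v' \<in> range (\<lambda>c. opscale c (idop X))"
      using v True qid_same[OF XY(1)] by metis+
    then obtain c d where "v = opscale c (idop X)" "v' = opscale d (idop X)" by blast
    then have "v' \<circ> adj X Y v = opscale (d * cnj c) (idop X)"
      using True H[OF XY(1)]
      by (simp add: adj_opscale adj_idop comp_opscale_left comp_opscale_right[OF idop_L idop_L] L_idop(1)[OF idop_L])
    then have "v' \<circ> adj X Y v \<in> qid XX X X"
      unfolding qid_same[OF XY(1)] by (rule image_eqI) simp
    then show ?thesis using True by metis
  next
    case False
    then have "v = 0 \<or> v' = 0" using v qid_diff[of X Y XX] qid_diff[of X Y' XX] by blast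
    then have "v' \<circ> adj X Y v = 0"
    proof
      assume "v' = 0"
      then show ?thesis by (simp add: comp_0_left)
    next
      assume "v = 0"
      moreover have "v' \<in> L X Y'"
        using v(2) H[OF XY(1)] H[OF XY(3)] by (auto simp: qid_def intro: L_closed split: if_splits)
      ultimately show ?thesis using H XY by (simp add: adj_0 comp_0_right)
    qed
    then show ?thesis using qid_subspace op.subspace_0 by metis
  qed
qed

lemma quantum_function_qid: "quantum_set XX \<Longrightarrow> quantum_function XX XX (qid XX)"
  by unfold_locales (auto intro: qid_Fun)

lemma pull_qid:
  assumes "quantum_set XX" "a \<in> carrier (ell XX)"
  shows "pull XX XX (qid XX) a = a"
proof -
  interpret quantum_function XX XX "qid XX" by (rule quantum_function_qid[OF assms(1)])
  show ?thesis
  proof (rule pull_eqI)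
    show "intertwines a a"
    proof (rule intertwinesI)
      fix X Y v assume XY: "X \<in> XX" "Y \<in> XX" and v: "v \<in> qid XX X Y"
      note aX = ell_in[OF assms(2) XY(1)] and aY = ell_in[OF assms(2) XY(2)]
      show "v \<circ> a X = a Y \<circ> v"
      proof (cases "X = Y")
        case True
        then obtain c where "v = opscale c (idop X)" using v by (auto simp: qid_def XY)
        then show ?thesis
          using True aY by (simp add: comp_opscale_left comp_opscale_right[OF aY idop_L] hilbert_X XY L_idop)
      next
        case False
        then show ?thesis using v comp_0_right[OF aY] by (simp add: qid_diff comp_0_left)
      qed
    qed
  qed (use assms in auto)
qed

locale quantum_function_pair =
  F: quantum_function XX YY F + G: quantum_function YY ZZ G for XX YY ZZ :: "'p qset" and F G
begin

lemma qcomp_spanning_in_L: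
  assumes "X \<in> XX" "Z \<in> ZZ" "t \<in> {s \<circ> r | Y s r. Y \<in> YY \<and> s \<in> G Y Z \<and> r \<in> F X Y}"
  shows "t \<in> L X Z"
  using assms F.in_L G.in_L L_comp by blast

lemma qcomp_in: "Y \<in> YY \<Longrightarrow> s \<in> G Y Z \<Longrightarrow> r \<in> F X Y \<Longrightarrow> s \<circ> r \<in> qcomp YY G F X Z"
  unfolding qcomp_def by (rule op.span_base) blast

lemma qcomp_in_L: "X \<in> XX \<Longrightarrow> Z \<in> ZZ \<Longrightarrow> qcomp YY G F X Z \<subseteq> L X Z"
  unfolding qcomp_def
  by (rule op.span_minimal) (use qcomp_spanning_in_L L_subspace[OF G.hilbert_Y] in blast)+

text \<open>In a generator v'\<dagger> v of the identity of X the identity of Y can be inserted in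
  the middle and decomposed in turn. Each resulting v'\<dagger> w'\<dagger> w v equals (w'
  v')\<dagger> (w v), a generator for the composite.\<close>

lemma qcomp_unit:
  assumes X: "X \<in> XX"
  shows "idop X \<in> op.span (source_span ZZ (qcomp YY G F) X)"
  using F.unit[OF X]
proof (induction rule: op.span_induct)
  case base
  then show ?case by (simp add: op.subspace_span)
next
  case (step t)
  then obtain Y v v' where t: "t = adj X Y v' \<circ> v" and v: "Y \<in> YY" "v \<in> F X Y" "v' \<in> F X Y"
    unfolding source_span_def by blast
  note HX = F.hilbert_X[OF X] and HY = F.hilbert_Y[OF v(1)]
  note vL = F.in_L[OF X v(1,2)] and v'L = F.in_L[OF X v(1,3)] and aL = F.adj_in_L[OF X v(1,3)]
  let ?P = "\<lambda>u. u \<in> L Y Y \<and> adj X Y v' \<circ> u \<circ> v \<in> op.span (source_span ZZ (qcomp YY G F) X)"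
  have "?P (idop Y)"
    using G.unit[OF v(1)]
  proof (induction rule: op.span_induct)
    case base
    show ?case unfolding op.subspace_def
      by (auto simp: L_closed[OF HY] comp_add_right[OF aL, of _ Y] comp_opscale_right[OF aL, of _ Y]
          comp_0_right[OF aL] comp_add_left comp_opscale_left comp_0_left op.span_zero
          intro: op.span_add op.span_scale)
  next
    case (step u)
    then obtain Z w w' where u: "u = adj Y Z w' \<circ> w" and w: "Z \<in> ZZ" "w \<in> G Y Z" "w' \<in> G Y Z"
      unfolding source_span_def by blast
    have "adj X Y v' \<circ> u \<circ> v = adj X Z (w' \<circ> v') \<circ> (w \<circ> v)"
      unfolding u adj_comp[OF HX HY G.hilbert_Y[OF w(1)] v'L G.in_L[OF v(1) w(1,3)]]
      by (simp only: comp_assoc)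
    also have "\<dots> \<in> source_span ZZ (qcomp YY G F) X"
      unfolding source_span_def using w(1) qcomp_in[OF v(1) w(2) v(2)] qcomp_in[OF v(1) w(3) v(3)] by blast
    finally show ?case
      unfolding u using L_comp[OF G.in_L[OF v(1) w(1,2)] G.adj_in_L[OF v(1) w(1,3)]]
      by (auto intro: op.span_base)
  qed
  then show ?case
    using L_idop(1)[OF aL] by (simp add: t)
qed

text \<open>On generators, w' v' (w v)\<dagger> = w' (v' v\<dagger>) w\<dagger>. Orthogonality for F
  makes the middle a scalar or zero, and what remains is orthogonality for G.\<close>

lemma qcomp_orth:
  assumes X: "X \<in> XX" and Z: "Z \<in> ZZ" "Z' \<in> ZZ"
    and u: "u \<in> qcomp YY G F X Z" and u': "u' \<in> qcomp YY G F X Z'"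
  shows "u' \<circ> adj X Z u \<in> qid ZZ Z Z'"
proof -
  note HX = F.hilbert_X[OF X] and HZ = G.hilbert_Y[OF Z(1)]
  note sub = qid_subspace[of ZZ Z Z']
  have gen: "w' \<circ> v' \<circ> adj X Z (w \<circ> v) \<in> qid ZZ Z Z'"
    if "Y \<in> YY" "w \<in> G Y Z" "v \<in> F X Y" "Y' \<in> YY" "w' \<in> G Y' Z'" "v' \<in> F X Y'" for Y Y' v v' w w'
  proof -
    note wL = G.in_L[OF that(1) Z(1) that(2)] and w'L = G.in_L[OF that(4) Z(2) that(5)]
    have e: "w' \<circ> v' \<circ> adj X Z (w \<circ> v) = w' \<circ> (v' \<circ> adj X Y v) \<circ> adj Y Z w"
      unfolding adj_comp[OF HX F.hilbert_Y[OF that(1)] HZ F.in_L[OF X that(1,3)] wL]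
      by (simp only: comp_assoc)
    show ?thesis
    proof (cases "Y = Y'")
      case True
      then obtain c where c: "v' \<circ> adj X Y v = opscale c (idop Y)"
        using F.orth_same[OF X \<open>Y \<in> YY\<close> \<open>v \<in> F X Y\<close>] \<open>v' \<in> F X Y'\<close> by metis
      have "w' \<circ> v' \<circ> adj X Z (w \<circ> v) = opscale c (w' \<circ> adj Y Z w)"
        unfolding e c using True w'L F.hilbert_Y[OF that(1)]
        by (simp add: comp_opscale_right[OF w'L idop_L] comp_opscale_left L_idop)
      then show ?thesis
        using G.orth[OF that(1) Z that(2)] that(5) True op.subspace_scale[OF sub] by metis
    next
      case False
      then have "v' \<circ> adj X Y v = 0" by (rule F.orth_diff[OF X that(1,4,3,6)])
      then show ?thesis
        unfolding e using op.subspace_0[OF sub] by (simp add: comp_0_right[OF w'L] comp_0_left)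
    qed
  qed
  let ?S = "\<lambda>Z. {s \<circ> r | Y s r. Y \<in> YY \<and> s \<in> G Y Z \<and> r \<in> F X Y}"
  \<comment> \<open>The extension to spans is done one argument at a time: here \<open>u'\<close> is
    arbitrary and the other operator a generator. The second extension also uses conjugate linearity
    of the adjoint.\<close>
  have left: "u' \<circ> adj X Z g \<in> qid ZZ Z Z'" if "g \<in> ?S Z" for g
    using u' unfolding qcomp_def
  proof (induction rule: op.span_induct)
    case base
    show ?case unfolding op.subspace_def
      using op.subspace_0[OF sub] op.subspace_add[OF sub] op.subspace_scale[OF sub]
      by (auto simp: comp_add_left comp_opscale_left comp_0_left)
  next
    case (step h)
    then show ?case using that gen by auto
  qed
  note u'L = subsetD[OF qcomp_in_L[OF X Z(2)] u']
  have "u \<in> L X Z \<and> u' \<circ> adj X Z u \<in> qid ZZ Z Z'"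
    using u unfolding qcomp_def
  proof (induction rule: op.span_induct)
    case base
    show ?case unfolding op.subspace_def
      using op.subspace_0[OF sub] op.subspace_add[OF sub] op.subspace_scale[OF sub]
      by (auto simp: L_closed[OF HZ] adj_add[OF HX HZ] adj_opscale[OF HX HZ] adj_0[OF HX HZ]
          comp_add_right[OF u'L adj_L[OF HX HZ] adj_L[OF HX HZ]]
          comp_opscale_right[OF u'L adj_L[OF HX HZ]] comp_0_right[OF u'L])
  next
    case (step g)
    then show ?case using left qcomp_spanning_in_L[OF X Z(1)] by blast
  qed
  then show ?thesis by simp
qed

lemma qcomp_Fun: "qcomp YY G F \<in> Fun XX ZZ"
proof (rule FunI)
  show "binrel XX ZZ (qcomp YY G F)"
    unfolding binrel_def
  proof (intro conjI ballI allI impI)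
    show "op.subspace (qcomp YY G F X Z)" for X Z
      unfolding qcomp_def by (rule op.subspace_span)
    fix X Z assume XZ: "X \<notin> XX \<or> Z \<notin> ZZ"
    have "t = 0" if "t \<in> {s \<circ> r | Y s r. Y \<in> YY \<and> s \<in> G Y Z \<and> r \<in> F X Y}" for t
    proof -
      obtain Y s r where t: "t = s \<circ> r" and Y: "Y \<in> YY" "s \<in> G Y Z" "r \<in> F X Y"
        using \<open>t \<in> _\<close> by blast
      show ?thesis
      proof (cases "Z \<in> ZZ")
        case True
        then have "r = 0" using XZ F.off[of X Y] Y(3) by blast
        then show ?thesis by (simp add: t comp_0_right[OF G.in_L[OF Y(1) True Y(2)]])
      next
        case False
        then have "s = 0" using G.off[of Y Z] Y(2) by blast
        then show ?thesis by (simp add: t comp_0_left)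
      qed
    qed
    then have "{s \<circ> r | Y s r. Y \<in> YY \<and> s \<in> G Y Z \<and> r \<in> F X Y} \<subseteq> {0}" by blast
    then have "qcomp YY G F X Z \<subseteq> {0}"
      unfolding qcomp_def by (intro op.span_minimal op.subspace_single_0)
    then show "qcomp YY G F X Z = {0}"
      unfolding qcomp_def using op.span_zero by blast
  qed (rule qcomp_in_L)
qed (rule qcomp_unit qcomp_orth; assumption)+

sublocale comp: quantum_function XX ZZ "qcomp YY G F"
  by unfold_locales (auto intro: F.XX G.YY qcomp_Fun)

text \<open>The iterated pullback intertwines: a generator w v lets it pass in two steps, once
  through \<open>v\<close> and once through \<open>w\<close>.\<close>

lemma pull_qcomp:
  assumes "c \<in> carrier (ell ZZ)"
  shows "pull XX ZZ (qcomp YY G F) c = pull XX YY F (pull YY ZZ G c)"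
proof (rule comp.pull_eqI)
  let ?a = "pull XX YY F (pull YY ZZ G c)"
  note Gc = G.pull_in[OF assms]
  show a: "?a \<in> carrier (ell XX)" by (rule F.pull_in[OF Gc])
  show "comp.intertwines ?a c"
  proof (rule comp.intertwinesI)
    fix X Z u assume X: "X \<in> XX" and Z: "Z \<in> ZZ" and u: "u \<in> qcomp YY G F X Z"
    note cL = ell_in[OF assms Z]
    have "u \<in> L X Z \<and> u \<circ> ?a X = c Z \<circ> u"
      using u unfolding qcomp_def
    proof (induction rule: op.span_induct)
      case base
      note HZ = G.hilbert_Y[OF Z]
      show ?case unfolding op.subspace_def
        by (auto simp: L_closed[OF HZ] comp_add_left comp_opscale_left comp_0_left
            comp_add_right[OF cL, of _ X] comp_opscale_right[OF cL, of _ X] comp_0_right[OF cL])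
    next
      case (step t)
      then obtain Y w v where t: "t = w \<circ> v" and v: "Y \<in> YY" "w \<in> G Y Z" "v \<in> F X Y" by blast
      have "t \<circ> ?a X = w \<circ> pull YY ZZ G c Y \<circ> v"
        by (simp only: t comp_assoc F.pull_comm[OF Gc X v(1,3)])
      also have "\<dots> = c Z \<circ> t"
        by (simp only: t comp_assoc[symmetric] G.pull_comm[OF assms v(1) Z v(2)])
      finally show ?case using step qcomp_spanning_in_L[OF X Z] by blast
    qed
    then show "u \<circ> ?a X = c Z \<circ> u" by blast
  qed
qed (rule assms)

end

lemma quantum_functionI:
  "quantum_set XX \<Longrightarrow> quantum_set YY \<Longrightarrow> F \<in> Fun XX YY \<Longrightarrow> quantum_function XX YY F"
  by (rule quantum_function.intro)

lemma contravariant_functor_ell: "contravariant_functor ell pull"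
  unfolding contravariant_functor_def
proof (intro conjI allI impI ballI)
  fix XX YY ZZ :: "'p qset" and F G and x
  assume "quantum_set XX" "quantum_set YY" "quantum_set ZZ"
    and "F \<in> Fun XX YY" "G \<in> Fun YY ZZ" and x: "x \<in> carrier (ell ZZ)"
  then interpret quantum_function_pair XX YY ZZ F G
    by (simp add: quantum_function_pair_def quantum_functionI)
  show "pull XX ZZ (qcomp YY G F) x = pull XX YY F (pull YY ZZ G x)" by (rule pull_qcomp[OF x])
qed (auto intro: unital_star_algebra_ell pull_qid quantum_function.pull_star_hom quantum_functionI)

section \<open>The spectral theorem\<close>

text \<open>The vector p(t) x by Horner's scheme: the constant term acts on \<open>x\<close>, the
  remaining polynomial is evaluated at \<open>t x\<close>.\<close>

definition poly_op :: "complex poly \<Rightarrow> 'p operator \<Rightarrow> 'p operator" where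
  "poly_op p t = fold_coeffs (\<lambda>c f x. cscale c x + f (t x)) p (\<lambda>_. 0)"

lemma poly_op_0: "poly_op 0 t x = 0"
  by (simp add: poly_op_def)

lemma poly_op_pCons: "poly_op (pCons c p) t x = cscale c x + poly_op p t (t x)"
  by (cases "p = 0 \<and> c = 0") (auto simp: poly_op_def comp_apply)

lemma poly_op_add: "poly_op (p + q) t x = poly_op p t x + poly_op q t x"
proof (induction p q arbitrary: x rule: poly_induct2)
  case (pCons a p b q)
  then show ?case by (simp add: poly_op_pCons cvec.scale_left_distrib)
qed (simp add: poly_op_0)

lemma poly_op_smult: "poly_op (smult c p) t x = cscale c (poly_op p t x)"
  by (induction p arbitrary: x) (simp_all add: poly_op_0 poly_op_pCons cvec.scale_right_distrib)

lemma poly_op_monom: "poly_op (monom 1 i) t x = (t ^^ i) x"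
  by (induction i arbitrary: x) (simp_all add: monom_0 monom_Suc poly_op_pCons poly_op_0 funpow_swap1 comp_apply)

lemma poly_op_linear:
  assumes "t \<in> L X X" "fd_hilbert X" "x \<in> carrier X" "y \<in> carrier X"
  shows "poly_op p t (cscale c x + y) = cscale c (poly_op p t x) + poly_op p t y"
  using assms(3,4)
proof (induction p arbitrary: x y)
  case (pCons a p)
  have "t (cscale c x + y) = cscale c (t x) + t y"
    using L_add[OF assms(1)] L_scale[OF assms(1)] pCons.prems carrier_closed[OF assms(2)] by simp
  then have "poly_op p t (t (cscale c x + y)) = cscale c (poly_op p t (t x)) + poly_op p t (t y)"
    using pCons.IH[OF L_in[OF assms(1)] L_in[OF assms(1)]] pCons.prems by simp
  then show ?case by (simp add: poly_op_pCons cvec.scale_right_distrib cvec.scale_left_commute)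
qed (simp add: poly_op_0)

text \<open>The linear factor is made to act first. A root of a polynomial that annihilates
  \<open>x\<close> thus yields a polynomial of smaller degree that annihilates the shifted
  vector.\<close>

lemma poly_op_factor:
  assumes "t \<in> L X X" "fd_hilbert X" "x \<in> carrier X"
  shows "poly_op ([:- l, 1:] * q) t x = poly_op q t (t x - cscale l x)"
proof -
  have e: "t x - cscale l x = cscale (- l) x + t x" by simp
  show ?thesis
    unfolding e poly_op_linear[OF assms(1-3) L_in[OF assms(1,3)]]
    by (simp only: mult_pCons_left mult_zero_left pCons_0_0 add_0_right smult_1_left
        poly_op_add poly_op_smult poly_op_pCons cvec.scale_zero_left add_0_left)
qed

text \<open>Otherwise the vectors x, t x, t (t x), ... would be pairwise distinct and independent,
  more of them than a finite spanning set of the space permits.\<close>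

lemma annihilating_poly:
  fixes X :: "'p hilb"
  assumes X: "fd_hilbert X" and t: "t \<in> L X X" and x: "x \<in> carrier X"
  shows "\<exists>p. p \<noteq> 0 \<and> poly_op p t x = 0"
proof (rule ccontr)
  assume no: "\<not> ?thesis"
  have inX: "(t ^^ i) x \<in> carrier X" for i
    by (induction i) (use x L_in[OF t] in \<open>auto simp: comp_apply\<close>)
  let ?K = "\<lambda>n. (\<lambda>i. (t ^^ i) x) ` {..<n}"
  have new: "(t ^^ n) x \<notin> cvec.span (?K n)" for n
  proof
    assume n: "(t ^^ n) x \<in> cvec.span (?K n)"
    \<comment> \<open>The values at \<open>x\<close> of polynomials of degree below
      \<open>n\<close>. A relation in this set, subtracted from the monomial of degree
      \<open>n\<close>, leaves a polynomial whose coefficient at \<open>n\<close> is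
      \<open>1\<close>.\<close>
    let ?S = "{poly_op q t x | q. \<forall>i\<ge>n. coeff q i = 0}"
    have "cvec.subspace ?S"
      unfolding cvec.subspace_def
    proof (intro conjI ballI allI)
      show "0 \<in> ?S" by (auto intro: exI[of _ 0] simp: poly_op_0)
      show "u + w \<in> ?S" if "u \<in> ?S" "w \<in> ?S" for u w
        using that by (clarsimp, metis (no_types, lifting) poly_op_add coeff_add add_0)
      show "cscale c u \<in> ?S" if "u \<in> ?S" for c u
        using that by (clarsimp, metis (no_types, lifting) poly_op_smult coeff_smult mult_zero_right)
    qed
    moreover have "?K n \<subseteq> ?S"
      by (auto intro!: exI[of _ "monom 1 i" for i] simp: poly_op_monom)
    ultimately have "(t ^^ n) x \<in> ?S" using n cvec.span_minimal by blast
    then obtain q where q: "(t ^^ n) x = poly_op q t x" "coeff q n = 0" by auto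
    have "poly_op (monom 1 n + smult (-1) q) t x = 0"
      by (simp only: poly_op_add poly_op_monom poly_op_smult q(1)) simp
    moreover have "coeff (monom 1 n + smult (-1) q) n \<noteq> 0" using q(2) by simp
    ultimately show False using no by (metis coeff_0)
  qed
  \<comment> \<open>The cardinality is tracked as well, since a repetition among the vectors would
    go unnoticed in the image set.\<close>
  have ind: "cvec.independent (?K n) \<and> card (?K n) = n" for n
  proof (induction n)
    case (Suc n)
    have "(t ^^ n) x \<notin> ?K n"
      by (rule contra_subsetD[OF cvec.span_superset new])
    then have "card (insert ((t ^^ n) x) (?K n)) = Suc n"
      by (simp add: card_insert_disjoint conjunct2[OF Suc])
    moreover have "cvec.independent (insert ((t ^^ n) x) (?K n))"
      by (rule cvec.independent_insertI[OF new conjunct1[OF Suc]])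
    moreover have "?K (Suc n) = insert ((t ^^ n) x) (?K n)" by (simp add: lessThan_Suc)
    ultimately show ?case by metis
  qed (simp add: cvec.independent_empty)
  obtain B where B: "finite B" "carrier X = cvec.span B" using X by (auto simp: fd_hilbert_def)
  have "?K (Suc (card B)) \<subseteq> cvec.span B" using inX B by auto
  then show False
    using cvec.independent_span_bound[OF B(1), of "?K (Suc (card B))"] ind[of "Suc (card B)"] by simp
qed

section \<open>Self-adjoint operators and their eigenvectors\<close>

context
  fixes X :: "'p hilb" and t :: "'p operator"
  assumes X: "fd_hilbert X" and t: "t \<in> L X X" and selfadj: "adj X X t = t"
begin

lemma ip_selfadj: "x \<in> carrier X \<Longrightarrow> y \<in> carrier X \<Longrightarrow> ip X (t y) x = ip X y (t x)"
  using ip_adj[OF X X t] selfadj by simp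

lemma eigenspace_subspace: "cvec.subspace {x \<in> carrier X. t x = cscale l x}"
  unfolding cvec.subspace_def
  by (auto simp: carrier_closed[OF X] L_add[OF t] L_scale[OF t] L_0[OF t]
      cvec.scale_right_distrib cvec.scale_left_commute)

lemma eigenvalue_real:
  assumes "x \<in> carrier X" "x \<noteq> 0" "t x = cscale l x"
  shows "cnj l = l"
proof -
  have "cnj l * ip X x x = l * ip X x x"
    using ip_selfadj[OF assms(1,1)] assms ip_rules(4,5)[OF X assms(1,1)] by simp
  then show ?thesis using ip_rules(7)[OF X assms(1,1)] assms(2) by simp
qed

text \<open>A nonzero \<open>y\<close> would be an eigenvector, so \<open>l\<close> is real and t -
  l is symmetric. Then the inner product of \<open>y\<close> with y = (t - l) x equals that of (t -
  l) y = 0 with \<open>x\<close>.\<close>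

lemma no_jordan_block:
  assumes x: "x \<in> carrier X" and y: "t x - cscale l x = y" "t y = cscale l y"
  shows "y = 0"
proof (rule ccontr)
  assume "y \<noteq> 0"
  have yX: "y \<in> carrier X"
    unfolding y(1)[symmetric] by (rule carrier_closed(3)[OF X L_in[OF t x] carrier_closed(4)[OF X x]])
  have "ip X y y = ip X y (t x) - ip X y (cscale l x)"
    using ip_rules(2)[OF X yX L_in[OF t x] carrier_closed(4)[OF X x], of l] y(1) by simp
  also have "ip X y (t x) = cnj l * ip X y x"
    using ip_selfadj[OF x yX] y(2) ip_rules(5)[OF X x yX] by simp
  also have "ip X y (cscale l x) = l * ip X y x" by (rule ip_rules(4)[OF X yX x])
  finally have "ip X y y = 0" using eigenvalue_real[OF yX \<open>y \<noteq> 0\<close> y(2)] by simp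
  then show False using ip_rules(7)[OF X yX yX] \<open>y \<noteq> 0\<close> by simp
qed

abbreviation "eigenvectors \<equiv> {x \<in> carrier X. \<exists>\<alpha>::real. t x = cscale (of_real \<alpha>) x}"

lemma span_eigenvectors_le: "cvec.span eigenvectors \<subseteq> carrier X"
  by (rule cvec.span_minimal[OF _ subspace_carrier[OF X]]) blast

lemma eigenvector_in_span:
  assumes "x \<in> carrier X" "t x = cscale l x"
  shows "x \<in> cvec.span eigenvectors"
proof (cases "x = 0")
  case False
  then have "l = of_real (Re l)" using eigenvalue_real[OF assms(1) _ assms(2)] by (simp add: complex_eq_iff)
  then show ?thesis using assms by (intro cvec.span_base) (metis (mono_tags, lifting) mem_Collect_eq)
qed (simp add: cvec.span_zero)

text \<open>Let W be the span of the eigenvectors. Each element of W is (t - l) z + e with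
  \<open>z\<close> in W and \<open>e\<close> in the eigenspace of \<open>l\<close>, because t - l
  acts invertibly on the other eigenvectors. Applied to (t - l) x this gives (t - l) (x - z) = e.
  The absence of Jordan blocks forces e = 0, so x - z is an eigenvector or zero.\<close>

lemma shift_in_span:
  assumes x: "x \<in> carrier X" and y: "t x - cscale l x \<in> cvec.span eigenvectors"
  shows "x \<in> cvec.span eigenvectors"
proof -
  let ?W = "cvec.span eigenvectors" and ?E = "{x \<in> carrier X. t x = cscale l x}"
  note WX = subsetD[OF span_eigenvectors_le]
  have "\<exists>z\<in>?W. \<exists>e\<in>?E. u = (t z - cscale l z) + e" if "u \<in> ?W" for u
    using that
  proof (induction rule: cvec.span_induct_alt)
    case base
    show ?case
      by (rule bexI[of _ 0], rule bexI[of _ 0])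
        (simp_all add: L_0[OF t] carrier_closed[OF X] cvec.span_zero)
  next
    case (step c u u')
    then obtain z e where z: "z \<in> ?W" "e \<in> ?E" "u' = (t z - cscale l z) + e" by blast
    obtain \<alpha> where u: "u \<in> carrier X" "t u = cscale \<alpha> u" using step by blast
    have tz: "t (cscale d u + z) = cscale (d * \<alpha>) u + t z" for d
      using u z L_add[OF t] L_scale[OF t] carrier_closed[OF X] WX by simp
    show ?case
    proof (cases "\<alpha> = l")
      case True
      show ?thesis
      proof (rule bexI[OF _ z(1)], rule bexI[of _ "cscale c u + e"])
        show "cscale c u + e \<in> ?E"
          using u z(2) True cvec.subspace_add[OF eigenspace_subspace] cvec.subspace_scale[OF eigenspace_subspace]
          by blast
      qed (simp add: z(3) algebra_simps)
    next
      case False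
      \<comment> \<open>On an eigenvector for \<alpha> the operator t - l multiplies by \<alpha> -
        l, so dividing by this number yields a preimage of \<open>cscale c u\<close>.\<close>
      define d where "d = c / (\<alpha> - l)"
      have c: "c = d * \<alpha> - l * d" proof -
        have "d * (\<alpha> - l) = c" using False by (simp add: d_def)
        then show ?thesis by (simp add: algebra_simps)
      qed
      show ?thesis
      proof (rule bexI[of _ "cscale d u + z"], rule bexI[OF _ z(2)])
        show "cscale c u + u' = t (cscale d u + z) - cscale l (cscale d u + z) + e"
          unfolding tz z(3) c by (simp add: cvec.scale_right_distrib cvec.scale_left_diff_distrib)
        show "cscale d u + z \<in> ?W"
          by (rule cvec.span_add[OF cvec.span_scale[OF cvec.span_base[OF step(1)]] z(1)])
      qed
    qed
  qed
  then obtain z e where z: "z \<in> ?W" "e \<in> ?E" and e: "t x - cscale l x = (t z - cscale l z) + e"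
    using y by blast
  have zX: "z \<in> carrier X" and xz: "x - z \<in> carrier X" using z x WX carrier_closed[OF X] by auto
  have tdiff: "t (x - z) = t x - t z"
    using L_add[OF t x, of "cscale (-1) z"] L_scale[OF t zX, of "-1"] carrier_closed(4)[OF X zX, of "-1"] by simp
  have "t (x - z) - cscale l (x - z) = (t x - cscale l x) - (t z - cscale l z)"
    unfolding tdiff by (simp add: cvec.scale_right_diff_distrib algebra_simps)
  then have d: "t (x - z) - cscale l (x - z) = e" unfolding e by simp
  then have "e = 0" using no_jordan_block[OF xz d] z by blast
  then have "x - z \<in> ?W" using d xz by (intro eigenvector_in_span[of _ l]) auto
  then show ?thesis using cvec.span_add[OF _ z(1), of "x - z"] by simp
qed

text \<open>The induction is on the degree of a polynomial annihilating one vector: each complex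
  root \<open>l\<close> is removed by passing to t x - l x, and \<open>shift_in_span\<close> leads
  back to \<open>x\<close>.\<close>

lemma spectral: "carrier X \<subseteq> cvec.span eigenvectors"
proof
  fix x assume x: "x \<in> carrier X"
  have "x \<in> cvec.span eigenvectors" if "p \<noteq> 0" "poly_op p t x = 0" "x \<in> carrier X" for p x
    using that
  proof (induction "degree p" arbitrary: p x rule: less_induct)
    case less
    show ?case
    proof (cases "degree p = 0")
      case True
      then obtain c where "p = [:c:]" by (metis degree_eq_zeroE)
      then have "cscale c x = 0" "c \<noteq> 0" using less.prems by (auto simp: poly_op_pCons poly_op_0)
      then show ?thesis by (simp add: cvec.span_zero)
    next
      case False
      then obtain l where "poly p l = 0"
        using fundamental_theorem_of_algebra[of p] by (auto simp: constant_degree)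
      then obtain q where q: "p = [:- l, 1:] * q" by (metis dvdE poly_eq_0_iff_dvd)
      then have "q \<noteq> 0" using less.prems by auto
      then have dq: "degree q < degree p" using q by (simp add: degree_mult_eq del: mult_pCons_left)
      have q0: "poly_op q t (t x - cscale l x) = 0"
        using less.prems poly_op_factor[OF t X less.prems(3)] q by simp
      have "t x - cscale l x \<in> carrier X"
        by (rule carrier_closed(3)[OF X L_in[OF t less.prems(3)] carrier_closed(4)[OF X less.prems(3)]])
      then have "t x - cscale l x \<in> cvec.span eigenvectors"
        by (rule less.hyps[OF dq \<open>q \<noteq> 0\<close> q0])
      then show ?thesis by (rule shift_in_span[OF less.prems(3)])
    qed
  qed
  then show "x \<in> cvec.span eigenvectors" using annihilating_poly[OF X t x] x by blast
qed

text \<open>Gram-Schmidt does not leave the set of eigenvectors: basis vectors with an eigenvalue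
  other than that of \<open>x\<close> are orthogonal to \<open>x\<close>, so \<open>x\<close> and
  its projection lie in the same eigenspace. Eigenvalues are labelled by a set \<open>S\<close> so
  that atoms of an arbitrary ordinary set can index them.\<close>

lemma eigenbasis:
  fixes h :: "'q \<Rightarrow> real" and S :: "'q set"
  defines "E \<equiv> {x \<in> carrier X. \<exists>p\<in>S. t x = cscale (of_real (h p)) x}"
  assumes "carrier X \<subseteq> cvec.span E"
  shows "\<exists>B. inner_form.orthonormal (carrier X) (ip X) B \<and> B \<subseteq> E \<and> cvec.span B = carrier X"
proof -
  interpret I: inner_form cscale "carrier X" "ip X" by (rule inner_form_ip[OF X])
  obtain S0 where S0: "S0 \<subseteq> E" "cvec.independent S0" "E \<subseteq> cvec.span S0"
    using cvec.maximal_independent_subset by blast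
  have EX: "E \<subseteq> carrier X" by (auto simp: E_def)
  obtain B0 where "finite B0" "carrier X = cvec.span B0" using X by (auto simp: fd_hilbert_def)
  then have "finite S0" using cvec.independent_span_bound S0 EX by blast
  have "\<exists>B. I.orthonormal B \<and> B \<subseteq> E \<and> cvec.span B = cvec.span S0"
  proof (rule I.gram_schmidt[OF \<open>finite S0\<close> S0(1) EX])
    show "cscale c x \<in> E" if "x \<in> E" for x c
      using that L_scale[OF t] carrier_closed[OF X] by (auto simp: E_def cvec.scale_left_commute)
    fix x B assume x: "x \<in> E" and B: "B \<subseteq> E" "I.orthonormal B"
    then obtain p where p: "p \<in> S" "t x = cscale (of_real (h p)) x" and xX: "x \<in> carrier X"
      by (auto simp: E_def)
    \<comment> \<open>The eigenspace of \<open>x\<close>. All summands of the projection lie in it: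
      either the coefficient vanishes or the eigenvalues coincide.\<close>
    let ?W = "{u \<in> carrier X. t u = cscale (of_real (h p)) u}"
    note W = eigenspace_subspace[of "of_real (h p)"]
    have "cscale (ip X b x) b \<in> ?W" if bB: "b \<in> B" for b
    proof -
      obtain p' where p': "t b = cscale (of_real (h p')) b" and bX: "b \<in> carrier X"
        using B(1) bB by (auto simp: E_def)
      have "of_real (h p') * ip X b x = of_real (h p) * ip X b x"
        using ip_selfadj[OF xX bX] p p' ip_rules(4)[OF X bX xX] ip_rules(5)[OF X xX bX] by simp
      then consider "ip X b x = 0" | "h p' = h p" by auto
      then show ?thesis
      proof cases
        case 1
        then show ?thesis using cvec.subspace_0[OF W] by simp
      next
        case 2
        then have "b \<in> ?W" using p' bX by simp
        then show ?thesis by (rule cvec.subspace_scale[OF W])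
      qed
    qed
    then have "I.proj B x \<in> ?W" unfolding I.proj_def by (rule cvec.subspace_sum[OF W])
    moreover have "x \<in> ?W" using p xX by simp
    ultimately have "x - I.proj B x \<in> ?W" by (rule cvec.subspace_diff[OF W, rotated])
    then show "x - I.proj B x \<in> E" using p(1) by (auto simp: E_def)
  qed
  moreover have "cvec.span S0 = carrier X"
    using assms(2) S0 EX cvec.span_minimal[OF _ subspace_carrier[OF X], of S0]
      cvec.span_minimal[OF S0(3) cvec.subspace_span] by blast
  ultimately show ?thesis by auto
qed

end

section \<open>Functions into ordinary sets\<close>

lemma ell2_carrier: "x \<in> carrier (ell2 p) \<longleftrightarrow> (\<forall>i. i \<noteq> p \<longrightarrow> x i = 0)"
  by (simp add: ell2_def)

lemma ell2_ip: "x \<in> carrier (ell2 p) \<Longrightarrow> y \<in> carrier (ell2 p) \<Longrightarrow> ip (ell2 p) x y = cnj (x p) * y p"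
  by (auto simp: ell2_def)

definition unit_at :: "'p \<Rightarrow> 'p \<Rightarrow> complex" where
  "unit_at p = (\<lambda>i. if i = p then 1 else 0)"

lemma unit_at_carrier: "unit_at p \<in> carrier (ell2 p)"
  by (simp add: ell2_carrier unit_at_def)

lemma unit_at_same [simp]: "unit_at p p = 1"
  by (simp add: unit_at_def)

lemma ell2_expand: "x \<in> carrier (ell2 p) \<Longrightarrow> cscale (x p) (unit_at p) = x"
  by (auto simp: ell2_carrier unit_at_def fun_eq_iff cscale_apply)

lemma ell2_subspace: "cvec.subspace (carrier (ell2 p))"
  unfolding cvec.subspace_def by (simp add: ell2_carrier cscale_apply plus_fun_apply zero_fun_apply)

lemma ell2_span: "carrier (ell2 p) = cvec.span {unit_at p}"
proof
  show "carrier (ell2 p) \<subseteq> cvec.span {unit_at p}"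
  proof
    fix x assume "x \<in> carrier (ell2 p)"
    then show "x \<in> cvec.span {unit_at p}"
      using cvec.span_scale[OF cvec.span_base[of "unit_at p" "{unit_at p}"], of "x p"] ell2_expand
      by fastforce
  qed
  show "cvec.span {unit_at p} \<subseteq> carrier (ell2 p)"
    by (rule cvec.span_minimal[OF _ ell2_subspace]) (simp add: unit_at_carrier)
qed

lemma fd_hilbert_ell2: "fd_hilbert (ell2 p)"
  unfolding fd_hilbert_def
proof (intro conjI ballI allI impI)
  note sub = cvec.subspace_add[OF ell2_subspace] cvec.subspace_scale[OF ell2_subspace]
  show "cvec.subspace (carrier (ell2 p))" by (rule ell2_subspace)
  show "\<exists>B. finite B \<and> carrier (ell2 p) = cvec.span B"
    using ell2_span by (intro exI[of _ "{unit_at p}"]) simp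
  fix x y :: "'a \<Rightarrow> complex" and c
  show "ip (ell2 p) x y = 0" if "x \<notin> carrier (ell2 p) \<or> y \<notin> carrier (ell2 p)"
    using that by (auto simp: ell2_def)
  assume x: "x \<in> carrier (ell2 p)"
  show "Im (ip (ell2 p) x x) = 0" "Re (ip (ell2 p) x x) > 0" if "x \<noteq> 0"
  proof -
    have "x p \<noteq> 0" using x that by (auto simp: ell2_carrier fun_eq_iff zero_fun_apply)
    moreover have "cnj (x p) * x p = of_real ((cmod (x p))\<^sup>2)"
      using complex_norm_square[of "x p"] by (simp add: mult.commute)
    ultimately show "Im (ip (ell2 p) x x) = 0" "Re (ip (ell2 p) x x) > 0"
      unfolding ell2_ip[OF x x] by simp_all
  qed
  assume y: "y \<in> carrier (ell2 p)"
  show "ip (ell2 p) x (cscale c y) = c * ip (ell2 p) x y"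
    using sub(2)[OF y] by (simp add: ell2_ip x y cscale_apply)
  show "ip (ell2 p) y x = cnj (ip (ell2 p) x y)" by (simp add: ell2_ip x y)
  fix z assume z: "z \<in> carrier (ell2 p)"
  show "ip (ell2 p) x (y + z) = ip (ell2 p) x y + ip (ell2 p) x z"
    using sub(1)[OF y z] by (simp add: ell2_ip x y z plus_fun_apply ring_distribs)
qed

lemma ell2_inject [simp]: "ell2 p = ell2 q \<longleftrightarrow> p = q"
proof
  assume "ell2 p = ell2 q"
  then have "unit_at p \<in> carrier (ell2 q)" using unit_at_carrier[of p] by simp
  then show "p = q" by (auto simp: ell2_carrier unit_at_def)
qed simp

lemma quantum_set_quote: "quantum_set (quote_set S)" for S :: "'p set"
proof -
  have "carrier (ell2 p) \<noteq> {0}" for p :: 'p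
    using unit_at_carrier[of p] by (metis singletonD unit_at_same zero_fun_apply zero_neq_one)
  then show ?thesis by (auto simp: quantum_set_def quote_set_def fd_hilbert_ell2)
qed

text \<open>In dimension one the second axiom of a function holds automatically between equal target
  atoms.\<close>

lemma L_ell2_scalar:
  assumes "t \<in> L (ell2 p) (ell2 p)"
  shows "t \<in> range (\<lambda>c. opscale c (idop (ell2 p)))"
proof
  show "t = opscale (t (unit_at p) p) (idop (ell2 p))"
  proof
    fix x show "t x = opscale (t (unit_at p) p) (idop (ell2 p)) x"
    proof (cases "x \<in> carrier (ell2 p)")
      case True
      have "t x = cscale (x p) (t (unit_at p))"
        using L_scale[OF assms unit_at_carrier, of "x p"] ell2_expand[OF True] by simp
      also have "t (unit_at p) = cscale (t (unit_at p) p) (unit_at p)"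
        using ell2_expand[OF L_in[OF assms unit_at_carrier]] by simp
      also have "cscale (x p) (cscale (t (unit_at p) p) (unit_at p)) = cscale (t (unit_at p) p) x"
        using ell2_expand[OF True] by (metis cvec.scale_left_commute)
      finally show ?thesis using True by (simp add: opscale_apply idop_def)
    next
      case False
      then show ?thesis using L_off[OF assms] by (simp add: opscale_apply idop_def)
    qed
  qed
qed simp

text \<open>The functional "inner product with \<open>b\<close>", with its values placed in the
  one-dimensional space at \<open>p\<close>.\<close>

definition covector :: "'p \<Rightarrow> 'p hilb \<Rightarrow> ('p \<Rightarrow> complex) \<Rightarrow> 'p operator" where
  "covector p X b = (\<lambda>x. cscale (ip X b x) (unit_at p))"

lemma ip_off: "fd_hilbert X \<Longrightarrow> x \<notin> carrier X \<Longrightarrow> ip X b x = 0"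
  by (auto simp: fd_hilbert_def)

lemma covector_L:
  assumes "fd_hilbert X" "b \<in> carrier X"
  shows "covector p X b \<in> L X (ell2 p)"
  by (rule LI)
    (use assms in \<open>simp_all add: covector_def ip_rules(1,4) cvec.scale_left_distrib ip_off
      cvec.subspace_scale[OF ell2_subspace] unit_at_carrier\<close>)

text \<open>The rank-one operator of \<open>b\<close>, for a unit vector the projection onto its
  line. It does not depend on \<open>p\<close>, so an orthonormal basis resolves the identity even
  when its vectors are sent to different atoms.\<close>

lemma adj_covector_comp:
  assumes X: "fd_hilbert X" and b: "b \<in> carrier X"
  shows "(adj X (ell2 p) (covector p X b) \<circ> covector p X b) x = cscale (ip X b x) b"
proof -
  \<comment> \<open>The adjoint of a functional sends the scalar of \<open>y\<close> back to the
    corresponding multiple of \<open>b\<close>.\<close>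
  define t where "t y = (if y \<in> carrier (ell2 p) then cscale (y p) b else 0)" for y
  have tL: "t \<in> L (ell2 p) X"
    by (rule LI)
      (auto simp: t_def carrier_closed[OF X] b cvec.subspace_add[OF ell2_subspace] plus_fun_apply
        cscale_apply cvec.subspace_scale[OF ell2_subspace] cvec.scale_left_distrib)
  have "adj X (ell2 p) (covector p X b) = t"
  proof (rule adjI[OF X fd_hilbert_ell2 covector_L[OF X b] tL])
    fix x y assume x: "x \<in> carrier X" and y: "y \<in> carrier (ell2 p)"
    show "ip X (t y) x = ip (ell2 p) y (covector p X b x)"
      using y ip_rules(5)[OF X x b] L_in[OF covector_L[OF X b] x]
      by (simp add: t_def ell2_ip covector_def cscale_apply)
  qed
  then show ?thesis
    by (simp add: comp_apply t_def covector_def cscale_apply unit_at_carrier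
        cvec.subspace_scale[OF ell2_subspace])
qed

lemma op_sum: "(sum f A) x = (\<Sum>a\<in>A. f a x)" for f :: "'a \<Rightarrow> 'p operator"
  by (induction A rule: infinite_finite_induct) (simp_all add: op_apply)

text \<open>The entry of \<open>F\<close> at \<open>ell2 p\<close> is the space of all operators that intertwine \<open>a\<close> with the
  scalar \<open>h p\<close>.\<close>

lemma quote_functions:
  fixes XX :: "'p qset" and h :: "'p \<Rightarrow> real"
  assumes XX: "quantum_set XX" and a: "a \<in> carrier (ell XX)" and star: "star (ell XX) a = a"
    and r: "r \<in> carrier (ell (quote_set S))"
    and rp: "\<And>p. p \<in> S \<Longrightarrow> r (ell2 p) = opscale (of_real (h p)) (idop (ell2 p))"
    and inj: "inj_on h S"
    and eig: "\<And>X. X \<in> XX \<Longrightarrow>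
      carrier X \<subseteq> cvec.span {x \<in> carrier X. \<exists>p\<in>S. a X x = cscale (of_real (h p)) x}"
  shows "\<exists>!F. F \<in> Fun XX (quote_set S) \<and> pull XX (quote_set S) F r = a"
proof -
  let ?S = "quote_set S"
  define F where "F X Y = (if X \<in> XX \<and> Y \<in> ?S then {v \<in> L X Y. v \<circ> a X = r Y \<circ> v} else {0})" for X Y
  note H = quantum_setD[OF XX]
  have self: "adj X X (a X) = a X" if "X \<in> XX" for X
    using fun_cong[OF star, of X] that by (simp add: ell_apply)
  have FD: "v \<in> L X Y" "v \<circ> a X = r Y \<circ> v" if "v \<in> F X Y" "X \<in> XX" "Y \<in> ?S" for v X Y
    using that by (auto simp: F_def)
  have F_p: "v \<in> F X (ell2 p) \<longleftrightarrow> v \<in> L X (ell2 p) \<and> v \<circ> a X = opscale (of_real (h p)) v"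
    if "X \<in> XX" "p \<in> S" for v X p
    using that by (auto simp: F_def quote_set_def rp comp_opscale_left L_idop)
  have F_orth: "v' \<circ> adj X Y v \<in> qid ?S Y Y'"
    if X: "X \<in> XX" and Y: "Y \<in> ?S" "Y' \<in> ?S" and v: "v \<in> F X Y" "v' \<in> F X Y'" for X Y Y' v v'
  proof -
    obtain p p' where p: "p \<in> S" "Y = ell2 p" "p' \<in> S" "Y' = ell2 p'" using Y by (auto simp: quote_set_def)
    note HX = H[OF X] and Hp = fd_hilbert_ell2[of p]
    have v: "v \<in> L X (ell2 p)" "v \<circ> a X = opscale (of_real (h p)) v"
      and v': "v' \<in> L X (ell2 p')" "v' \<circ> a X = opscale (of_real (h p')) v'"
      using v F_p[OF X] p by auto
    note adjv = adj_L[OF HX Hp v(1)] and aL = ell_in[OF a X]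
    show ?thesis
    proof (cases "p = p'")
      case True
      have "v' \<circ> adj X Y v \<in> range (\<lambda>c. opscale c (idop Y))"
        using L_ell2_scalar[OF L_comp[OF adjv]] v'(1) True p by simp
      then show ?thesis using True p qid_same[OF Y(1)] by simp
    next
      case False
      \<comment> \<open>The operator v' a v\<dagger> is evaluated in two ways, through
        \<open>v'\<close> and, as \<open>a\<close> is self-adjoint, through v\<dagger>. The two
        scalars differ by injectivity of \<open>h\<close>, so v' v\<dagger> vanishes.\<close>
      have "opscale (of_real (h p')) (v' \<circ> adj X Y v) = v' \<circ> (a X \<circ> adj X Y v)"
        by (simp only: comp_opscale_left[symmetric] v'(2)[symmetric] comp_assoc)
      also have "a X \<circ> adj X Y v = adj X Y (v \<circ> a X)"
        using adj_comp[OF HX HX Hp aL v(1)] self[OF X] p by simp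
      also have "\<dots> = opscale (of_real (h p)) (adj X Y v)"
        using adj_opscale[OF HX Hp v(1)] p v(2) by simp
      also have "v' \<circ> \<dots> = opscale (of_real (h p)) (v' \<circ> adj X Y v)"
        using comp_opscale_right[OF v'(1) adjv] p by simp
      finally have "of_real (h p') = (of_real (h p) :: complex) \<or> v' \<circ> adj X Y v = 0"
        by simp
      then have "v' \<circ> adj X Y v = 0" using False inj p by (auto dest: inj_onD)
      then show ?thesis using op.subspace_0[OF qid_subspace] by metis
    qed
  qed
  have F: "F \<in> Fun XX ?S"
  proof (rule FunI)
    show "binrel XX ?S F"
      unfolding binrel_def
    proof (intro conjI ballI allI impI)
      fix X Y assume X: "X \<in> XX" and Y: "Y \<in> ?S"
      show "F X Y \<subseteq> L X Y" using FD[OF _ X Y] by blast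
      note HY = quantum_setD[OF quantum_set_quote Y]
      note aL = ell_in[OF a X] and rL = ell_in[OF r Y]
      have "F X Y = {v \<in> L X Y. v \<circ> a X = r Y \<circ> v}" using X Y by (simp add: F_def)
      then show "op.subspace (F X Y)"
        unfolding op.subspace_def
        by (auto simp: L_closed[OF HY] comp_add_left comp_opscale_left comp_0_left
            comp_add_right[OF rL, of _ X] comp_opscale_right[OF rL, of _ X] comp_0_right[OF rL])
    qed (auto simp: F_def)
  next
    fix X assume X: "X \<in> XX"
    note HX = H[OF X] and aL = ell_in[OF a X]
    interpret I: inner_form cscale "carrier X" "ip X" by (rule inner_form_ip[OF HX])
    obtain B where B: "I.orthonormal B" "B \<subseteq> {x \<in> carrier X. \<exists>p\<in>S. a X x = cscale (of_real (h p)) x}"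
        "cvec.span B = carrier X"
      using eigenbasis[OF HX aL self[OF X] eig[OF X]] by blast
    have "\<forall>b\<in>B. \<exists>p. p \<in> S \<and> a X b = cscale (of_real (h p)) b" using B(2) by blast
    then obtain q where q: "\<And>b. b \<in> B \<Longrightarrow> q b \<in> S \<and> a X b = cscale (of_real (h (q b))) b"
      by (metis bchoice)
    have BX: "b \<in> carrier X" if "b \<in> B" for b using B(2) that by blast
    \<comment> \<open>Each basis eigenvector is sent to the atom labelled by its eigenvalue.
      Self-adjointness of \<open>a\<close> makes this functional an intertwiner.\<close>
    define u where "u b = covector (q b) X b" for b
    have uF: "u b \<in> F X (ell2 (q b))" if "b \<in> B" for b
    proof -
      note b = BX[OF that] and qb = q[OF that]
      have "u b \<circ> a X = opscale (of_real (h (q b))) (u b)"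
      proof
        fix x show "(u b \<circ> a X) x = opscale (of_real (h (q b))) (u b) x"
        proof (cases "x \<in> carrier X")
          case True
          then have "ip X b (a X x) = of_real (h (q b)) * ip X b x"
            using ip_selfadj[OF HX aL self[OF X] True b] qb ip_rules(5)[OF HX True b] by simp
          then show ?thesis by (simp add: comp_apply op_apply u_def covector_def)
        next
          case False
          then have "a X x = 0" "x \<notin> carrier X" using L_off[OF aL] by auto
          then show ?thesis
            using I.form_zero[OF b] ip_off[OF HX] by (simp add: comp_apply op_apply u_def covector_def)
        qed
      qed
      then show ?thesis using F_p[OF X] qb covector_L[OF HX b] by (simp add: u_def)
    qed
    \<comment> \<open>The resolution of the identity by the eigenbasis, written in generators of the
      source span.\<close>
    have "idop X = (\<Sum>b\<in>B. adj X (ell2 (q b)) (u b) \<circ> u b)"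
    proof
      fix x
      have "(\<Sum>b\<in>B. adj X (ell2 (q b)) (u b) \<circ> u b) x = I.proj B x"
        unfolding op_sum I.proj_def u_def using BX by (intro sum.cong) (simp_all add: adj_covector_comp[OF HX])
      also have "\<dots> = idop X x"
      proof (cases "x \<in> carrier X")
        case True
        then show ?thesis using I.proj_span[OF B(1)] B(3) by (simp add: idop_def)
      next
        case False
        then show ?thesis using ip_off[OF HX] by (simp add: idop_def I.proj_def)
      qed
      finally show "idop X x = (\<Sum>b\<in>B. adj X (ell2 (q b)) (u b) \<circ> u b) x" by simp
    qed
    moreover have "adj X (ell2 (q b)) (u b) \<circ> u b \<in> source_span ?S F X" if "b \<in> B" for b
      unfolding source_span_def using uF[OF that] q[OF that] by (auto simp: quote_set_def)
    ultimately show "idop X \<in> op.span (source_span ?S F X)"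
      using op.span_sum[of B "\<lambda>b. adj X (ell2 (q b)) (u b) \<circ> u b"] op.span_base by metis
  qed (rule F_orth)
  have pull: "pull XX ?S F r = a"
  proof -
    interpret quantum_function XX ?S F by (rule quantum_functionI[OF XX quantum_set_quote F])
    show ?thesis by (rule pull_eqI[OF a r intertwinesI]) (rule FD)
  qed
  \<comment> \<open>Intertwining puts G below F. Conversely, an element \<open>w\<close> of F(X,Y)
    is composed with the identity of X as decomposed by G: in w v'\<dagger> v the product w
    v'\<dagger> is a scalar or zero by orthogonality within F, so the result is a multiple of
    \<open>v\<close> in G(X,Y) or zero.\<close>
  have "G = F" if G: "G \<in> Fun XX ?S" and Gr: "pull XX ?S G r = a" for G
  proof (intro ext)
    interpret quantum_function XX ?S G by (rule quantum_functionI[OF XX quantum_set_quote G])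
    fix X Y
    show "G X Y = F X Y"
    proof (cases "X \<in> XX \<and> Y \<in> ?S")
      case True
      then have X: "X \<in> XX" and Y: "Y \<in> ?S" by auto
      have GF: "v \<in> F X Y'" if "Y' \<in> ?S" "v \<in> G X Y'" for v Y'
        using that X in_L pull_comm[OF r X that] Gr by (auto simp: F_def)
      note sub = rel_subspace[OF X Y]
      have "w \<in> G X Y" if w: "w \<in> F X Y" for w
      proof -
        note wL = FD(1)[OF w X Y]
        have "idop X \<in> L X X \<and> w \<circ> idop X \<in> G X Y"
          using unit[OF X]
        proof (induction rule: op.span_induct)
          case base
          show ?case unfolding op.subspace_def
            by (auto simp: L_closed[OF H[OF X]] comp_add_right[OF wL, of _ X]
                comp_opscale_right[OF wL, of _ X] comp_0_right[OF wL] op.subspace_0[OF sub]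
                op.subspace_add[OF sub] op.subspace_scale[OF sub])
        next
          case (step t)
          then obtain Y' v v' where t: "t = adj X Y' v' \<circ> v" and v: "Y' \<in> ?S" "v \<in> G X Y'" "v' \<in> G X Y'"
            unfolding source_span_def by blast
          have e: "w \<circ> t = (w \<circ> adj X Y' v') \<circ> v" by (simp only: t comp_assoc)
          have o: "w \<circ> adj X Y' v' \<in> qid ?S Y' Y"
            by (rule F_orth[OF X v(1) Y GF[OF v(1,3)] w])
          have "w \<circ> t \<in> G X Y"
          proof (cases "Y' = Y")
            case True
            then obtain c where "w \<circ> adj X Y' v' = opscale c (idop Y')"
              using o qid_same[OF v(1)] by auto
            then have "w \<circ> t = opscale c v"
              using in_L[OF X v(1,2)] by (simp add: e comp_opscale_left L_idop)
            then show ?thesis using v(2) True op.subspace_scale[OF sub] by simp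
          next
            case False
            then have "w \<circ> adj X Y' v' = 0" using o qid_diff by blast
            then show ?thesis using op.subspace_0[OF sub] by (simp add: e comp_0_left)
          qed
          moreover have "t \<in> L X X"
            unfolding t by (rule L_comp[OF in_L[OF X v(1,2)] adj_in_L[OF X v(1,3)]])
          ultimately show ?case by simp
        qed
        then show ?thesis using L_idop(1)[OF wL] by simp
      qed
      then show ?thesis using GF[OF Y] by blast
    next
      case False
      then show ?thesis using off by (auto simp: F_def)
    qed
  qed
  then show ?thesis using F pull by blast
qed

section \<open>Functions to the reals and to a point, and ordinary functions\<close>

lemma r_elem_at: "r_elem (ell2 (RealPt \<alpha>)) = opscale (of_real \<alpha>) (idop (ell2 (RealPt \<alpha>)))"
  by (simp add: r_elem_def quote_set_def)

lemma r_elem_in: "r_elem \<in> carrier (ell qReal)"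
  unfolding r_elem_def
  by (rule ell_carrierI) (auto simp: quote_set_def intro!: L_closed fd_hilbert_ell2 idop_L)

text \<open>The spectral theorem provides the spanning hypothesis, as \<open>qReal\<close> has an
  atom for every real number. The value \<open>0\<close> of \<open>h\<close> concerns labels outside
  the index set.\<close>

lemma real_functions:
  fixes XX :: "'i point qset"
  assumes "quantum_set XX" "a \<in> carrier (ell XX)" "star (ell XX) a = a"
  shows "\<exists>!F. F \<in> Fun XX qReal \<and> pull XX qReal F r_elem = a"
proof (rule quote_functions[OF assms r_elem_in, where h = "\<lambda>p. case p of RealPt \<alpha> \<Rightarrow> \<alpha> | _ \<Rightarrow> 0"])
  fix X assume X: "X \<in> XX"
  have "adj X X (a X) = a X" using fun_cong[OF assms(3), of X] X by (simp add: ell_apply)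
  then show "carrier X \<subseteq> cvec.span {x \<in> carrier X. \<exists>p\<in>range RealPt.
      a X x = cscale (of_real (case p of RealPt \<alpha> \<Rightarrow> \<alpha> | _ \<Rightarrow> 0)) x}"
    using spectral[OF quantum_setD[OF assms(1) X] ell_in[OF assms(2) X]] by simp
qed (auto simp: r_elem_at inj_on_def)

text \<open>The case of a single label with eigenvalue \<open>0\<close> and the zero element: every
  vector is an eigenvector, and every function pulls zero back to zero. Uniqueness among solutions
  of the pullback equation is then uniqueness among all functions.\<close>

lemma terminal_functions:
  fixes XX :: "'p qset"
  assumes "quantum_set XX"
  shows "\<exists>!F. F \<in> Fun XX (quote_set {p})"
proof -
  let ?z = "\<zero>\<^bsub>ell XX\<^esub>" and ?r = "\<zero>\<^bsub>ell (quote_set {p})\<^esub>"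
  note H = quantum_setD[OF assms]
  have star: "star (ell XX) ?z = ?z"
    by (rule ell_ext[of _ XX]) (auto simp: ell_closed[OF assms] ell_apply adj_0 H)
  have rp: "?r (ell2 p) = 0" by (simp add: ell_apply quote_set_def)
  have "\<exists>!F. F \<in> Fun XX (quote_set {p}) \<and> pull XX (quote_set {p}) F ?r = ?z"
    by (rule quote_functions[OF assms _ star, where h = "\<lambda>_. 0"])
      (auto simp: ell_closed assms quantum_set_quote rp ell_apply op_apply intro: cvec.span_base)
  moreover have "pull XX (quote_set {p}) F ?r = ?z" if "F \<in> Fun XX (quote_set {p})" for F
  proof -
    interpret quantum_function XX "quote_set {p}" F
      by (rule quantum_functionI[OF assms quantum_set_quote that])
    show ?thesis
      by (rule pull_eqI[OF _ _ intertwinesI])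
        (auto simp: ell_closed assms quantum_set_quote ell_apply comp_0_left comp_0_right)
  qed
  ultimately show ?thesis by metis
qed

lemma quote_fun_Fun:
  fixes f :: "'p \<Rightarrow> 'p"
  assumes "f ` S \<subseteq> S'"
  shows "quote_fun S f \<in> Fun (quote_set S) (quote_set S')"
proof (rule FunI)
  note HS = quantum_setD[OF quantum_set_quote[of S]] and HS' = quantum_setD[OF quantum_set_quote[of S']]
  show "binrel (quote_set S) (quote_set S') (quote_fun S f)"
    unfolding binrel_def
  proof (intro conjI ballI allI impI)
    fix X Y assume "X \<in> quote_set S" "Y \<in> quote_set S'"
    then show "op.subspace (quote_fun S f X Y)" "quote_fun S f X Y \<subseteq> L X Y"
      using L_subspace[OF HS', of Y X] L_closed(1)[OF HS', of Y X]
      by (auto simp: quote_fun_def op.subspace_single_0)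
  next
    fix X Y assume "X \<notin> quote_set S \<or> Y \<notin> quote_set S'"
    then show "quote_fun S f X Y = {0}"
      using assms by (auto simp: quote_fun_def quote_set_def)
  qed
  show "idop X \<in> op.span (source_span (quote_set S') (quote_fun S f) X)" if X: "X \<in> quote_set S" for X
  proof -
    obtain \<alpha> where \<alpha>: "\<alpha> \<in> S" "X = ell2 \<alpha>" using X by (auto simp: quote_set_def)
    note HX = HS[OF X]
    have b: "unit_at \<alpha> \<in> carrier X" using \<alpha> unit_at_carrier by simp
    \<comment> \<open>The source is spanned by one unit vector, so its single rank-one operator is
      already the identity.\<close>
    define u where "u = covector (f \<alpha>) X (unit_at \<alpha>)"
    have u: "u \<in> quote_fun S f X (ell2 (f \<alpha>))"
      using \<alpha> covector_L[OF HX b, of "f \<alpha>"] unfolding u_def quote_fun_def by auto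
    have "idop X = adj X (ell2 (f \<alpha>)) u \<circ> u"
    proof
      fix x show "idop X x = (adj X (ell2 (f \<alpha>)) u \<circ> u) x"
        unfolding u_def adj_covector_comp[OF HX b]
        using ell2_expand[of x \<alpha>] ell2_ip[OF unit_at_carrier[of \<alpha>], of x] \<alpha>
        by (cases "x \<in> carrier X") (simp_all add: idop_def ip_off[OF fd_hilbert_ell2])
    qed
    then have "idop X \<in> source_span (quote_set S') (quote_fun S f) X"
      using u \<alpha> assms unfolding source_span_def quote_set_def by blast
    then show ?thesis by (rule op.span_base)
  qed
  fix X Y Y' v v'
  assume X: "X \<in> quote_set S" and Y: "Y \<in> quote_set S'" "Y' \<in> quote_set S'"
    and v: "v \<in> quote_fun S f X Y" "v' \<in> quote_fun S f X Y'"
  obtain \<alpha> where \<alpha>: "\<alpha> \<in> S" "X = ell2 \<alpha>" using X by (auto simp: quote_set_def)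
  have vL: "v \<in> L X Y" "v' \<in> L X Y'"
    using v L_closed(1)[OF HS'[OF Y(1)], of X] L_closed(1)[OF HS'[OF Y(2)], of X]
    by (auto simp: quote_fun_def split: if_splits)
  have cases: "v = 0 \<or> Y = ell2 (f \<alpha>)" "v' = 0 \<or> Y' = ell2 (f \<alpha>)"
    using v \<alpha> by (auto simp: quote_fun_def split: if_splits)
  show "v' \<circ> adj X Y v \<in> qid (quote_set S') Y Y'"
  proof (cases "v = 0 \<or> v' = 0")
    case True
    then have "v' \<circ> adj X Y v = 0"
      using adj_0[OF HS[OF X] HS'[OF Y(1)]] comp_0_right[OF vL(2)] by (auto simp: comp_0_left)
    then show ?thesis using op.subspace_0[OF qid_subspace] by metis
  next
    case False
    then have e: "Y = ell2 (f \<alpha>)" "Y' = Y" using cases by auto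
    have "v' \<circ> adj X Y v \<in> range (\<lambda>c. opscale c (idop Y))"
      using L_ell2_scalar[of _ "f \<alpha>"] L_comp[OF adj_L[OF HS[OF X] HS'[OF Y(1)] vL(1)] vL(2)] e by simp
    then show ?thesis using e qid_same[OF Y(1)] by simp
  qed
qed

text \<open>On scalar families the pullback is composition with \<open>f\<close>: the number
  \<open>g \<alpha>\<close> is both the value of \<open>a\<close> at \<alpha> and the value of
  \<open>b\<close> at \<open>f \<alpha>\<close>.\<close>

lemma pull_quote_fun:
  assumes f: "f ` S \<subseteq> S'"
    and a: "a \<in> carrier (ell (quote_set S))" and b: "b \<in> carrier (ell (quote_set S'))"
    and ab: "\<And>\<alpha>. \<alpha> \<in> S \<Longrightarrow> a (ell2 \<alpha>) = opscale (g \<alpha>) (idop (ell2 \<alpha>)) \<and>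
      b (ell2 (f \<alpha>)) = opscale (g \<alpha>) (idop (ell2 (f \<alpha>)))"
  shows "pull (quote_set S) (quote_set S') (quote_fun S f) b = a"
proof -
  interpret quantum_function "quote_set S" "quote_set S'" "quote_fun S f"
    by (intro quantum_functionI quantum_set_quote quote_fun_Fun f)
  show ?thesis
  proof (rule pull_eqI[OF a b intertwinesI])
    fix X Y v assume X: "X \<in> quote_set S" and Y: "Y \<in> quote_set S'"
      and v: "v \<in> quote_fun S f X Y" and vL: "v \<in> L X Y"
    obtain \<alpha> where \<alpha>: "\<alpha> \<in> S" "X = ell2 \<alpha>" using X by (auto simp: quote_set_def)
    have "v = 0 \<or> Y = ell2 (f \<alpha>)"
      using v \<alpha> by (auto simp: quote_fun_def split: if_splits)
    then show "v \<circ> a X = b Y \<circ> v"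
    proof
      assume "v = 0"
      then show ?thesis by (simp add: comp_0_left comp_0_right[OF ell_in[OF b Y]])
    next
      assume "Y = ell2 (f \<alpha>)"
      then show ?thesis
        using \<alpha> ab[OF \<alpha>(1)] comp_opscale_right[OF vL idop_L[OF hilbert_X[OF X]]] L_idop[OF vL]
        by (simp add: comp_opscale_left)
    qed
  qed
qed


section \<open>The quantum complex numbers\<close>

lemma pairing:
  assumes "is_product XX YY P" "quantum_set ZZ" "F1 \<in> Fun ZZ XX" "F2 \<in> Fun ZZ YY"
  shows "pairing P ZZ F1 F2 \<in> Fun ZZ (obj P)"
    "qcomp (obj P) (pr1 P) (pairing P ZZ F1 F2) = F1" "qcomp (obj P) (pr2 P) (pairing P ZZ F1 F2) = F2"
proof -
  have "\<exists>!H. H \<in> Fun ZZ (obj P) \<and> qcomp (obj P) (pr1 P) H = F1 \<and> qcomp (obj P) (pr2 P) H = F2"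
    using assms unfolding is_product_def by blast
  from theI'[OF this] show "pairing P ZZ F1 F2 \<in> Fun ZZ (obj P)"
    "qcomp (obj P) (pr1 P) (pairing P ZZ F1 F2) = F1" "qcomp (obj P) (pr2 P) (pairing P ZZ F1 F2) = F2"
    unfolding pairing_def by blast+
qed

lemma product_ext:
  assumes "is_product XX YY P" "quantum_set ZZ" "H \<in> Fun ZZ (obj P)" "H' \<in> Fun ZZ (obj P)"
    and "qcomp (obj P) (pr1 P) H = qcomp (obj P) (pr1 P) H'"
    and "qcomp (obj P) (pr2 P) H = qcomp (obj P) (pr2 P) H'"
    and "quantum_set XX" "quantum_set YY"
  shows "H = H'"
proof -
  have P: "quantum_set (obj P)" "pr1 P \<in> Fun (obj P) XX" "pr2 P \<in> Fun (obj P) YY"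
    using assms(1) by (auto simp: is_product_def)
  interpret p1: quantum_function_pair ZZ "obj P" XX H' "pr1 P"
    by (simp add: quantum_function_pair_def quantum_functionI assms P)
  interpret p2: quantum_function_pair ZZ "obj P" YY H' "pr2 P"
    by (simp add: quantum_function_pair_def quantum_functionI assms P)
  have "\<exists>!H. H \<in> Fun ZZ (obj P) \<and> qcomp (obj P) (pr1 P) H = qcomp (obj P) (pr1 P) H' \<and>
      qcomp (obj P) (pr2 P) H = qcomp (obj P) (pr2 P) H'"
    using assms(1,2) p1.qcomp_Fun p2.qcomp_Fun unfolding is_product_def by blast
  then show ?thesis using assms(3-6) by blast
qed

lemma qcomp_Fun:
  assumes "quantum_set XX" "quantum_set YY" "quantum_set ZZ" "F \<in> Fun XX YY" "G \<in> Fun YY ZZ"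
  shows "qcomp YY G F \<in> Fun XX ZZ"
proof -
  interpret quantum_function_pair XX YY ZZ F G
    by (simp add: quantum_function_pair_def quantum_functionI assms)
  show ?thesis by (rule qcomp_Fun)
qed

lemma pull_qcomp:
  assumes "quantum_set XX" "quantum_set YY" "quantum_set ZZ" "F \<in> Fun XX YY" "G \<in> Fun YY ZZ"
    and "c \<in> carrier (ell ZZ)"
  shows "pull XX ZZ (qcomp YY G F) c = pull XX YY F (pull YY ZZ G c)"
  using contravariant_functor_ell assms unfolding contravariant_functor_def by blast

lemma star_r_elem: "star (ell qReal) r_elem = r_elem"
proof (rule ell_ext[of _ qReal])
  fix X :: "'a point hilb" assume X: "X \<in> qReal"
  then obtain \<alpha> where \<alpha>: "X = ell2 (RealPt \<alpha>)" by (auto simp: quote_set_def)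
  show "star (ell qReal) r_elem X = r_elem X"
    unfolding ell_apply[OF X] unfolding \<alpha> r_elem_at
    by (simp add: adj_opscale fd_hilbert_ell2 adj_idop)
qed (auto intro: ell_closed r_elem_in quantum_set_quote)

section \<open>Self-adjoint real and imaginary parts\<close>

definition re_part :: "'p qset \<Rightarrow> 'p family \<Rightarrow> 'p family" where
  "re_part XX a = (1 / 2) \<odot>\<^bsub>ell XX\<^esub> (a \<oplus>\<^bsub>ell XX\<^esub> star (ell XX) a)"

definition im_part :: "'p qset \<Rightarrow> 'p family \<Rightarrow> 'p family" where
  "im_part XX a = (- \<i> / 2) \<odot>\<^bsub>ell XX\<^esub> (a \<oplus>\<^bsub>ell XX\<^esub> ((-1) \<odot>\<^bsub>ell XX\<^esub> star (ell XX) a))"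

text \<open>Comparing coordinates reduces linear identities between operators to complex
  arithmetic.\<close>

lemma op_ext: "(\<And>x i. r x i = s x i) \<Longrightarrow> r = s" for r s :: "'p operator"
  by (intro ext)

lemmas op_coord = op_apply plus_fun_apply zero_fun_apply cscale_apply

lemma parts:
  assumes XX: "quantum_set XX" and a: "a \<in> carrier (ell XX)"
  shows "re_part XX a \<in> carrier (ell XX)" "im_part XX a \<in> carrier (ell XX)"
    "star (ell XX) (re_part XX a) = re_part XX a" "star (ell XX) (im_part XX a) = im_part XX a"
    "re_part XX a \<oplus>\<^bsub>ell XX\<^esub> (\<i> \<odot>\<^bsub>ell XX\<^esub> im_part XX a) = a"
proof -
  note H = quantum_setD[OF XX] and cl = ell_closed[OF XX]
  show re: "re_part XX a \<in> carrier (ell XX)" and im: "im_part XX a \<in> carrier (ell XX)"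
    unfolding re_part_def im_part_def by (intro cl a)+
  have adj: "adj X X (a X) \<in> L X X" "a X \<in> L X X" "adj X X (adj X X (a X)) = a X" if "X \<in> XX" for X
    using ell_in[OF a that] H[OF that] by (auto intro: adj_L adj_adj)
  show "star (ell XX) (re_part XX a) = re_part XX a"
  proof (rule ell_ext[OF cl(6)[OF re] re])
    fix X assume X: "X \<in> XX"
    show "star (ell XX) (re_part XX a) X = re_part XX a X"
      using adj[OF X] H[OF X] L_closed[OF H[OF X]] X
      by (simp add: re_part_def ell_apply adj_opscale adj_add add.commute)
  qed
  show "star (ell XX) (im_part XX a) = im_part XX a"
  proof (rule ell_ext[OF cl(6)[OF im] im])
    fix X assume X: "X \<in> XX"
    have "adj X X (opscale (- \<i> / 2) (a X + opscale (- 1) (adj X X (a X)))) =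
        opscale (\<i> / 2) (adj X X (a X) + opscale (- 1) (a X))"
      using adj[OF X] H[OF X] L_closed(2,3)[OF H[OF X], of _ X] by (simp only: adj_opscale adj_add) simp
    also have "\<dots> = opscale (- \<i> / 2) (a X + opscale (- 1) (adj X X (a X)))"
      by (rule op_ext) (simp add: op_coord algebra_simps)
    finally show "star (ell XX) (im_part XX a) X = im_part XX a X"
      using X by (simp add: im_part_def ell_apply)
  qed
  show "re_part XX a \<oplus>\<^bsub>ell XX\<^esub> (\<i> \<odot>\<^bsub>ell XX\<^esub> im_part XX a) = a"
  proof (rule ell_ext[OF cl(4)[OF re cl(5)[OF im]] a])
    fix X assume X: "X \<in> XX"
    show "(re_part XX a \<oplus>\<^bsub>ell XX\<^esub> (\<i> \<odot>\<^bsub>ell XX\<^esub> im_part XX a)) X = a X"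
      by (rule op_ext) (simp only: ell_apply[OF X] re_part_def im_part_def op_coord, simp add: algebra_simps)
  qed
qed

text \<open>Self-adjointness gives the adjoint of \<open>a\<close> as b - i c, and the two equations
  are solved for \<open>b\<close> and \<open>c\<close>.\<close>

lemma parts_unique:
  assumes XX: "quantum_set XX" and bc: "b \<in> carrier (ell XX)" "c \<in> carrier (ell XX)"
    and star: "star (ell XX) b = b" "star (ell XX) c = c"
    and a: "a = b \<oplus>\<^bsub>ell XX\<^esub> (\<i> \<odot>\<^bsub>ell XX\<^esub> c)"
  shows "b = re_part XX a" "c = im_part XX a"
proof -
  note H = quantum_setD[OF XX] and cl = ell_closed[OF XX]
  have aA: "a \<in> carrier (ell XX)" unfolding a by (intro cl bc)
  have adj_a: "adj X X (a X) = b X + opscale (- \<i>) (c X)" if X: "X \<in> XX" for X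
  proof -
    have "adj X X (b X) = b X" "adj X X (c X) = c X"
      using fun_cong[OF star(1), of X] fun_cong[OF star(2), of X] X by (simp_all add: ell_apply)
    then show ?thesis
      using ell_in[OF bc(1) X] ell_in[OF bc(2) X] H[OF X] L_closed(3)[OF H[OF X], of "c X" X \<i>] X
      by (simp add: a ell_apply adj_add adj_opscale)
  qed
  show "b = re_part XX a"
  proof (rule ell_ext[OF bc(1) parts(1)[OF XX aA]])
    fix X assume X: "X \<in> XX"
    show "b X = re_part XX a X"
      unfolding re_part_def ell_apply[OF X] adj_a[OF X] unfolding a ell_apply[OF X]
      by (rule op_ext) (simp add: op_coord)
  qed
  show "c = im_part XX a"
  proof (rule ell_ext[OF bc(2) parts(2)[OF XX aA]])
    fix X assume X: "X \<in> XX"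
    show "c X = im_part XX a X"
      unfolding im_part_def ell_apply[OF X] adj_a[OF X] unfolding a ell_apply[OF X]
      by (rule op_ext) (simp add: op_coord algebra_simps)
  qed
qed

locale quantum_complex =
  fixes C D :: "'i point qproduct"
  assumes C: "is_product qReal qReal C" and D: "is_product (obj C) (obj C) D"
begin

lemma obj_C: "quantum_set (obj C)" and pr_C: "pr1 C \<in> Fun (obj C) qReal" "pr2 C \<in> Fun (obj C) qReal"
  using C by (auto simp: is_product_def)

lemma obj_D: "quantum_set (obj D)" and pr_D: "pr1 D \<in> Fun (obj D) (obj C)" "pr2 D \<in> Fun (obj D) (obj C)"
  using D by (auto simp: is_product_def)

lemma pull_r_elem:
  assumes "quantum_set XX" "F \<in> Fun XX qReal"
  shows "pull XX qReal F r_elem \<in> carrier (ell XX)"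
    "star (ell XX) (pull XX qReal F r_elem) = pull XX qReal F r_elem"
proof -
  interpret quantum_function XX qReal F
    by (rule quantum_functionI[OF assms(1) quantum_set_quote assms(2)])
  show "pull XX qReal F r_elem \<in> carrier (ell XX)" by (rule pull_in[OF r_elem_in])
  show "star (ell XX) (pull XX qReal F r_elem) = pull XX qReal F r_elem"
    using pull_star[OF r_elem_in, unfolded star_r_elem] by simp
qed

lemma s_elem_in: "s_elem C \<in> carrier (ell (obj C))"
  unfolding s_elem_def
  by (intro ell_closed[OF obj_C] pull_r_elem[OF obj_C] pr_C)

text \<open>The component at \<open>XX\<close> of the natural isomorphism. Its naturality is
  \<open>op_of_qcomp\<close>.\<close>

definition op_of :: "'i point qset \<Rightarrow> 'i point qrel \<Rightarrow> 'i point family" where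
  "op_of XX F = pull XX (obj C) F (s_elem C)"

lemma op_of_in: "quantum_set XX \<Longrightarrow> F \<in> Fun XX (obj C) \<Longrightarrow> op_of XX F \<in> carrier (ell XX)"
  unfolding op_of_def
  by (intro quantum_function.pull_in[OF quantum_functionI] obj_C s_elem_in)

lemma op_of_qcomp:
  assumes "quantum_set XX" "quantum_set YY" "F \<in> Fun XX YY" "G \<in> Fun YY (obj C)"
  shows "op_of XX (qcomp YY G F) = pull XX YY F (op_of YY G)"
  unfolding op_of_def by (rule pull_qcomp[OF assms(1,2) obj_C assms(3,4) s_elem_in])

text \<open>Pulling back along F after a projection is pulling back along the composite, so F enters
  only through its two real components. These become the real and imaginary part of the
  operator.\<close>

lemma op_of_parts:
  assumes XX: "quantum_set XX" and F: "F \<in> Fun XX (obj C)"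
  shows "op_of XX F = pull XX qReal (qcomp (obj C) (pr1 C) F) r_elem \<oplus>\<^bsub>ell XX\<^esub>
    (\<i> \<odot>\<^bsub>ell XX\<^esub> pull XX qReal (qcomp (obj C) (pr2 C) F) r_elem)"
proof -
  interpret quantum_function XX "obj C" F by (rule quantum_functionI[OF XX obj_C F])
  note p = pull_r_elem(1)[OF obj_C]
  show ?thesis
    unfolding op_of_def s_elem_def
    by (simp add: pull_add pull_smult p pr_C ell_closed[OF obj_C]
        pull_qcomp[OF XX obj_C quantum_set_quote F _ r_elem_in])
qed

lemma op_of_bij:
  assumes XX: "quantum_set XX" and a: "a \<in> carrier (ell XX)"
  shows "\<exists>!F. F \<in> Fun XX (obj C) \<and> op_of XX F = a"
proof -
  note pa = parts[OF XX a]
  obtain F1 where F1: "F1 \<in> Fun XX qReal" "pull XX qReal F1 r_elem = re_part XX a"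
    using real_functions[OF XX pa(1,3)] by blast
  obtain F2 where F2: "F2 \<in> Fun XX qReal" "pull XX qReal F2 r_elem = im_part XX a"
    using real_functions[OF XX pa(2,4)] by blast
  note H = pairing[OF C XX F1(1) F2(1)]
  have "op_of XX (pairing C XX F1 F2) = a"
    using op_of_parts[OF XX H(1)] H F1 F2 pa(5) by simp
  moreover have "F = F'" if F: "F \<in> Fun XX (obj C)" "op_of XX F = a"
    and F': "F' \<in> Fun XX (obj C)" "op_of XX F' = a" for F F'
  proof (rule product_ext[OF C XX F(1) F'(1) _ _ quantum_set_quote quantum_set_quote])
    note q = qcomp_Fun[OF XX obj_C quantum_set_quote]
    \<comment> \<open>Uniqueness of the parts determines the operators of both components;
      \<open>real_functions\<close> then determines the components and \<open>product_ext\<close>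
      the function.\<close>
    have u: "pull XX qReal (qcomp (obj C) (pr1 C) G) r_elem = re_part XX a"
        "pull XX qReal (qcomp (obj C) (pr2 C) G) r_elem = im_part XX a"
      if G: "G \<in> Fun XX (obj C)" "op_of XX G = a" for G
    proof -
      note p1 = pull_r_elem[OF XX q[OF G(1) pr_C(1)]] and p2 = pull_r_elem[OF XX q[OF G(1) pr_C(2)]]
      note uni = parts_unique[OF XX p1(1) p2(1) p1(2) p2(2) op_of_parts[OF XX G(1)]]
      show "pull XX qReal (qcomp (obj C) (pr1 C) G) r_elem = re_part XX a"
        "pull XX qReal (qcomp (obj C) (pr2 C) G) r_elem = im_part XX a"
        using uni unfolding G(2) by simp_all
    qed
    show "qcomp (obj C) (pr1 C) F = qcomp (obj C) (pr1 C) F'"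
      using real_functions[OF XX pa(1,3)] u(1)[OF F] u(1)[OF F'] q[OF F(1) pr_C(1)] q[OF F'(1) pr_C(1)]
      by blast
    show "qcomp (obj C) (pr2 C) F = qcomp (obj C) (pr2 C) F'"
      using real_functions[OF XX pa(2,4)] u(2)[OF F] u(2)[OF F'] q[OF F(1) pr_C(2)] q[OF F'(1) pr_C(2)]
      by blast
  qed
  ultimately show ?thesis using H(1) by blast
qed

text \<open>Addition, multiplication and conjugation on \<open>C\<close> are definite descriptions
  of this form; this lemma resolves all three.\<close>

lemma the_function:
  assumes "quantum_set XX" "a \<in> carrier (ell XX)"
  shows "(THE F. F \<in> Fun XX (obj C) \<and> pull XX (obj C) F (s_elem C) = a) \<in> Fun XX (obj C)"
    "op_of XX (THE F. F \<in> Fun XX (obj C) \<and> pull XX (obj C) F (s_elem C) = a) = a"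
  using theI'[OF op_of_bij[OF assms]] unfolding op_of_def by blast+

lemma plus_fun: "plus_fun C D \<in> Fun (obj D) (obj C)"
    "op_of (obj D) (plus_fun C D) = op_of (obj D) (pr1 D) \<oplus>\<^bsub>ell (obj D)\<^esub> op_of (obj D) (pr2 D)"
  and times_fun: "times_fun C D \<in> Fun (obj D) (obj C)"
    "op_of (obj D) (times_fun C D) = op_of (obj D) (pr1 D) \<otimes>\<^bsub>ell (obj D)\<^esub> op_of (obj D) (pr2 D)"
  and conj_fun: "conj_fun C \<in> Fun (obj C) (obj C)"
    "op_of (obj C) (conj_fun C) = star (ell (obj C)) (s_elem C)"
proof -
  note p = op_of_in[OF obj_D pr_D(1)] op_of_in[OF obj_D pr_D(2)]
  note cl = ell_closed[OF obj_D]
  show "plus_fun C D \<in> Fun (obj D) (obj C)"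
    "op_of (obj D) (plus_fun C D) = op_of (obj D) (pr1 D) \<oplus>\<^bsub>ell (obj D)\<^esub> op_of (obj D) (pr2 D)"
    using the_function[OF obj_D cl(4)[OF p]] by (simp_all add: plus_fun_def op_of_def)
  show "times_fun C D \<in> Fun (obj D) (obj C)"
    "op_of (obj D) (times_fun C D) = op_of (obj D) (pr1 D) \<otimes>\<^bsub>ell (obj D)\<^esub> op_of (obj D) (pr2 D)"
    using the_function[OF obj_D cl(3)[OF p]] by (simp_all add: times_fun_def op_of_def)
  show "conj_fun C \<in> Fun (obj C) (obj C)"
    "op_of (obj C) (conj_fun C) = star (ell (obj C)) (s_elem C)"
    using the_function[OF obj_C ell_closed(6)[OF obj_C s_elem_in]] by (simp_all add: conj_fun_def)
qed

text \<open>The pair of projections of \<open>D\<close> is the generic pair of functions. Pulling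
  back along a pairing specialises it, so the equations that define addition and multiplication on
  \<open>D\<close> pass to arbitrary functions.\<close>

lemma op_of_pairing:
  assumes XX: "quantum_set XX" and F: "F1 \<in> Fun XX (obj C)" "F2 \<in> Fun XX (obj C)"
  shows "pull XX (obj D) (pairing D XX F1 F2) (op_of (obj D) (pr1 D)) = op_of XX F1"
    "pull XX (obj D) (pairing D XX F1 F2) (op_of (obj D) (pr2 D)) = op_of XX F2"
  by (simp_all add: op_of_qcomp[OF XX obj_D pairing(1)[OF D XX F], symmetric] pr_D pairing(2,3)[OF D XX F])

lemma Fun_add:
  assumes XX: "quantum_set XX" and F: "F1 \<in> Fun XX (obj C)" "F2 \<in> Fun XX (obj C)"
  shows "Fun_add C D XX F1 F2 \<in> Fun XX (obj C)"
    "op_of XX (Fun_add C D XX F1 F2) = op_of XX F1 \<oplus>\<^bsub>ell XX\<^esub> op_of XX F2"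
proof -
  note H = pairing(1)[OF D XX F]
  interpret P: quantum_function XX "obj D" "pairing D XX F1 F2" by (rule quantum_functionI[OF XX obj_D H])
  show "Fun_add C D XX F1 F2 \<in> Fun XX (obj C)"
    unfolding Fun_add_def by (rule qcomp_Fun[OF XX obj_D obj_C H plus_fun(1)])
  show "op_of XX (Fun_add C D XX F1 F2) = op_of XX F1 \<oplus>\<^bsub>ell XX\<^esub> op_of XX F2"
    unfolding Fun_add_def op_of_qcomp[OF XX obj_D H plus_fun(1)] plus_fun(2)
    by (simp add: P.pull_add op_of_in[OF obj_D] pr_D op_of_pairing[OF XX F])
qed

lemma Fun_mult:
  assumes XX: "quantum_set XX" and F: "F1 \<in> Fun XX (obj C)" "F2 \<in> Fun XX (obj C)"
  shows "Fun_mult C D XX F1 F2 \<in> Fun XX (obj C)"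
    "op_of XX (Fun_mult C D XX F1 F2) = op_of XX F1 \<otimes>\<^bsub>ell XX\<^esub> op_of XX F2"
proof -
  note H = pairing(1)[OF D XX F]
  interpret P: quantum_function XX "obj D" "pairing D XX F1 F2" by (rule quantum_functionI[OF XX obj_D H])
  show "Fun_mult C D XX F1 F2 \<in> Fun XX (obj C)"
    unfolding Fun_mult_def by (rule qcomp_Fun[OF XX obj_D obj_C H times_fun(1)])
  show "op_of XX (Fun_mult C D XX F1 F2) = op_of XX F1 \<otimes>\<^bsub>ell XX\<^esub> op_of XX F2"
    unfolding Fun_mult_def op_of_qcomp[OF XX obj_D H times_fun(1)] times_fun(2)
    by (simp add: P.pull_mult op_of_in[OF obj_D] pr_D op_of_pairing[OF XX F])
qed

lemma Fun_star:
  assumes XX: "quantum_set XX" and F: "F \<in> Fun XX (obj C)"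
  shows "qcomp (obj C) (conj_fun C) F \<in> Fun XX (obj C)"
    "op_of XX (qcomp (obj C) (conj_fun C) F) = star (ell XX) (op_of XX F)"
proof -
  interpret quantum_function XX "obj C" F by (rule quantum_functionI[OF XX obj_C F])
  show "qcomp (obj C) (conj_fun C) F \<in> Fun XX (obj C)"
    by (rule qcomp_Fun[OF XX obj_C obj_C F conj_fun(1)])
  show "op_of XX (qcomp (obj C) (conj_fun C) F) = star (ell XX) (op_of XX F)"
    unfolding op_of_qcomp[OF XX obj_C F conj_fun(1)] conj_fun(2)
    by (simp add: pull_star s_elem_in op_of_def)
qed

text \<open>The complex function \<open>g\<close> as an element of the algebra of the classical
  complex numbers, acting on the atom of \<open>z\<close> as the scalar \<open>g z\<close>.\<close>

definition scalar_elem :: "(complex \<Rightarrow> complex) \<Rightarrow> 'i point family" where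
  "scalar_elem g = (\<lambda>X\<in>qComplex. opscale (g (THE z. X = ell2 (ComplexPt z))) (idop X))"

lemma scalar_elem_at: "scalar_elem g (ell2 (ComplexPt z)) = opscale (g z) (idop (ell2 (ComplexPt z)))"
  by (simp add: scalar_elem_def quote_set_def)

lemma scalar_elem_in: "scalar_elem g \<in> carrier (ell qComplex)"
  unfolding scalar_elem_def
  by (rule ell_carrierI) (auto simp: quote_set_def intro!: L_closed fd_hilbert_ell2 idop_L)

lemma re_im_fun: "re_fun \<in> Fun qComplex qReal" "im_fun \<in> Fun qComplex qReal"
    "pull qComplex qReal re_fun r_elem = scalar_elem (\<lambda>z. of_real (Re z))"
    "pull qComplex qReal im_fun r_elem = scalar_elem (\<lambda>z. of_real (Im z))"
proof -
  show "re_fun \<in> Fun qComplex qReal" "im_fun \<in> Fun qComplex qReal"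
    unfolding re_fun_def im_fun_def by (auto intro!: quote_fun_Fun)
  show "pull qComplex qReal re_fun r_elem = scalar_elem (\<lambda>z. of_real (Re z))"
    unfolding re_fun_def
    by (rule pull_quote_fun[OF _ scalar_elem_in r_elem_in,
          where g = "\<lambda>p. case p of ComplexPt z \<Rightarrow> of_real (Re z) | _ \<Rightarrow> 0"])
      (auto simp: scalar_elem_at r_elem_at)
  show "pull qComplex qReal im_fun r_elem = scalar_elem (\<lambda>z. of_real (Im z))"
    unfolding im_fun_def
    by (rule pull_quote_fun[OF _ scalar_elem_in r_elem_in,
          where g = "\<lambda>p. case p of ComplexPt z \<Rightarrow> of_real (Im z) | _ \<Rightarrow> 0"])
      (auto simp: scalar_elem_at r_elem_at)
qed

text \<open>The components pull \<open>r_elem\<close> back to the functions Re and Im, which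
  recombine to the identity function.\<close>

lemma incl: "incl C \<in> Fun qComplex (obj C)" "op_of qComplex (incl C) = scalar_elem (\<lambda>z. z)"
proof -
  note P = pairing[OF C quantum_set_quote re_im_fun(1,2)]
  show "incl C \<in> Fun qComplex (obj C)" unfolding incl_def by (rule P(1))
  have "op_of qComplex (incl C) = scalar_elem (\<lambda>z. of_real (Re z)) \<oplus>\<^bsub>ell qComplex\<^esub>
      (\<i> \<odot>\<^bsub>ell qComplex\<^esub> scalar_elem (\<lambda>z. of_real (Im z)))"
    unfolding incl_def op_of_parts[OF quantum_set_quote P(1)] P(2,3) re_im_fun(3,4) ..
  also have "\<dots> = scalar_elem (\<lambda>z. z)"
  proof (rule ell_ext[of _ qComplex])
    fix X :: "'i point hilb" assume X: "X \<in> qComplex"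
    then obtain z where z: "X = ell2 (ComplexPt z)" by (auto simp: quote_set_def)
    show "(scalar_elem (\<lambda>z. of_real (Re z)) \<oplus>\<^bsub>ell qComplex\<^esub>
        (\<i> \<odot>\<^bsub>ell qComplex\<^esub> scalar_elem (\<lambda>z. of_real (Im z)))) X = scalar_elem (\<lambda>z. z) X"
      unfolding ell_apply[OF X] unfolding z scalar_elem_at
      by (simp add: complex_eq[of z, symmetric] flip: op.scale_left_distrib)
  qed (intro ell_closed[OF quantum_set_quote] scalar_elem_in)+
  finally show "op_of qComplex (incl C) = scalar_elem (\<lambda>z. z)" .
qed

text \<open>On the terminal object the operator is \<alpha> times the unit, and the pullback along
  \<open>bang XX\<close> is linear and unital.\<close>

lemma Cst:
  assumes XX: "quantum_set XX"
  shows "Cst C XX \<alpha> \<in> Fun XX (obj C)" "op_of XX (Cst C XX \<alpha>) = \<alpha> \<odot>\<^bsub>ell XX\<^esub> \<one>\<^bsub>ell XX\<^esub>"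
proof -
  let ?q = "quote_fun {Star} (\<lambda>_. ComplexPt \<alpha>)"
  note Q = quantum_set_quote
  have bang: "bang XX \<in> Fun XX qOne"
    unfolding bang_def by (rule theI'[OF terminal_functions[OF XX]])
  have q: "?q \<in> Fun qOne qComplex" by (rule quote_fun_Fun) auto
  note qb = qcomp_Fun[OF XX Q Q bang q]
  show "Cst C XX \<alpha> \<in> Fun XX (obj C)"
    unfolding Cst_def by (rule qcomp_Fun[OF XX Q obj_C qb incl(1)])
  have one: "\<alpha> \<odot>\<^bsub>ell qOne\<^esub> \<one>\<^bsub>ell qOne\<^esub> \<in> carrier (ell qOne)"
    by (intro ell_closed[OF Q])
  have "pull qOne qComplex ?q (scalar_elem (\<lambda>z. z)) = \<alpha> \<odot>\<^bsub>ell qOne\<^esub> \<one>\<^bsub>ell qOne\<^esub>"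
    by (rule pull_quote_fun[OF _ one scalar_elem_in, where g = "\<lambda>_. \<alpha>"])
      (auto simp: scalar_elem_at ell_apply quote_set_def)
  moreover have "pull XX qOne (bang XX) (\<alpha> \<odot>\<^bsub>ell qOne\<^esub> \<one>\<^bsub>ell qOne\<^esub>) = \<alpha> \<odot>\<^bsub>ell XX\<^esub> \<one>\<^bsub>ell XX\<^esub>"
  proof -
    interpret quantum_function XX qOne "bang XX" by (rule quantum_functionI[OF XX Q bang])
    show ?thesis by (simp add: pull_smult pull_one ell_closed Q)
  qed
  ultimately show "op_of XX (Cst C XX \<alpha>) = \<alpha> \<odot>\<^bsub>ell XX\<^esub> \<one>\<^bsub>ell XX\<^esub>"
    unfolding Cst_def op_of_qcomp[OF XX Q qb incl(1)] incl(2)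
      pull_qcomp[OF XX Q Q bang q scalar_elem_in] by simp
qed

end

section \<open>Transport of the algebra structure\<close>

lemma star_algebraD:
  assumes "unital_star_algebra A"
  shows "Module.module complex_ring A" "Ring.ring A"
    "\<lbrakk>x \<in> carrier A; y \<in> carrier A\<rbrakk> \<Longrightarrow> (c \<odot>\<^bsub>A\<^esub> x) \<otimes>\<^bsub>A\<^esub> y = c \<odot>\<^bsub>A\<^esub> (x \<otimes>\<^bsub>A\<^esub> y)"
    "\<lbrakk>x \<in> carrier A; y \<in> carrier A\<rbrakk> \<Longrightarrow> x \<otimes>\<^bsub>A\<^esub> (c \<odot>\<^bsub>A\<^esub> y) = c \<odot>\<^bsub>A\<^esub> (x \<otimes>\<^bsub>A\<^esub> y)"
    "x \<in> carrier A \<Longrightarrow> star A x \<in> carrier A"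
    "x \<in> carrier A \<Longrightarrow> star A (star A x) = x"
    "\<lbrakk>x \<in> carrier A; y \<in> carrier A\<rbrakk> \<Longrightarrow> star A (x \<oplus>\<^bsub>A\<^esub> y) = star A x \<oplus>\<^bsub>A\<^esub> star A y"
    "\<lbrakk>x \<in> carrier A; y \<in> carrier A\<rbrakk> \<Longrightarrow> star A (x \<otimes>\<^bsub>A\<^esub> y) = star A y \<otimes>\<^bsub>A\<^esub> star A x"
    "x \<in> carrier A \<Longrightarrow> star A (c \<odot>\<^bsub>A\<^esub> x) = cnj c \<odot>\<^bsub>A\<^esub> star A x"
  using assms unfolding unital_star_algebra_def by blast+

text \<open>Each law holds in \<open>A\<close> because both sides have the same image under the
  injective \<eta>. Among the algebra laws, surjectivity serves for additive inverses, which are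
  obtained as preimages.\<close>

lemma star_algebra_transport:
  fixes A :: "'a star_algebra" and B :: "'b star_algebra"
  assumes B: "unital_star_algebra B" and \<eta>: "bij_betw \<eta> (carrier A) (carrier B)"
    and closed: "\<one>\<^bsub>A\<^esub> \<in> carrier A" "\<zero>\<^bsub>A\<^esub> \<in> carrier A"
      "\<And>x y. \<lbrakk>x \<in> carrier A; y \<in> carrier A\<rbrakk> \<Longrightarrow> x \<otimes>\<^bsub>A\<^esub> y \<in> carrier A"
      "\<And>x y. \<lbrakk>x \<in> carrier A; y \<in> carrier A\<rbrakk> \<Longrightarrow> x \<oplus>\<^bsub>A\<^esub> y \<in> carrier A"
      "\<And>c x. x \<in> carrier A \<Longrightarrow> c \<odot>\<^bsub>A\<^esub> x \<in> carrier A"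
      "\<And>x. x \<in> carrier A \<Longrightarrow> star A x \<in> carrier A"
    and hom: "\<eta> \<one>\<^bsub>A\<^esub> = \<one>\<^bsub>B\<^esub>" "\<eta> \<zero>\<^bsub>A\<^esub> = \<zero>\<^bsub>B\<^esub>"
      "\<And>x y. \<lbrakk>x \<in> carrier A; y \<in> carrier A\<rbrakk> \<Longrightarrow> \<eta> (x \<otimes>\<^bsub>A\<^esub> y) = \<eta> x \<otimes>\<^bsub>B\<^esub> \<eta> y"
      "\<And>x y. \<lbrakk>x \<in> carrier A; y \<in> carrier A\<rbrakk> \<Longrightarrow> \<eta> (x \<oplus>\<^bsub>A\<^esub> y) = \<eta> x \<oplus>\<^bsub>B\<^esub> \<eta> y"
      "\<And>c x. x \<in> carrier A \<Longrightarrow> \<eta> (c \<odot>\<^bsub>A\<^esub> x) = c \<odot>\<^bsub>B\<^esub> \<eta> x"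
      "\<And>x. x \<in> carrier A \<Longrightarrow> \<eta> (star A x) = star B (\<eta> x)"
  shows "unital_star_algebra A" "\<eta> \<in> star_iso A B"
proof -
  interpret B: Ring.ring B by (rule star_algebraD(2)[OF B])
  interpret BM: Module.module complex_ring B by (rule star_algebraD(1)[OF B])
  have in_B: "\<eta> x \<in> carrier B" if "x \<in> carrier A" for x
    using \<eta> that by (rule bij_betw_apply)
  have eqI: "x = y" if "\<eta> x = \<eta> y" "x \<in> carrier A" "y \<in> carrier A" for x y
    using \<eta> that by (auto simp: bij_betw_def dest: inj_onD)
  note rules = closed hom in_B star_algebraD(3-)[OF B]
  have UNIV: "c \<in> carrier complex_ring" for c by (simp add: complex_ring_def)
  have group: "abelian_group A"
  proof (rule abelian_groupI)
    fix x assume x: "x \<in> carrier A"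
    have "\<ominus>\<^bsub>B\<^esub> \<eta> x \<in> \<eta> ` carrier A"
      using \<eta> B.a_inv_closed[OF in_B[OF x]] by (simp add: bij_betw_def)
    then obtain y where y: "y \<in> carrier A" "\<eta> y = \<ominus>\<^bsub>B\<^esub> \<eta> x" by (metis imageE)
    have "y \<oplus>\<^bsub>A\<^esub> x = \<zero>\<^bsub>A\<^esub>"
      by (rule eqI) (simp_all add: rules x y B.l_neg)
    then show "\<exists>y\<in>carrier A. y \<oplus>\<^bsub>A\<^esub> x = \<zero>\<^bsub>A\<^esub>" using y by blast
  next
    fix x y z assume xyz: "x \<in> carrier A" "y \<in> carrier A" "z \<in> carrier A"
    show "x \<oplus>\<^bsub>A\<^esub> y \<oplus>\<^bsub>A\<^esub> z = x \<oplus>\<^bsub>A\<^esub> (y \<oplus>\<^bsub>A\<^esub> z)"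
      by (rule eqI) (simp_all add: rules xyz B.a_assoc)
  next
    fix x y assume xy: "x \<in> carrier A" "y \<in> carrier A"
    show "x \<oplus>\<^bsub>A\<^esub> y = y \<oplus>\<^bsub>A\<^esub> x"
      by (rule eqI) (simp_all add: rules xy B.a_comm)
  next
    fix x assume x: "x \<in> carrier A"
    show "\<zero>\<^bsub>A\<^esub> \<oplus>\<^bsub>A\<^esub> x = x" by (rule eqI) (simp_all add: rules x)
  qed (use closed in auto)
  have monoid: "monoid A"
  proof (rule monoidI)
    fix x y z assume xyz: "x \<in> carrier A" "y \<in> carrier A" "z \<in> carrier A"
    show "x \<otimes>\<^bsub>A\<^esub> y \<otimes>\<^bsub>A\<^esub> z = x \<otimes>\<^bsub>A\<^esub> (y \<otimes>\<^bsub>A\<^esub> z)"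
      by (rule eqI) (simp_all add: rules xyz B.m_assoc)
  next
    fix x assume x: "x \<in> carrier A"
    show "\<one>\<^bsub>A\<^esub> \<otimes>\<^bsub>A\<^esub> x = x" "x \<otimes>\<^bsub>A\<^esub> \<one>\<^bsub>A\<^esub> = x" by (rule eqI; simp add: rules x)+
  qed (use closed in auto)
  have "Ring.ring A"
  proof (rule ringI[OF group monoid])
    fix x y z assume xyz: "x \<in> carrier A" "y \<in> carrier A" "z \<in> carrier A"
    show "(x \<oplus>\<^bsub>A\<^esub> y) \<otimes>\<^bsub>A\<^esub> z = x \<otimes>\<^bsub>A\<^esub> z \<oplus>\<^bsub>A\<^esub> y \<otimes>\<^bsub>A\<^esub> z"
      "z \<otimes>\<^bsub>A\<^esub> (x \<oplus>\<^bsub>A\<^esub> y) = z \<otimes>\<^bsub>A\<^esub> x \<oplus>\<^bsub>A\<^esub> z \<otimes>\<^bsub>A\<^esub> y"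
      by (rule eqI; simp add: rules xyz B.l_distr B.r_distr)+
  qed
  moreover have "Module.module complex_ring A"
  proof (rule Module.moduleI[OF cring_complex_ring group])
    fix a b x y assume xy: "x \<in> carrier A" "y \<in> carrier A"
    show "(a \<oplus>\<^bsub>complex_ring\<^esub> b) \<odot>\<^bsub>A\<^esub> x = a \<odot>\<^bsub>A\<^esub> x \<oplus>\<^bsub>A\<^esub> b \<odot>\<^bsub>A\<^esub> x"
      "a \<odot>\<^bsub>A\<^esub> (x \<oplus>\<^bsub>A\<^esub> y) = a \<odot>\<^bsub>A\<^esub> x \<oplus>\<^bsub>A\<^esub> a \<odot>\<^bsub>A\<^esub> y"
      "(a \<otimes>\<^bsub>complex_ring\<^esub> b) \<odot>\<^bsub>A\<^esub> x = a \<odot>\<^bsub>A\<^esub> (b \<odot>\<^bsub>A\<^esub> x)"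
      by (rule eqI; simp add: rules xy UNIV BM.smult_l_distr BM.smult_r_distr BM.smult_assoc1)+
  next
    fix x assume x: "x \<in> carrier A"
    show "\<one>\<^bsub>complex_ring\<^esub> \<odot>\<^bsub>A\<^esub> x = x" by (rule eqI; simp add: rules x)
  qed (rule closed)
  moreover have "(c \<odot>\<^bsub>A\<^esub> x) \<otimes>\<^bsub>A\<^esub> y = c \<odot>\<^bsub>A\<^esub> (x \<otimes>\<^bsub>A\<^esub> y)" "x \<otimes>\<^bsub>A\<^esub> (c \<odot>\<^bsub>A\<^esub> y) = c \<odot>\<^bsub>A\<^esub> (x \<otimes>\<^bsub>A\<^esub> y)"
      "star A (x \<oplus>\<^bsub>A\<^esub> y) = star A x \<oplus>\<^bsub>A\<^esub> star A y" "star A (x \<otimes>\<^bsub>A\<^esub> y) = star A y \<otimes>\<^bsub>A\<^esub> star A x"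
    if "x \<in> carrier A" "y \<in> carrier A" for c x y
    by (rule eqI; simp add: rules that)+
  moreover have "star A (star A x) = x" "star A (c \<odot>\<^bsub>A\<^esub> x) = cnj c \<odot>\<^bsub>A\<^esub> star A x"
    if "x \<in> carrier A" for c x
    by (rule eqI; simp add: rules that)+
  ultimately show "unital_star_algebra A"
    unfolding unital_star_algebra_def using closed(6) by simp
  show "\<eta> \<in> star_iso A B"
    using \<eta> by (simp add: star_iso_def star_hom_def ring_hom_def hom in_B)
qed

text \<open>Under the injective \<open>\<eta>'\<close> both sides of each homomorphism law for
  \<open>h\<close> become those for the composite of the homomorphisms \<eta> and
  \<open>g\<close>.\<close>

lemma star_hom_reflect:
  assumes A: "unital_star_algebra A" "unital_star_algebra A'"
    and \<eta>: "\<eta> \<in> star_iso A B" "\<eta>' \<in> star_iso A' B'" and g: "g \<in> star_hom B B'"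
    and h: "\<And>x. x \<in> carrier A \<Longrightarrow> h x \<in> carrier A'"
    and comm: "\<And>x. x \<in> carrier A \<Longrightarrow> \<eta>' (h x) = g (\<eta> x)"
  shows "h \<in> star_hom A A'"
proof -
  interpret A: Ring.ring A by (rule star_algebraD(2)[OF A(1)])
  interpret A': Ring.ring A' by (rule star_algebraD(2)[OF A(2)])
  interpret AM: Module.module complex_ring A by (rule star_algebraD(1)[OF A(1)])
  interpret AM': Module.module complex_ring A' by (rule star_algebraD(1)[OF A(2)])
  have UNIV: "c \<in> carrier complex_ring" for c by (simp add: complex_ring_def)
  have eqI: "x = y" if "\<eta>' x = \<eta>' y" "x \<in> carrier A'" "y \<in> carrier A'" for x y
    using \<eta>(2) that by (auto simp: star_iso_def bij_betw_def dest: inj_onD)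
  have in_B: "\<eta> x \<in> carrier B" if "x \<in> carrier A" for x
    using \<eta>(1) that by (auto simp: star_iso_def star_hom_def ring_hom_def)
  note rules = UNIV h comm in_B A.m_closed A.a_closed A.one_closed AM.smult_closed star_algebraD(5)[OF A(1)]
    A'.m_closed A'.a_closed A'.one_closed AM'.smult_closed star_algebraD(5)[OF A(2)]
  have \<eta>_hom: "\<eta> (x \<otimes>\<^bsub>A\<^esub> y) = \<eta> x \<otimes>\<^bsub>B\<^esub> \<eta> y" "\<eta> (x \<oplus>\<^bsub>A\<^esub> y) = \<eta> x \<oplus>\<^bsub>B\<^esub> \<eta> y"
      "\<eta> (c \<odot>\<^bsub>A\<^esub> x) = c \<odot>\<^bsub>B\<^esub> \<eta> x" "\<eta> (star A x) = star B (\<eta> x)" "\<eta> \<one>\<^bsub>A\<^esub> = \<one>\<^bsub>B\<^esub>"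
    if "x \<in> carrier A" "y \<in> carrier A" for x y c
    using \<eta>(1) that by (auto simp: star_iso_def star_hom_def ring_hom_def)
  have \<eta>'_hom: "\<eta>' (x \<otimes>\<^bsub>A'\<^esub> y) = \<eta>' x \<otimes>\<^bsub>B'\<^esub> \<eta>' y" "\<eta>' (x \<oplus>\<^bsub>A'\<^esub> y) = \<eta>' x \<oplus>\<^bsub>B'\<^esub> \<eta>' y"
      "\<eta>' (c \<odot>\<^bsub>A'\<^esub> x) = c \<odot>\<^bsub>B'\<^esub> \<eta>' x" "\<eta>' (star A' x) = star B' (\<eta>' x)" "\<eta>' \<one>\<^bsub>A'\<^esub> = \<one>\<^bsub>B'\<^esub>"
    if "x \<in> carrier A'" "y \<in> carrier A'" for x y c
    using \<eta>(2) that by (auto simp: star_iso_def star_hom_def ring_hom_def)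
  have g_hom: "g (x \<otimes>\<^bsub>B\<^esub> y) = g x \<otimes>\<^bsub>B'\<^esub> g y" "g (x \<oplus>\<^bsub>B\<^esub> y) = g x \<oplus>\<^bsub>B'\<^esub> g y"
      "g (c \<odot>\<^bsub>B\<^esub> x) = c \<odot>\<^bsub>B'\<^esub> g x" "g (star B x) = star B' (g x)" "g \<one>\<^bsub>B\<^esub> = \<one>\<^bsub>B'\<^esub>"
    if "x \<in> carrier B" "y \<in> carrier B" for x y c
    using g that by (auto simp: star_hom_def ring_hom_def)
  have "h (x \<otimes>\<^bsub>A\<^esub> y) = h x \<otimes>\<^bsub>A'\<^esub> h y" "h (x \<oplus>\<^bsub>A\<^esub> y) = h x \<oplus>\<^bsub>A'\<^esub> h y"
    if "x \<in> carrier A" "y \<in> carrier A" for x y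
    by (rule eqI; simp add: rules that \<eta>_hom(1,2) \<eta>'_hom(1,2) g_hom(1,2))+
  moreover have "h (c \<odot>\<^bsub>A\<^esub> x) = c \<odot>\<^bsub>A'\<^esub> h x" "h (star A x) = star A' (h x)"
    if x: "x \<in> carrier A" for x c
    by (rule eqI; simp add: rules x \<eta>_hom(3,4)[OF x x] \<eta>'_hom(3,4)[OF h h, OF x x] g_hom(3,4)[OF in_B in_B, OF x x])+
  moreover have "h \<one>\<^bsub>A\<^esub> = \<one>\<^bsub>A'\<^esub>"
  proof (rule eqI)
    note 1 = A.one_closed
    show "\<eta>' (h \<one>\<^bsub>A\<^esub>) = \<eta>' \<one>\<^bsub>A'\<^esub>"
      unfolding comm[OF 1] \<eta>_hom(5)[OF 1 1] g_hom(5)[OF in_B in_B, OF 1 1] \<eta>'_hom(5)[OF h h, OF 1 1] ..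
  qed (simp_all add: rules)
  ultimately show ?thesis
    using h by (simp add: star_hom_def ring_hom_def Pi_def)
qed

context quantum_complex
begin

lemma op_of_bij_betw:
  assumes "quantum_set XX"
  shows "bij_betw (op_of XX) (Fun XX (obj C)) (carrier (ell XX))"
proof (rule bij_betwI')
  show "op_of XX F = op_of XX G \<longleftrightarrow> F = G" if "F \<in> Fun XX (obj C)" "G \<in> Fun XX (obj C)" for F G
    using op_of_bij[OF assms op_of_in[OF assms that(1)]] that by metis
  show "op_of XX F \<in> carrier (ell XX)" if "F \<in> Fun XX (obj C)" for F
    by (rule op_of_in[OF assms that])
  show "\<exists>F\<in>Fun XX (obj C). a = op_of XX F" if "a \<in> carrier (ell XX)" for a
    using op_of_bij[OF assms that] by metis
qed

lemma Fun_alg: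
  assumes XX: "quantum_set XX"
  shows "unital_star_algebra (Fun_alg C D XX)" "op_of XX \<in> star_iso (Fun_alg C D XX) (ell XX)"
proof -
  interpret E: Module.module complex_ring "ell XX"
    by (rule star_algebraD(1)[OF unital_star_algebra_ell[OF XX]])
  interpret R: Ring.ring "ell XX"
    by (rule star_algebraD(2)[OF unital_star_algebra_ell[OF XX]])
  note B = unital_star_algebra_ell[OF XX]
  \<comment> \<open>The unit and zero of \<open>Fun_alg\<close> are constant functions, whose
    operators are these multiples of the unit.\<close>
  have 1: "1 \<odot>\<^bsub>ell XX\<^esub> \<one>\<^bsub>ell XX\<^esub> = \<one>\<^bsub>ell XX\<^esub>"
    using E.smult_one[OF R.one_closed] by (simp add: complex_ring_def)
  have 0: "0 \<odot>\<^bsub>ell XX\<^esub> \<one>\<^bsub>ell XX\<^esub> = \<zero>\<^bsub>ell XX\<^esub>"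
    using E.smult_l_null[OF R.one_closed] by (simp add: complex_ring_def)
  \<comment> \<open>Scalar multiplication of functions is multiplication by a constant function, so
    it has to be matched with the scalar action on operators.\<close>
  have smult: "(c \<odot>\<^bsub>ell XX\<^esub> \<one>\<^bsub>ell XX\<^esub>) \<otimes>\<^bsub>ell XX\<^esub> op_of XX F = c \<odot>\<^bsub>ell XX\<^esub> op_of XX F"
    if "F \<in> Fun XX (obj C)" for c F
    using star_algebraD(3)[OF B R.one_closed op_of_in[OF XX that]] R.l_one[OF op_of_in[OF XX that]] by simp
  have bij: "bij_betw (op_of XX) (carrier (Fun_alg C D XX)) (carrier (ell XX))"
    using op_of_bij_betw[OF XX] by (simp add: Fun_alg_def)
  note facts = star_algebra_transport[OF B bij]
  show "unital_star_algebra (Fun_alg C D XX)"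
    by (rule facts) (simp_all add: Fun_alg_def Cst[OF XX] Fun_add[OF XX] Fun_mult[OF XX] Fun_star[OF XX] 0 1 smult)
  show "op_of XX \<in> star_iso (Fun_alg C D XX) (ell XX)"
    by (rule facts) (simp_all add: Fun_alg_def Cst[OF XX] Fun_add[OF XX] Fun_mult[OF XX] Fun_star[OF XX] 0 1 smult)
qed

lemma op_of_inj:
  assumes "quantum_set XX" "F \<in> Fun XX (obj C)" "G \<in> Fun XX (obj C)" "op_of XX F = op_of XX G"
  shows "F = G"
  using op_of_bij_betw[OF assms(1)] assms(2-4) by (auto simp: bij_betw_def dest: inj_onD)

text \<open>Since \<open>op_of\<close> is injective and natural, the functor laws for \<open>precomp\<close> follow from those for
  \<open>pull\<close>.\<close>

lemma contravariant_functor_precomp: "contravariant_functor (Fun_alg C D) precomp"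
  unfolding contravariant_functor_def
proof (intro conjI allI impI ballI)
  note carr = Fun_alg_def
  fix XX YY ZZ :: "'i point qset" and F G
  assume XX: "quantum_set XX"
  show "unital_star_algebra (Fun_alg C D XX)" by (rule Fun_alg(1)[OF XX])
  show "precomp XX XX (qid XX) x = x" if "x \<in> carrier (Fun_alg C D XX)" for x
  proof -
    have x: "x \<in> Fun XX (obj C)" using that by (simp add: carr)
    show ?thesis
      unfolding precomp_def
      by (rule op_of_inj[OF XX qcomp_Fun[OF XX XX obj_C qid_Fun[OF XX] x] x])
        (simp add: op_of_qcomp XX x qid_Fun pull_qid op_of_in)
  qed
  assume YY: "quantum_set YY"
  show "precomp XX YY F \<in> star_hom (Fun_alg C D YY) (Fun_alg C D XX)" if F: "F \<in> Fun XX YY"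
  proof (rule star_hom_reflect[OF Fun_alg(1)[OF YY] Fun_alg(1)[OF XX] Fun_alg(2)[OF YY] Fun_alg(2)[OF XX]])
    show "pull XX YY F \<in> star_hom (ell YY) (ell XX)"
      by (rule quantum_function.pull_star_hom[OF quantum_functionI[OF XX YY F]])
    fix x assume "x \<in> carrier (Fun_alg C D YY)"
    then have x: "x \<in> Fun YY (obj C)" by (simp add: carr)
    show "precomp XX YY F x \<in> carrier (Fun_alg C D XX)"
      using qcomp_Fun[OF XX YY obj_C F x] by (simp add: carr precomp_def)
    show "op_of XX (precomp XX YY F x) = pull XX YY F (op_of YY x)"
      unfolding precomp_def by (rule op_of_qcomp[OF XX YY F x])
  qed
  assume ZZ: "quantum_set ZZ" and F: "F \<in> Fun XX YY" and G: "G \<in> Fun YY ZZ"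
  fix x assume "x \<in> carrier (Fun_alg C D ZZ)"
  then have x: "x \<in> Fun ZZ (obj C)" by (simp add: carr)
  note GF = qcomp_Fun[OF XX YY ZZ F G] and xG = qcomp_Fun[OF YY ZZ obj_C G x]
  show "precomp XX ZZ (qcomp YY G F) x = precomp XX YY F (precomp YY ZZ G x)"
    unfolding precomp_def
    by (rule op_of_inj[OF XX qcomp_Fun[OF XX ZZ obj_C GF x] qcomp_Fun[OF XX YY obj_C F xG]])
      (simp add: op_of_qcomp XX YY ZZ F G GF x xG pull_qcomp op_of_in)
qed

text \<open>The naturality square is functoriality of the pullback, applied to the single element
  \<open>s_elem C\<close>.\<close>

lemma natural_isomorphism_op_of: "natural_isomorphism (Fun_alg C D) precomp ell pull op_of"
  unfolding natural_isomorphism_def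
  by (simp add: Fun_alg(2) precomp_def) (simp add: Fun_alg_def op_of_qcomp)

end

theorem theorem11p9:
  fixes C D :: "'i point qproduct"
  assumes "is_product qReal qReal C"
    and "is_product (obj C) (obj C) D"
  shows "contravariant_functor (Fun_alg C D) precomp \<and>
         contravariant_functor (ell :: 'i point qset \<Rightarrow> 'i point family star_algebra) pull \<and>
         natural_isomorphism (Fun_alg C D) precomp ell pull
           (\<lambda>XX F. pull XX (obj C) F (s_elem C))"
proof -
  interpret quantum_complex C D by unfold_locales (rule assms)+
  have "(\<lambda>XX F. pull XX (obj C) F (s_elem C)) = op_of" by (intro ext) (simp add: op_of_def)
  then show ?thesis
    using contravariant_functor_precomp contravariant_functor_ell natural_isomorphism_op_of by simp
qed

end
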